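(* Let $\lambda/\mu$ and $\tilde\lambda/\tilde\mu$ be skew partitions whose diagrams coincide up to translation. Then \[c_{\mu,\lambda}\, c'_{\lambda,\mu}\, J_{\tilde\lambda/\tilde\mu} =c_{\tilde\mu,\tilde\lambda}\, c'_{\tilde\lambda,\tilde\mu}\, J_{\lambda/\mu},\] as symmetric functions with coefficients in $\mathbb Q(\alpha)$.
   Context: Partitions and diagrams: a partition $\lambda=(\lambda_1\ge\lambda_2\ge\cdots)$ has diagram the set of boxes $(i,j)$ (row $i$, column $j$) with $1\le j\le\lambda_i$; $\lambda'$ is the transposed partition, $\ell(\lambda)$ the number of nonzero parts, $|\lambda|$ the sum of parts. $\mu\subset\lambda$ means containment of diagrams (equality allowed); a skew partition $\lambda/\mu$ is a pair $\mu\subset\lambda$. Jack functions: work in the ring of symmetric functions in $x=(x_1,x_2,\dots)$ over $\mathbb Q(\alpha)$, with the scalar product for which the power sums $p_\lambda$ are pairwise orthogonal and $\langle p_\lambda,p_\lambda\rangle=z_\lambda\alpha^{\ell(\lambda)}$, where $z_\lambda=\prod_i i^{k_i}k_i!$ and $k_i$ is the number of parts of $\lambda$ equal to $i$. The Jack symmetric functions $J_\lambda=J_\lambda(x;\alpha)$ are the unique symmetric functions that are pairwise orthogonal, of the form $J_\lambda=\sum_{\mu\le\lambda}v_{\lambda,\mu}(\alpha)m_\mu$ ($m_\mu$ the monomial symmetric functions, $\le$ the dominance order), and normalized by $v_{\lambda,(1^n)}=n!$ for $n=|\lambda|$. The skew Jack function $J_{\lambda/\mu}$ is defined by $\langle J_{\lambda/\mu},J_\nu\rangle=\langle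 J_\lambda,J_\mu J_\nu\rangle$ for all partitions $\nu$. For $s=(i,j)\in\lambda$ the arm and leg are $a_{\lambda,s}=\lambda_i-j$ and $\ell_{\lambda,s}=\lambda'_j-i$. For $\mu\subset\lambda$ put \[c_{\mu,\lambda}=\prod_{s\in\mu}\bigl(a_{\mu,s}\,\alpha+\ell_{\lambda,s}+1\bigr),\qquad c'_{\lambda,\mu}=\prod_{s\in\mu}\bigl((a_{\lambda,s}+1)\alpha+\ell_{\mu,s}\bigr).\] Coincidence up to translation: the diagrams of $\lambda/\mu$ and $\tilde\lambda/\tilde\mu$ coincide up to translation if one is obtained from the other by a finite sequence of steps, each of which adds or removes an empty row at the top or an empty column at the left. Here removing an empty top row means: if $\lambda_1=\mu_1$, replace $\lambda/\mu$ by $(\lambda_2,\lambda_3,\dots)/(\mu_2,\mu_3,\dots)$; removing an empty leftmost column means: if $\lambda'_1=\mu'_1$, delete the first column from both $\lambda$ and $\mu$; adding is the inverse operation. *)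

theory Defs
  imports "HOL-Library.Multiset" "HOL-Computational_Algebra.Computational_Algebra"
begin

section \<open>Partitions\<close>

text \<open>
  Rows and columns are numbered from \<open>0\<close>: the part \<open>\<lambda>\<^sub>i\<close> of the usual notation is \<open>part \<lambda> (i - 1)\<close>,
  and the box \<open>(i, j)\<close> of the usual notation is the pair \<open>(i - 1, j - 1)\<close>.
\<close>

typedef partition = "{p :: nat \<Rightarrow> nat. antimono p \<and> finite {i. p i \<noteq> 0}}"
  morphisms part Abs_partition
proof
  show "(\<lambda>_. 0) \<in> {p :: nat \<Rightarrow> nat. antimono p \<and> finite {i. p i \<noteq> 0}}"
    by (simp add: antimono_def)
qed

setup_lifting type_definition_partition

lemma antimono_part: "antimono (part l)"
  using part[of l] by simp

lemma finite_support_part: "finite {i. part l i \<noteq> 0}"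
  using part[of l] by simp

lemma partition_eqI: "(\<And>i. part l i = part m i) \<Longrightarrow> l = m"
  by (metis ext part_inject)

lift_definition transpose :: "partition \<Rightarrow> partition"
  is "\<lambda>p j. card {i. j < p i}"
proof -
  fix p :: "nat \<Rightarrow> nat"
  assume p: "antimono p \<and> finite {i. p i \<noteq> 0}"
  have fin: "finite {i. j < p i}" for j
    by (rule finite_subset[of _ "{i. p i \<noteq> 0}"]) (use p in auto)
  have "antimono (\<lambda>j. card {i. j < p i})"
    unfolding antimono_def by (intro allI impI card_mono[OF fin]) auto
  moreover have "p i \<le> p 0" for i
    using p by (simp add: antimono_def)
  then have "{j. card {i. j < p i} \<noteq> 0} \<subseteq> {..<p 0}"
    by (auto simp: card_eq_0_iff intro: less_le_trans)
  then have "finite {j. card {i. j < p i} \<noteq> 0}"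
    by (rule finite_subset) simp
  ultimately show "antimono (\<lambda>j. card {i. j < p i}) \<and> finite {j. card {i. j < p i} \<noteq> 0}"
    by blast
qed

definition num_parts :: "partition \<Rightarrow> nat" where
  "num_parts l = card {i. part l i \<noteq> 0}"

definition weight :: "partition \<Rightarrow> nat" where
  "weight l = (\<Sum>i | part l i \<noteq> 0. part l i)"

definition parts_mset :: "partition \<Rightarrow> nat multiset" where
  "parts_mset l = image_mset (part l) (mset_set {i. part l i \<noteq> 0})"

definition diagram :: "partition \<Rightarrow> (nat \<times> nat) set" where
  "diagram l = {(i, j). j < part l i}"

definition contained :: "partition \<Rightarrow> partition \<Rightarrow> bool" where
  "contained m l \<longleftrightarrow> diagram m \<subseteq> diagram l"

definition dominated :: "partition \<Rightarrow> partition \<Rightarrow> bool" where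
  "dominated m l \<longleftrightarrow> weight m = weight l \<and> (\<forall>k. (\<Sum>i<k. part m i) \<le> (\<Sum>i<k. part l i))"

lift_definition single_column :: "nat \<Rightarrow> partition"
  is "\<lambda>n i. if i < n then 1 else 0"
  by (auto simp: antimono_def)

lemma finite_diagram: "finite (diagram l)"
proof -
  have "diagram l = Sigma {i. part l i \<noteq> 0} (\<lambda>i. {..<part l i})"
    by (auto simp: diagram_def)
  then show ?thesis
    using finite_support_part by (simp only: finite_SigmaI finite_lessThan)
qed

lemma part_eq_0_if_weight_le:
  assumes "weight l \<le> i"
  shows "part l i = 0"
proof (rule ccontr)
  assume "part l i \<noteq> 0"
  then have *: "part l j \<ge> 1" if "j \<le> i" for j
    using antimonoD[OF antimono_part that, of l] by linarith
  have "Suc i = (\<Sum>j\<le>i. 1)" by simp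
  also have "\<dots> \<le> (\<Sum>j\<le>i. part l j)"
    using * by (intro sum_mono) auto
  also have "\<dots> \<le> weight l"
    unfolding weight_def
    by (rule sum_mono2[OF finite_support_part]) (use * in force)+
  finally show False using assms by simp
qed

lemma part_le_weight: "part l i \<le> weight l"
proof (cases "part l i = 0")
  case False
  then show ?thesis
    unfolding weight_def by (intro member_le_sum finite_support_part) auto
qed simp

lemma finite_dominated: "finite {m. dominated m l}"
proof -
  let ?n = "weight l"
  have "part ` {m. dominated m l} \<subseteq>
      {f. \<forall>i. (i \<in> {..<?n} \<longrightarrow> f i \<in> {..?n}) \<and> (i \<notin> {..<?n} \<longrightarrow> f i = 0)}"
  proof (intro image_subsetI CollectI conjI allI impI)
    fix m i assume "m \<in> {m. dominated m l}"
    then have w: "weight m = weight l" by (simp add: dominated_def)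
    show "part m i \<in> {..weight l}" using part_le_weight[of m i] w by simp
    show "part m i = 0" if "i \<notin> {..<weight l}" using that w by (intro part_eq_0_if_weight_le) simp
  qed
  moreover have "finite \<dots>"
    by (rule finite_set_of_finite_funs; simp)
  ultimately have "finite (part ` {m. dominated m l})"
    by (rule finite_subset)
  then show ?thesis
    by (rule finite_imageD) (auto simp: inj_on_def part_inject)
qed


section \<open>The ring of symmetric functions\<close>

text \<open>
  Symmetric functions are formal power series of bounded degree in \<open>x\<^sub>0, x\<^sub>1, \<dots>\<close> that are
  invariant under permutation of the variables. The monomial \<open>x\<^sub>i \<cdot> x\<^sub>j \<cdot> \<dots>\<close> is encoded by the
  multiset \<open>{#i, j, \<dots>#}\<close> of the indices of its variables, and a series by its coefficients.
\<close>

typedef (overloaded) 'a symfun =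
  "{f :: nat multiset \<Rightarrow> 'a :: zero.
      (\<forall>\<pi> M. bij \<pi> \<longrightarrow> f (image_mset \<pi> M) = f M) \<and> (\<exists>d. \<forall>M. f M \<noteq> 0 \<longrightarrow> size M \<le> d)}"
  morphisms sf_coeff Abs_symfun
proof
  show "(\<lambda>_. 0) \<in> {f :: nat multiset \<Rightarrow> 'a :: zero.
      (\<forall>\<pi> M. bij \<pi> \<longrightarrow> f (image_mset \<pi> M) = f M) \<and> (\<exists>d. \<forall>M. f M \<noteq> 0 \<longrightarrow> size M \<le> d)}"
    by simp
qed

setup_lifting type_definition_symfun

lemma symfun_eqI: "(\<And>M. sf_coeff f M = sf_coeff g M) \<Longrightarrow> f = g"
  by (metis ext sf_coeff_inject)

lemma finite_submultisets: "finite {A :: 'b multiset. A \<subseteq># M}"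
proof (induction M)
  case empty
  have "{A :: 'b multiset. A \<subseteq># {#}} = {{#}}" by auto
  then show ?case by simp
next
  case (add x M)
  have "A \<in> {A. A \<subseteq># M} \<union> add_mset x ` {A. A \<subseteq># M}" if A: "A \<subseteq># add_mset x M" for A
  proof (cases "x \<in># A")
    case True
    then obtain B where "A = add_mset x B" by (metis insert_DiffM)
    with A show ?thesis by auto
  next
    case False
    with A have "A \<subseteq># M"
      by (metis diff_single_trivial subset_eq_diff_conv add_mset_add_single)
    then show ?thesis by blast
  qed
  then have "{A. A \<subseteq># add_mset x M} \<subseteq> {A. A \<subseteq># M} \<union> add_mset x ` {A. A \<subseteq># M}" by blast
  then show ?case using add.IH by (meson finite_UnI finite_imageI finite_subset)
qed

lemma double_diff_submset: "A \<subseteq># M \<Longrightarrow> M - (M - A) = (A :: 'b multiset)"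
  by (simp add: multiset_eq_iff subseteq_mset_def)

lemma sum_submultisets_swap:
  "(\<Sum>A | A \<subseteq># M. h A (M - A)) = (\<Sum>A | A \<subseteq># M. h (M - A) A)"
  by (rule sum.reindex_bij_witness[of _ "\<lambda>A. M - A" "\<lambda>A. M - A"])
     (simp_all add: double_diff_submset)

instantiation symfun :: (comm_ring_1) comm_ring_1
begin

lift_definition zero_symfun :: "'a symfun" is "\<lambda>_. 0" by simp

lift_definition one_symfun :: "'a symfun" is "\<lambda>M. if M = {#} then 1 else 0" by auto

lift_definition plus_symfun :: "'a symfun \<Rightarrow> 'a symfun \<Rightarrow> 'a symfun" is "\<lambda>f g M. f M + g M"
proof -
  fix f g :: "nat multiset \<Rightarrow> 'a"
  assume f: "(\<forall>\<pi> M. bij \<pi> \<longrightarrow> f (image_mset \<pi> M) = f M) \<and> (\<exists>d. \<forall>M. f M \<noteq> 0 \<longrightarrow> size M \<le> d)"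
    and g: "(\<forall>\<pi> M. bij \<pi> \<longrightarrow> g (image_mset \<pi> M) = g M) \<and> (\<exists>d. \<forall>M. g M \<noteq> 0 \<longrightarrow> size M \<le> d)"
  obtain d e where d: "\<And>M. f M \<noteq> 0 \<Longrightarrow> size M \<le> d" and e: "\<And>M. g M \<noteq> 0 \<Longrightarrow> size M \<le> e"
    using f g by blast
  have "\<forall>M. f M + g M \<noteq> 0 \<longrightarrow> size M \<le> max d e"
    using d e by (metis add_0 le_max_iff_disj)
  with f g show "(\<forall>\<pi> M. bij \<pi> \<longrightarrow> f (image_mset \<pi> M) + g (image_mset \<pi> M) = f M + g M) \<and>
      (\<exists>d. \<forall>M. f M + g M \<noteq> 0 \<longrightarrow> size M \<le> d)"
    by auto
qed

lift_definition uminus_symfun :: "'a symfun \<Rightarrow> 'a symfun" is "\<lambda>f M. - f M"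
  by auto

definition minus_symfun :: "'a symfun \<Rightarrow> 'a symfun \<Rightarrow> 'a symfun" where
  "minus_symfun f g = f + (- g)"

lift_definition times_symfun :: "'a symfun \<Rightarrow> 'a symfun \<Rightarrow> 'a symfun"
  is "\<lambda>f g M. \<Sum>A | A \<subseteq># M. f A * g (M - A)"
proof -
  fix f g :: "nat multiset \<Rightarrow> 'a"
  assume f: "(\<forall>\<pi> M. bij \<pi> \<longrightarrow> f (image_mset \<pi> M) = f M) \<and> (\<exists>d. \<forall>M. f M \<noteq> 0 \<longrightarrow> size M \<le> d)"
    and g: "(\<forall>\<pi> M. bij \<pi> \<longrightarrow> g (image_mset \<pi> M) = g M) \<and> (\<exists>d. \<forall>M. g M \<noteq> 0 \<longrightarrow> size M \<le> d)"
  obtain d e where d: "\<And>M. f M \<noteq> 0 \<Longrightarrow> size M \<le> d" and e: "\<And>M. g M \<noteq> 0 \<Longrightarrow> size M \<le> e"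
    using f g by blast
  let ?h = "\<lambda>M. \<Sum>A | A \<subseteq># M. f A * g (M - A)"
  have "?h (image_mset \<pi> M) = ?h M" if \<pi>: "bij \<pi>" for \<pi> :: "nat \<Rightarrow> nat" and M
  proof -
    have i1: "image_mset (inv \<pi>) (image_mset \<pi> A) = A" for A
      using \<pi> by (simp add: multiset.map_comp bij_is_inj)
    have i2: "image_mset \<pi> (image_mset (inv \<pi>) A) = A" for A
      using \<pi> by (simp add: multiset.map_comp o_def bij_is_surj surj_f_inv_f)
    show ?thesis
    proof (rule sum.reindex_bij_witness[of _ "image_mset \<pi>" "image_mset (inv \<pi>)"], goal_cases)
      case (2 A)
      then show ?case using image_mset_subseteq_mono[of A "image_mset \<pi> M" "inv \<pi>"] i1 by simp
    next
      case (5 A)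
      then have sub: "image_mset (inv \<pi>) A \<subseteq># M"
        using image_mset_subseteq_mono[of A "image_mset \<pi> M" "inv \<pi>"] i1 by simp
      have "image_mset \<pi> (M - image_mset (inv \<pi>) A) = image_mset \<pi> M - A"
        by (subst image_mset_Diff[OF sub]) (simp only: i2)
      moreover have "f (image_mset (inv \<pi>) A) = f A" using f \<pi> i2 by metis
      moreover have "g (image_mset \<pi> (M - image_mset (inv \<pi>) A)) = g (M - image_mset (inv \<pi>) A)"
        using g \<pi> by blast
      ultimately show ?case by simp
    qed (auto simp: i1 i2 image_mset_subseteq_mono)
  qed
  moreover have "size M \<le> d + e" if "?h M \<noteq> 0" for M
  proof -
    from that obtain A where A: "A \<subseteq># M" "f A * g (M - A) \<noteq> 0"
      by (metis (mono_tags, lifting) mem_Collect_eq sum.neutral)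
    then have "f A \<noteq> 0" "g (M - A) \<noteq> 0" by auto
    then have "size A \<le> d" "size (M - A) \<le> e" using d e by blast+
    then show ?thesis using A(1) by (simp add: size_Diff_submset)
  qed
  ultimately show "(\<forall>\<pi> M. bij \<pi> \<longrightarrow> ?h (image_mset \<pi> M) = ?h M) \<and>
      (\<exists>d. \<forall>M. ?h M \<noteq> 0 \<longrightarrow> size M \<le> d)"
    by blast
qed

instance
proof
  fix f g h :: "'a symfun"
  show "f + g + h = f + (g + h)" by transfer (simp add: add.assoc)
  show "f + g = g + f" by transfer (simp add: add.commute)
  show "0 + f = f" by transfer simp
  show "- f + f = 0" by transfer simp
  show "f - g = f + - g" by (simp add: minus_symfun_def)
  show "f * g = g * f"
  proof (rule symfun_eqI)
    fix M
    show "sf_coeff (f * g) M = sf_coeff (g * f) M"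
      using sum_submultisets_swap[of "\<lambda>A B. sf_coeff f A * sf_coeff g B" M]
      by (simp add: times_symfun.rep_eq mult.commute)
  qed
  show "1 * f = f"
  proof (rule symfun_eqI)
    fix M
    have "(\<Sum>A | A \<subseteq># M. (if A = {#} then 1 else 0) * sf_coeff f (M - A)) =
        (\<Sum>A\<in>{{#}}. (if A = {#} then 1 else 0) * sf_coeff f (M - A))"
      by (rule sum.mono_neutral_right[OF finite_submultisets]) auto
    then show "sf_coeff (1 * f) M = sf_coeff f M"
      by (simp add: times_symfun.rep_eq one_symfun.rep_eq)
  qed
  show "(f + g) * h = f * h + g * h"
    by transfer (simp add: distrib_right sum.distrib)
  show "f * g * h = f * (g * h)"
  proof (rule symfun_eqI)
    fix M
    let ?f = "sf_coeff f" and ?g = "sf_coeff g" and ?h = "sf_coeff h"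
    have "sf_coeff (f * g * h) M =
        (\<Sum>A | A \<subseteq># M. \<Sum>B | B \<subseteq># A. ?f B * ?g (A - B) * ?h (M - A))"
      by (simp add: times_symfun.rep_eq sum_distrib_right)
    also have "\<dots> = (\<Sum>(A, B) \<in> Sigma {A. A \<subseteq># M} (\<lambda>A. {B. B \<subseteq># A}). ?f B * ?g (A - B) * ?h (M - A))"
      by (rule sum.Sigma) (simp_all add: finite_submultisets)
    also have "\<dots> = (\<Sum>(B, C) \<in> Sigma {B. B \<subseteq># M} (\<lambda>B. {C. C \<subseteq># M - B}). ?f B * (?g C * ?h (M - B - C)))"
    proof (rule sum.reindex_bij_witness[of _ "\<lambda>(B, C). (B + C, B)" "\<lambda>(A, B). (B, A - B)"], goal_cases)
      case (2 a)
      then show ?case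
        by (auto simp: subseteq_mset_def diff_le_mono intro: order_trans)
    next
      case (4 b)
      obtain B C where b: "b = (B, C)" by (cases b)
      with 4 have "B \<subseteq># M" "C \<subseteq># M - B" by auto
      then have "B + C \<subseteq># M"
        by (metis subset_mset.le_diff_conv2 add.commute)
      then show ?case by (simp add: b)
    next
      case (5 a)
      obtain A B where a: "a = (A, B)" by (cases a)
      with 5 have "B \<subseteq># A" by auto
      then have "M - B - (A - B) = M - A"
        by (simp add: diff_diff_add_mset)
      then show ?case by (simp add: a mult.assoc)
    qed auto
    also have "\<dots> = (\<Sum>B | B \<subseteq># M. \<Sum>C | C \<subseteq># M - B. ?f B * (?g C * ?h (M - B - C)))"
      by (rule sum.Sigma[symmetric]) (simp_all add: finite_submultisets)
    also have "\<dots> = sf_coeff (f * (g * h)) M"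
      by (simp add: times_symfun.rep_eq sum_distrib_left)
    finally show "sf_coeff (f * g * h) M = sf_coeff (f * (g * h)) M" .
  qed
  show "(0 :: 'a symfun) \<noteq> 1"
    by transfer (metis zero_neq_one)
qed

end

lift_definition sf_scale :: "'a :: comm_ring_1 \<Rightarrow> 'a symfun \<Rightarrow> 'a symfun"
  is "\<lambda>c f M. c * f M"
  by (metis mult_zero_right)

lemma vector_space_sf_scale: "vector_space (sf_scale :: 'a :: field \<Rightarrow> _)"
  by unfold_locales (transfer; simp add: algebra_simps)+

definition exponents :: "nat multiset \<Rightarrow> nat multiset" where
  "exponents M = image_mset (count M) (mset_set (set_mset M))"

lemma exponents_image_mset:
  assumes "inj \<pi>"
  shows "exponents (image_mset \<pi> M) = exponents M"
proof -
  have "mset_set (\<pi> ` set_mset M) = image_mset \<pi> (mset_set (set_mset M))"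
    using assms by (simp add: image_mset_mset_set inj_on_subset)
  moreover have "count (image_mset \<pi> M) (\<pi> i) = count M i" for i
  proof -
    have "{j \<in> set_mset M. \<pi> j = \<pi> i} = (if i \<in># M then {i} else {})"
      using assms by (auto dest: injD)
    then show ?thesis
      by (simp add: count_image_mset' count_eq_zero_iff eq_commute[of "\<pi> i"])
  qed
  ultimately show ?thesis
    by (simp add: exponents_def multiset.map_comp o_def)
qed

lemma sum_mset_exponents: "sum_mset (exponents M) = size M"
  by (simp add: exponents_def size_multiset_overloaded_eq sum_unfold_sum_mset)

lift_definition monomial_sym :: "partition \<Rightarrow> 'a :: comm_ring_1 symfun"
  is "\<lambda>l M. if exponents M = parts_mset l then 1 else 0"
  by (auto simp: exponents_image_mset bij_is_inj)
     (metis sum_mset_exponents order_refl)+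

text \<open>The series \<open>\<Sum>i. x\<^sub>i ^ k\<close>, for \<open>k > 0\<close>.\<close>

lift_definition power_sum :: "nat \<Rightarrow> 'a :: comm_ring_1 symfun"
  is "\<lambda>k M. if \<exists>i. M = replicate_mset k i then 1 else 0"
proof (intro conjI allI impI)
  fix k and \<pi> :: "nat \<Rightarrow> nat" and M
  assume \<pi>: "bij \<pi>"
  have "image_mset \<pi> M = replicate_mset k i \<longleftrightarrow> M = replicate_mset k (inv \<pi> i)" for i
  proof
    assume "image_mset \<pi> M = replicate_mset k i"
    then have "image_mset (inv \<pi>) (image_mset \<pi> M) = replicate_mset k (inv \<pi> i)" by simp
    then show "M = replicate_mset k (inv \<pi> i)"
      using \<pi> by (simp add: multiset.map_comp bij_is_inj)
  qed (use \<pi> in \<open>simp add: bij_is_surj surj_f_inv_f\<close>)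
  then have "(\<exists>i. image_mset \<pi> M = replicate_mset k i) \<longleftrightarrow> (\<exists>i. M = replicate_mset k i)"
    using \<pi> by (metis bij_inv_eq_iff)
  then show "(if \<exists>i. image_mset \<pi> M = replicate_mset k i then 1 else 0 :: 'a) =
      (if \<exists>i. M = replicate_mset k i then 1 else 0)" by simp
next
  fix k
  show "\<exists>d. \<forall>M :: nat multiset.
      (if \<exists>i. M = replicate_mset k i then 1 else 0 :: 'a) \<noteq> 0 \<longrightarrow> size M \<le> d"
    by (rule exI[of _ k]) auto
qed

definition power_sum_part :: "partition \<Rightarrow> 'a :: comm_ring_1 symfun" where
  "power_sum_part l = (\<Prod>k\<in>#parts_mset l. power_sum k)"


section \<open>Jack symmetric functions\<close>

text \<open>The field \<open>\<rat>(\<alpha>)\<close>, with its generator \<open>\<alpha>\<close>.\<close>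

type_synonym ratfun = "rat poly fract"

definition \<alpha> :: ratfun where
  "\<alpha> = Fract [:0, 1:] 1"

definition z_part :: "partition \<Rightarrow> nat" where
  "z_part l = (\<Prod>i\<in>set_mset (parts_mset l). i ^ count (parts_mset l) i * fact (count (parts_mset l) i))"

definition jack_inner :: "ratfun symfun \<Rightarrow> ratfun symfun \<Rightarrow> ratfun" where
  "jack_inner = (THE B.
     (\<forall>f. Vector_Spaces.linear sf_scale (*) (\<lambda>g. B f g)) \<and>
     (\<forall>g. Vector_Spaces.linear sf_scale (*) (\<lambda>f. B f g)) \<and>
     (\<forall>l m. B (power_sum_part l) (power_sum_part m) =
        (if l = m then of_nat (z_part l) * \<alpha> ^ num_parts l else 0)))"

text \<open>
  The defining properties of the family of Jack symmetric functions; they determine the family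
  uniquely. Note that \<open>v (single_column n)\<close> is the coefficient of \<open>m\<^bsub>(1,\<dots>,1)\<^esub>\<close>.
\<close>

definition is_jack_family :: "(partition \<Rightarrow> ratfun symfun) \<Rightarrow> bool" where
  "is_jack_family J \<longleftrightarrow>
     (\<forall>l m. l \<noteq> m \<longrightarrow> jack_inner (J l) (J m) = 0) \<and>
     (\<forall>l. \<exists>v. J l = (\<Sum>m | dominated m l. sf_scale (v m) (monomial_sym m)) \<and>
        v (single_column (weight l)) = fact (weight l))"

definition skew_jack ::
    "(partition \<Rightarrow> ratfun symfun) \<Rightarrow> partition \<Rightarrow> partition \<Rightarrow> ratfun symfun" where
  "skew_jack J l m = (THE f. \<forall>n. jack_inner f (J n) = jack_inner (J l) (J m * J n))"


section \<open>Arms, legs and translation of skew diagrams\<close>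

text \<open>Integer-valued, since the box need not lie in the diagram.\<close>

definition arm :: "partition \<Rightarrow> nat \<times> nat \<Rightarrow> int" where
  "arm l = (\<lambda>(i, j). int (part l i) - int (Suc j))"

definition leg :: "partition \<Rightarrow> nat \<times> nat \<Rightarrow> int" where
  "leg l = (\<lambda>(i, j). int (part (transpose l) j) - int (Suc i))"

definition c_lower :: "partition \<Rightarrow> partition \<Rightarrow> ratfun" where
  "c_lower m l = (\<Prod>s\<in>diagram m. of_int (arm m s) * \<alpha> + of_int (leg l s) + 1)"

definition c_upper :: "partition \<Rightarrow> partition \<Rightarrow> ratfun" where
  "c_upper l m = (\<Prod>s\<in>diagram m. (of_int (arm l s) + 1) * \<alpha> + of_int (leg m s))"

lift_definition drop_row :: "partition \<Rightarrow> partition" is "\<lambda>p i. p (Suc i)"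
proof -
  fix p :: "nat \<Rightarrow> nat"
  assume p: "antimono p \<and> finite {i. p i \<noteq> 0}"
  have "finite (Suc -` {i. p i \<noteq> 0})"
    using p by (intro finite_vimageI) auto
  then show "antimono (\<lambda>i. p (Suc i)) \<and> finite {i. p (Suc i) \<noteq> 0}"
    using p by (simp add: antimono_def vimage_def)
qed

lift_definition drop_column :: "partition \<Rightarrow> partition" is "\<lambda>p i. p i - 1"
proof -
  fix p :: "nat \<Rightarrow> nat"
  assume p: "antimono p \<and> finite {i. p i \<noteq> 0}"
  have "finite {i. p i - 1 \<noteq> 0}"
    by (rule finite_subset[of _ "{i. p i \<noteq> 0}"]) (use p in auto)
  then show "antimono (\<lambda>i. p i - 1) \<and> finite {i. p i - 1 \<noteq> 0}"
    using p by (simp add: antimono_def diff_le_mono)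
qed

text \<open>A pair \<open>(l, m)\<close> stands for the skew partition \<open>l/m\<close>.\<close>

inductive remove_empty :: "partition \<times> partition \<Rightarrow> partition \<times> partition \<Rightarrow> bool" where
  row: "part l 0 = part m 0 \<Longrightarrow> remove_empty (l, m) (drop_row l, drop_row m)"
| column: "part (transpose l) 0 = part (transpose m) 0 \<Longrightarrow>
    remove_empty (l, m) (drop_column l, drop_column m)"

definition coincide_up_to_translation ::
    "partition \<times> partition \<Rightarrow> partition \<times> partition \<Rightarrow> bool" where
  "coincide_up_to_translation = equivclp remove_empty"

end

theory Submission
  imports Defs "HOL-Combinatorics.Permutations"
begin

hide_const (open) Transposition.transpose

text \<open>
  Removing an empty row changes \<open>J\<^bsub>\<lambda>/\<mu>\<^esub>\<close> only by a scalar because Jack functions are eigenvectors of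
  the Laplace-Beltrami operator. Let \<open>g\<^sub>r\<close> be the functions dual to the monomials \<open>x\<^sup>r\<close>. Modulo the ideal
  \<open>I\<^sub>N\<close> generated by \<open>g\<^sub>r\<close> with \<open>r > N\<close>, multiplication by \<open>g\<^sub>N\<close> intertwines the operator with itself up
  to a constant. Hence \<open>g\<^sub>N J\<^sub>\<nu>\<close> is proportional to \<open>J\<^bsub>(N,\<nu>)\<^esub>\<close> modulo \<open>I\<^sub>N\<close>, and \<open>J\<^sub>\<lambda>\<close> is orthogonal to \<open>I\<^sub>N\<close>
  if \<open>\<lambda>\<^sub>1 = N\<close>; this turns \<open>\<langle>J\<^sub>\<lambda>, J\<^sub>\<mu> f\<rangle>\<close> into a multiple of \<open>\<langle>J\<^sub>\<rho>, J\<^sub>\<kappa> f\<rangle>\<close>, where \<open>\<rho>\<close> and \<open>\<kappa>\<close> arise from \<open>\<lambda>\<close> and \<open>\<mu>\<close> by removing the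
  first rows. Columns are removed in the same way with \<open>e\<^sub>n\<close> in place of \<open>g\<^sub>N\<close>.

  The scalars follow from the principal specialization \<open>p\<^sub>k \<mapsto> X\<close>, which maps \<open>J\<^sub>\<lambda>\<close> to the product of
  \<open>X + \<alpha> j - i\<close> over the boxes \<open>(i, j)\<close>, numbered from \<open>0\<close>, of \<open>\<lambda>\<close> and which annihilates \<open>I\<^sub>N\<close> for \<open>X = - N \<alpha>\<close>, and the corresponding
  ideal for columns for \<open>X = n\<close>. Comparing the two reductions also yields the norm of \<open>J\<^sub>\<lambda>\<close>.
\<close>

section \<open>Partitions and majorization\<close>

text \<open>Neither dominance nor the eigenvalue suffices alone. Partitions of equal weight may
  share an eigenvalue, as (4,1,1) and (3,3) do, but comparable ones never do, and triangularity
  leaves only comparable ones to be separated. The series depends on a parameter \<theta>; the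
  values 1/\<alpha> (rows) and -1 (columns) are the two roots of the quadratic equation that makes
  its coefficients eigenvectors of the operator. Each removal carries two scalars, one for the
  smaller and one for the larger partition. With \<open>strip\<close> denoting the pairing of J for
  the full partition with \<open>gen\<close> times J for the reduced one, specialization yields only
  norm over \<open>strip\<close>; the other scalar, \<open>strip\<close> over the norm of the
  reduced function, requires the norms. The first quotient is also the recursion factor of a leading
  coefficient: removing rows computes norm over \<open>lead\<close>, removing columns computes
  \<open>lead\<close>, and the product is the norm. Definiteness and nonvanishing rest on ordering
  the field of rational functions so that \<alpha> is positive.\<close>

lemma less_part_transpose [simp]: "i < part (transpose l) j \<longleftrightarrow> j < part l i"
proof -
  have fin: "finite {i. j < part l i}"
    by (rule finite_subset[OF _ finite_support_part[of l]]) auto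
  have down: "i' \<in> {i. j < part l i}" if "i \<in> {i. j < part l i}" "i' \<le> i" for i i'
    using that antimonoD[OF antimono_part that(2), of l] by auto
  \<comment> \<open>A finite down-closed set of naturals is the initial segment of its
    cardinality.\<close>
  have "{i. j < part l i} = {..<card {i. j < part l i}}"
  proof (rule card_seteq[symmetric])
    show "{..<card {i. j < part l i}} \<subseteq> {i. j < part l i}"
    proof
      fix i assume i: "i \<in> {..<card {i. j < part l i}}"
      show "i \<in> {i. j < part l i}"
      proof (rule ccontr)
        assume "i \<notin> {i. j < part l i}"
        then have "{i. j < part l i} \<subseteq> {..<i}" using down by (metis lessThan_iff not_le subsetI)
        then have "card {i. j < part l i} \<le> i" using card_mono[of "{..<i}"] by fastforce
        then show False using i by simp
      qed
    qed
  qed (use fin in auto)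
  then show ?thesis by (auto simp: transpose.rep_eq)
qed

lemma partition_eqI_less: "(\<And>i j. j < part l i \<longleftrightarrow> j < part m i) \<Longrightarrow> l = m"
  by (rule partition_eqI) (metis linorder_neqE_nat less_irrefl)

lemma transpose_transpose [simp]: "transpose (transpose l) = l"
  by (rule partition_eqI_less) simp

lemma transpose_inject [simp]: "transpose l = transpose m \<longleftrightarrow> l = m"
  by (metis transpose_transpose)

lemma transpose_drop_row: "transpose (drop_row l) = drop_column (transpose l)"
proof (rule partition_eqI_less)
  fix i j
  have "j < part (drop_column (transpose l)) i \<longleftrightarrow> Suc j < part (transpose l) i"
    by (simp add: drop_column.rep_eq less_diff_conv del: less_part_transpose)
  then show "j < part (transpose (drop_row l)) i \<longleftrightarrow> j < part (drop_column (transpose l)) i"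
    by (simp add: drop_row.rep_eq)
qed

lemma transpose_drop_column: "transpose (drop_column l) = drop_row (transpose l)"
  by (metis transpose_drop_row transpose_transpose)

lemma diagram_transpose: "diagram (transpose l) = prod.swap ` diagram l"
  by (force simp: diagram_def)

lemma zero_notin_parts [simp]: "0 \<notin># parts_mset l"
  using finite_support_part[of l] by (auto simp: parts_mset_def)

lemma size_parts_mset: "size (parts_mset l) = num_parts l"
  by (simp add: parts_mset_def num_parts_def)

lemma sum_parts_mset: "sum_mset (parts_mset l) = weight l"
  by (simp add: parts_mset_def weight_def sum_unfold_sum_mset)

lemma part_le_first: "part l i \<le> part l 0"
  using antimonoD[OF antimono_part[of l], of 0 i] by simp

lemma parts_mset_le: "x \<in># parts_mset l \<Longrightarrow> x \<le> part l 0"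
  using finite_support_part[of l] by (auto simp: parts_mset_def part_le_first)

lemma part_transpose_eq_size: "part (transpose l) j = size {#x \<in># parts_mset l. j < x#}"
proof -
  have "{#x \<in># parts_mset l. j < x#} = image_mset (part l) (mset_set {i \<in> {i. part l i \<noteq> 0}. j < part l i})"
    unfolding parts_mset_def filter_mset_image_mset
    by (simp only: filter_mset_mset_set[OF finite_support_part])
  then show ?thesis by (simp add: transpose.rep_eq) (rule arg_cong[of _ _ card], auto)
qed

lemma num_parts_eq: "num_parts l = part (transpose l) 0"
  by (simp add: num_parts_def transpose.rep_eq)

lemma parts_mset_inject [simp]: "parts_mset l = parts_mset m \<longleftrightarrow> l = m"
proof
  assume "parts_mset l = parts_mset m"
  then have "transpose l = transpose m"
    by (intro partition_eqI) (simp add: part_transpose_eq_size)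
  then show "l = m" by simp
qed simp

lemma ex_parts_mset:
  assumes "0 \<notin># A"
  obtains l where "parts_mset l = A"
proof -
  define xs where "xs = rev (sorted_list_of_multiset A)"
  define p where "p i = (if i < length xs then xs ! i else 0)" for i
  have mx: "mset xs = A" by (simp add: xs_def)
  have pos: "xs ! i \<noteq> 0" if "i < length xs" for i
    using that assms mx by (metis nth_mem set_mset_mset)
  have "antimono p"
  proof (rule antimonoI)
    fix i j :: nat assume "i \<le> j"
    then show "p j \<le> p i"
      by (auto simp: p_def xs_def sorted_rev_iff_nth_mono[of "rev (sorted_list_of_multiset A)", simplified])
  qed
  moreover have supp: "{i. p i \<noteq> 0} = {..<length xs}" using pos by (auto simp: p_def)
  ultimately have "part (Abs_partition p) = p" by (simp add: Abs_partition_inverse)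
  then have "parts_mset (Abs_partition p) = image_mset p (mset_set {..<length xs})"
    by (simp only: parts_mset_def supp)
  also have "\<dots> = image_mset ((!) xs) (mset [0..<length xs])"
    unfolding lessThan_atLeast0 mset_upt by (rule image_mset_cong) (simp add: p_def)
  also have "\<dots> = A" by (simp only: mset_map[symmetric] map_nth mx)
  finally show ?thesis using that by blast
qed

lemma parts_mset_drop_row:
  "parts_mset l = (if part l 0 = 0 then {#} else add_mset (part l 0) (parts_mset (drop_row l)))"
proof (cases "part l 0 = 0")
  case True
  then have "part l i = 0" for i using part_le_first[of l i] by simp
  then show ?thesis using True by (simp add: parts_mset_def)
next
  case False
  have "{i. part l i \<noteq> 0} = insert 0 (Suc ` {i. part (drop_row l) i \<noteq> 0})"
  proof (rule set_eqI)
    fix i show "i \<in> {i. part l i \<noteq> 0} \<longleftrightarrow> i \<in> insert 0 (Suc ` {i. part (drop_row l) i \<noteq> 0})"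
      using False by (cases i) (auto simp: drop_row.rep_eq)
  qed
  then have "mset_set {i. part l i \<noteq> 0} = add_mset 0 (image_mset Suc (mset_set {i. part (drop_row l) i \<noteq> 0}))"
    using finite_support_part[of "drop_row l"]
    by (simp add: image_mset_mset_set)
  then show ?thesis using False
    by (simp add: parts_mset_def multiset.map_comp o_def drop_row.rep_eq)
qed

lemma drop_row_trivial: "part l 0 = 0 \<Longrightarrow> drop_row l = l"
  by (rule partition_eqI) (metis drop_row.rep_eq part_le_first le_zero_eq)

lemma weight_drop_row: "weight l = part l 0 + weight (drop_row l)"
proof (cases "part l 0 = 0")
  case True then show ?thesis by (simp add: drop_row_trivial)
next
  case False then show ?thesis
    using sum_parts_mset[of l] sum_parts_mset[of "drop_row l"] by (subst (asm) parts_mset_drop_row) simp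
qed

lemma partition_induct [case_names empty row]:
  assumes "\<And>l. part l 0 = 0 \<Longrightarrow> Q l"
    and "\<And>l. part l 0 \<noteq> 0 \<Longrightarrow> Q (drop_row l) \<Longrightarrow> Q l"
  shows "Q l"
proof (induction "weight l" arbitrary: l rule: less_induct)
  case less
  show ?case
    using assms[of l] less[of "drop_row l"] weight_drop_row[of l] by (cases "part l 0 = 0") auto
qed

lemma weight_eq_card: "weight l = card (diagram l)"
proof -
  have "diagram l = Sigma {i. part l i \<noteq> 0} (\<lambda>i. {..<part l i})" by (auto simp: diagram_def)
  then show ?thesis using finite_support_part[of l] by (simp add: weight_def)
qed

lemma weight_transpose [simp]: "weight (transpose l) = weight l"
  by (simp add: weight_eq_card diagram_transpose card_image)

lemma finite_weight_le: "finite {l. weight l \<le> d}"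
proof -
  have "part ` {l. weight l \<le> d} \<subseteq>
      {f. \<forall>i. (i \<in> {..<d} \<longrightarrow> f i \<in> {..d}) \<and> (i \<notin> {..<d} \<longrightarrow> f i = 0)}"
  proof (intro image_subsetI CollectI conjI allI impI)
    fix m i assume "m \<in> {l. weight l \<le> d}"
    then have w: "weight m \<le> d" by simp
    show "part m i \<in> {..d}" using part_le_weight[of m i] w by simp
    show "part m i = 0" if "i \<notin> {..<d}" using that w by (intro part_eq_0_if_weight_le) simp
  qed
  moreover have "finite \<dots>" by (rule finite_set_of_finite_funs; simp)
  ultimately have "finite (part ` {l. weight l \<le> d})" by (rule finite_subset)
  then show ?thesis by (rule finite_imageD) (auto simp: inj_on_def part_inject)
qed

text \<open>Up to permutation and zero entries, \<open>A\<close> is dominated by \<open>B\<close> exactly if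
  the sums of the truncated entries \<open>x - t\<close> satisfy the inequalities below.
  In this form no sorting is needed.\<close>

definition hinge :: "nat \<Rightarrow> nat multiset \<Rightarrow> nat" where
  "hinge t A = (\<Sum>x\<in>#A. x - t)"

definition majorized :: "nat multiset \<Rightarrow> nat multiset \<Rightarrow> bool" where
  "majorized A B \<longleftrightarrow> sum_mset A = sum_mset B \<and> (\<forall>t. hinge t A \<le> hinge t B)"

definition strictly_majorized :: "nat multiset \<Rightarrow> nat multiset \<Rightarrow> bool" where
  "strictly_majorized A B \<longleftrightarrow> majorized A B \<and> (\<exists>t. hinge t A < hinge t B)"

lemma hinge_simps [simp]:
  "hinge t {#} = 0" "hinge t (add_mset x A) = (x - t) + hinge t A" "hinge t (A + B) = hinge t A + hinge t B"
  by (auto simp: hinge_def)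

lemma hinge_0 [simp]: "hinge 0 A = sum_mset A" by (simp add: hinge_def)

lemma majorized_refl [simp]: "majorized A A" by (simp add: majorized_def)

lemma majorized_trans: "majorized A B \<Longrightarrow> majorized B C \<Longrightarrow> majorized A C"
  by (auto simp: majorized_def intro: order_trans)

lemma majorized_add: "majorized A B \<Longrightarrow> majorized (A + C) (B + C)"
  by (simp add: majorized_def)

lemma strictly_majorized_add: "strictly_majorized A B \<Longrightarrow> strictly_majorized (A + C) (B + C)"
  by (auto simp: strictly_majorized_def majorized_add)

text \<open>The second difference of the hinge function centred at \<open>Suc t\<close> counts the
  entries equal to \<open>Suc t\<close>, so hinges determine a multiset up to zero entries.\<close>

lemma hinge_count: "hinge t A + hinge (Suc (Suc t)) A = 2 * hinge (Suc t) A + count A (Suc t)"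
  by (induction A) auto

lemma hinge_inject:
  assumes "0 \<notin># A" "0 \<notin># B" "\<And>t. hinge t A = hinge t B"
  shows "A = B"
proof (rule multiset_eqI)
  fix x show "count A x = count B x"
  proof (cases x)
    case 0 then show ?thesis using assms by (simp add: not_in_iff)
  next
    case (Suc t)
    then show ?thesis using hinge_count[of t A] hinge_count[of t B] assms(3) by simp
  qed
qed

lemma hinge_eq_0_iff: "hinge t A = 0 \<longleftrightarrow> (\<forall>x\<in>#A. x \<le> t)"
  by (induction A) auto

lemma hinge_parts: "hinge t (parts_mset l) = (\<Sum>i | part l i \<noteq> 0. part l i - t)"
  by (simp add: hinge_def parts_mset_def multiset.map_comp o_def sum_unfold_sum_mset)

lemma hinge_drop_row: "hinge t (parts_mset l) = (part l 0 - t) + hinge t (parts_mset (drop_row l))"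
  by (cases "part l 0 = 0") (simp add: drop_row_trivial, subst parts_mset_drop_row, simp)

text \<open>Removing a column shifts the hinge function, just as removing a row subtracts one
  truncated entry; hence both removals are compatible with the order.\<close>

lemma hinge_drop_column: "hinge t (parts_mset (drop_column l)) = hinge (Suc t) (parts_mset l)"
proof -
  have "(\<Sum>i | part (drop_column l) i \<noteq> 0. part (drop_column l) i - t) =
     (\<Sum>i | part l i \<noteq> 0. part (drop_column l) i - t)"
    by (rule sum.mono_neutral_left[OF finite_support_part]) (auto simp: drop_column.rep_eq)
  then show ?thesis by (simp add: hinge_parts drop_column.rep_eq)
qed

section \<open>The dominance order in terms of hinges\<close>

definition part_le :: "partition \<Rightarrow> partition \<Rightarrow> bool" (infix "\<unlhd>" 50) where
  "l \<unlhd> m \<longleftrightarrow> majorized (parts_mset l) (parts_mset m)"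

lemma part_le_refl [simp]: "l \<unlhd> l" by (simp add: part_le_def)

lemma part_le_trans: "l \<unlhd> m \<Longrightarrow> m \<unlhd> n \<Longrightarrow> l \<unlhd> n"
  unfolding part_le_def by (rule majorized_trans)

lemma majorized_parts_antisym:
  "majorized (parts_mset l) (parts_mset m) \<Longrightarrow> \<not> strictly_majorized (parts_mset l) (parts_mset m) \<Longrightarrow> l = m"
  unfolding strictly_majorized_def majorized_def
  by (metis hinge_inject parts_mset_inject zero_notin_parts le_neq_implies_less)

lemma part_le_antisym: "l \<unlhd> m \<Longrightarrow> m \<unlhd> l \<Longrightarrow> l = m"
  by (metis majorized_parts_antisym part_le_def strictly_majorized_def majorized_def not_le)

lemma part_le_weight: "l \<unlhd> m \<Longrightarrow> weight l = weight m"
  by (simp add: part_le_def majorized_def sum_parts_mset)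

lemma strictly_majorized_parts: "strictly_majorized (parts_mset l) (parts_mset m) \<longleftrightarrow> l \<unlhd> m \<and> l \<noteq> m"
  by (metis majorized_parts_antisym part_le_def strictly_majorized_def less_irrefl)

text \<open>The hinge of \<open>m\<close> at its largest part vanishes, hence so does that of
  \<open>l\<close>.\<close>

lemma part_le_part_0: "l \<unlhd> m \<Longrightarrow> part l 0 \<le> part m 0"
  using hinge_drop_row[of "part m 0" l] hinge_eq_0_iff[of "part m 0" "parts_mset m"] parts_mset_le[of _ m]
  by (simp add: part_le_def majorized_def) (metis add_is_0 diff_is_0_eq le_zero_eq)

text \<open>Without zero entries the number of entries is the total minus the hinge at 1, so a
  larger hinge means fewer parts.\<close>

lemma part_le_transpose_0:
  assumes "l \<unlhd> m" shows "part (transpose m) 0 \<le> part (transpose l) 0"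
proof -
  have "size A + hinge 1 A = sum_mset A" if "0 \<notin># A" for A
    using that by (induction A) auto
  from this[of "parts_mset l"] this[of "parts_mset m"] assms show ?thesis
    by (simp add: part_le_def majorized_def size_parts_mset num_parts_eq)
      (metis add_le_cancel_right add_le_cancel_left)
qed

lemma part_le_drop_row:
  assumes "part l 0 = part m 0" shows "drop_row l \<unlhd> drop_row m \<longleftrightarrow> l \<unlhd> m"
  using assms weight_drop_row[of l] weight_drop_row[of m]
  by (simp add: part_le_def majorized_def sum_parts_mset hinge_drop_row[of _ l] hinge_drop_row[of _ m])

lemma part_le_drop_column:
  assumes "part (transpose l) 0 = part (transpose m) 0"
  shows "drop_column l \<unlhd> drop_column m \<longleftrightarrow> l \<unlhd> m"
proof -
  have w: "weight l = part (transpose l) 0 + weight (drop_column l)" for l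
    using weight_drop_row[of "transpose l"] by (simp flip: transpose_drop_column)
  have eq: "(\<forall>t. Q t) \<longleftrightarrow> Q 0 \<and> (\<forall>t. Q (Suc t))" for Q :: "nat \<Rightarrow> bool"
    by (metis not0_implies_Suc)
  show ?thesis
    unfolding part_le_def majorized_def hinge_drop_column
    by (subst (2) eq) (use assms w[of l] w[of m] in \<open>auto simp: sum_parts_mset\<close>)
qed

lemma dominated_imp_part_le:
  assumes "dominated m l" shows "m \<unlhd> l"
proof -
  have "hinge t (parts_mset m) \<le> hinge t (parts_mset l)" for t
  proof -
    \<comment> \<open>The number of parts of \<open>m\<close> exceeding \<open>t\<close>. With this
      \<open>k\<close> the hinge of \<open>m\<close> equals its partial sum minus
      \<open>k * t\<close>, while for \<open>l\<close> the same expression is a lower bound of the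
      hinge.\<close>
    define k where "k = part (transpose m) t"
    have k: "i < k \<longleftrightarrow> t < part m i" for i by (simp add: k_def)
    have "hinge t (parts_mset m) = (\<Sum>i<k. part m i - t)"
      unfolding hinge_parts
      by (rule sum.mono_neutral_right[OF finite_support_part]) (auto simp: k)
    then have "int (hinge t (parts_mset m)) = (\<Sum>i<k. int (part m i) - int t)"
      by simp (rule sum.cong, auto simp: k)
    also have "\<dots> \<le> (\<Sum>i<k. int (part l i) - int t)"
    proof -
      have "(\<Sum>i<k. part m i) \<le> (\<Sum>i<k. part l i)" using assms by (simp add: dominated_def)
      then have "(\<Sum>i<k. int (part m i)) \<le> (\<Sum>i<k. int (part l i))"
        by (metis of_nat_sum of_nat_le_iff)
      then show ?thesis by (simp add: sum_subtractf)
    qed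
    also have "\<dots> \<le> (\<Sum>i<k. int (part l i - t))" by (rule sum_mono) auto
    also have "\<dots> \<le> (\<Sum>i\<in>{..<k} \<union> {i. part l i \<noteq> 0}. int (part l i - t))"
      by (rule sum_mono2) (use finite_support_part in auto)
    also have "\<dots> = int (hinge t (parts_mset l))"
      unfolding hinge_parts of_nat_sum
      by (rule sum.mono_neutral_right) (use finite_support_part in auto)
    finally show ?thesis by simp
  qed
  then show ?thesis using assms by (simp add: part_le_def majorized_def sum_parts_mset dominated_def)
qed

text \<open>\<open>\<Sum>{..<x}\<close> is x choose 2, which is also the sum of the truncated
  differences \<open>x - Suc t\<close>. Over the parts of a partition this statistic is the
  coefficient of \<alpha> in the Laplace-Beltrami eigenvalue.\<close>

lemma sum_choose_eq_sum_hinge: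
  assumes "\<forall>x\<in>#A. x \<le> T"
  shows "(\<Sum>x\<in>#A. \<Sum>{..<x}) = (\<Sum>t<T. hinge (Suc t) A)"
  using assms
proof (induction A)
  case (add x A)
  have "(\<Sum>t<T. x - Suc t) = (\<Sum>t<x. x - Suc t)"
    by (rule sum.mono_neutral_right) (use add.prems in auto)
  also have "\<dots> = \<Sum>{..<x}" by (rule sum.nat_diff_reindex)
  finally show ?case using add by (simp add: sum.distrib)
qed simp

text \<open>The hinges are ordered termwise, so equal sums force each pair of hinges to agree;
  beyond \<open>part m 0\<close> both vanish.\<close>

lemma part_le_sum_choose_eq:
  assumes "l \<unlhd> m" "(\<Sum>x\<in>#parts_mset l. \<Sum>{..<x}) = (\<Sum>x\<in>#parts_mset m. \<Sum>{..<x})"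
  shows "l = m"
proof (rule majorized_parts_antisym)
  show maj: "majorized (parts_mset l) (parts_mset m)" using assms by (simp add: part_le_def)
  let ?T = "part m 0"
  have T: "part l 0 \<le> ?T" by (rule part_le_part_0) fact
  have "(\<Sum>t<?T. hinge (Suc t) (parts_mset l)) = (\<Sum>t<?T. hinge (Suc t) (parts_mset m))"
    using assms(2) by (subst (asm) (1 2) sum_choose_eq_sum_hinge[of _ ?T])
      (use parts_mset_le T order_trans in blast)+
  then have *: "hinge (Suc t) (parts_mset l) = hinge (Suc t) (parts_mset m)" if "t < ?T" for t
    by (rule sum_mono_inv[where I = "{..<?T}"]) (use that maj in \<open>auto simp: majorized_def\<close>)
  have "hinge t (parts_mset l) = hinge t (parts_mset m)" for t
  proof (cases "t \<le> ?T")
    case True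
    then show ?thesis using * maj by (cases t) (auto simp: majorized_def)
  next
    case False
    then have "hinge t (parts_mset l) = 0" "hinge t (parts_mset m) = 0"
      unfolding hinge_eq_0_iff using parts_mset_le T by force+
    then show ?thesis by simp
  qed
  then show "\<not> strictly_majorized (parts_mset l) (parts_mset m)"
    by (simp add: strictly_majorized_def)
qed

section \<open>Power sums form a basis\<close>

text \<open>Induction on the number of indices beyond \<open>i\<close>, which drops along
  \<open>lt\<close>. It inverts the triangular changes of basis between power sums and monomials,
  generating products and Jack functions, dual products and monomials.\<close>

lemma (in vector_space) triangular_inverse:
  fixes x y :: "'i \<Rightarrow> 'b" and lt :: "'i \<Rightarrow> 'i \<Rightarrow> bool"
  assumes tri: "\<And>i. c i \<noteq> 0 \<and> x i - c i *s y i \<in> span {y j | j. lt i j}"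
    and fin: "\<And>i. finite {j. lt i j}"
    and trans: "\<And>i j k. lt i j \<Longrightarrow> lt j k \<Longrightarrow> lt i k"
    and irrefl: "\<And>i. \<not> lt i i"
  shows "y i - inverse (c i) *s x i \<in> span {x j | j. lt i j}"
proof (induction "card {j. lt i j}" arbitrary: i rule: less_induct)
  case less
  have sub: "{y j | j. lt i j} \<subseteq> span {x j | j. lt i j}"
  proof clarify
    fix j assume ij: "lt i j"
    have "{k. lt j k} \<subset> {k. lt i k}" using ij trans irrefl by blast
    then have "card {k. lt j k} < card {k. lt i k}" by (rule psubset_card_mono[OF fin])
    then have "y j - inverse (c j) *s x j \<in> span {x k | k. lt j k}" by (rule less)
    moreover have "span {x k | k. lt j k} \<subseteq> span {x k | k. lt i k}"
      by (rule span_mono) (use ij trans in blast)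
    ultimately have "y j - inverse (c j) *s x j \<in> span {x k | k. lt i k}" by blast
    moreover have "inverse (c j) *s x j \<in> span {x k | k. lt i k}"
      using ij by (intro span_scale span_base) auto
    ultimately have "y j - inverse (c j) *s x j + inverse (c j) *s x j \<in> span {x k | k. lt i k}"
      by (rule span_add)
    then show "y j \<in> span {x k | k. lt i k}" by simp
  qed
  have "x i - c i *s y i \<in> span {x j | j. lt i j}"
    using tri[of i] span_minimal[OF sub subspace_span] by blast
  then have "(- inverse (c i)) *s (x i - c i *s y i) \<in> span {x j | j. lt i j}"
    by (rule span_scale)
  then show ?case using tri[of i] by (simp add: scale_right_diff_distrib)
qed

interpretation sf: vector_space "sf_scale :: ratfun \<Rightarrow> ratfun symfun \<Rightarrow> ratfun symfun"
  by (rule vector_space_sf_scale)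

lemma sf_coeff_simps [simp]:
  "sf_coeff 0 M = 0" "sf_coeff (f + g) M = sf_coeff f M + sf_coeff g M"
  "sf_coeff (- f) M = - sf_coeff f M" "sf_coeff (f - g) M = sf_coeff f M - sf_coeff g M"
  "sf_coeff (sf_scale c f) M = c * sf_coeff f M"
  by (simp_all only: zero_symfun.rep_eq plus_symfun.rep_eq uminus_symfun.rep_eq sf_scale.rep_eq
      minus_symfun_def diff_conv_add_uminus)

lemma sf_coeff_sum [simp]: "sf_coeff (sum f S) M = (\<Sum>s\<in>S. sf_coeff (f s) M)"
  by (induction S rule: infinite_finite_induct) simp_all

lemma sf_scale_mult [simp]:
  "sf_scale c f * g = sf_scale c (f * g)" "g * sf_scale c f = sf_scale c (g * f)"
proof -
  show "sf_scale c f * g = sf_scale c (f * g)" for f g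
    by (rule symfun_eqI) (simp add: times_symfun.rep_eq sum_distrib_left mult.assoc)
  then show "g * sf_scale c f = sf_scale c (g * f)" by (metis mult.commute)
qed

section \<open>Triangularity of power sums over monomials\<close>

definition psum :: "nat multiset \<Rightarrow> 'a :: comm_ring_1 symfun" where
  "psum A = (\<Prod>k\<in>#A. power_sum k)"

lemma psum_simps [simp]:
  "psum {#} = 1" "psum (add_mset k A) = power_sum k * psum A" "psum (A + B) = psum A * psum B"
  by (simp_all add: psum_def)

lemma power_sum_part_eq: "power_sum_part l = psum (parts_mset l)"
  by (simp add: power_sum_part_def psum_def)

text \<open>Each monomial of \<open>power_sum k\<close> is a power of one variable. For
  \<open>k = 0\<close> all these powers coincide and the power sum is 1; this is why the index 0 is
  excluded from products of power sums.\<close>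

lemma sf_coeff_power_sum_mult:
  assumes "k > 0"
  shows "sf_coeff (power_sum k * f) M =
    (\<Sum>i | i \<in># M \<and> k \<le> count M i. sf_coeff f (M - replicate_mset k i))"
proof -
  let ?I = "{i. i \<in># M \<and> k \<le> count M i}"
  have "sf_coeff (power_sum k * f) M =
      (\<Sum>A | A \<subseteq># M. (if \<exists>i. A = replicate_mset k i then sf_coeff f (M - A) else 0))"
    unfolding times_symfun.rep_eq power_sum.rep_eq by (intro sum.cong) auto
  also have "\<dots> = (\<Sum>A\<in>replicate_mset k ` ?I. sf_coeff f (M - A))"
  proof (rule sum.mono_neutral_cong_right[OF finite_submultisets])
    have *: "replicate_mset k i \<subseteq># M \<longleftrightarrow> i \<in> ?I" for i
      using assms by (auto simp: count_le_replicate_mset_subset_eq[symmetric] intro: count_inI)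
    then show "replicate_mset k ` ?I \<subseteq> {A. A \<subseteq># M}" by auto
    show "\<forall>A\<in>{A. A \<subseteq># M} - replicate_mset k ` ?I.
        (if \<exists>i. A = replicate_mset k i then sf_coeff f (M - A) else 0) = 0"
      using * by auto
  qed auto
  also have "\<dots> = (\<Sum>i\<in>?I. sf_coeff f (M - replicate_mset k i))"
  proof (rule sum.reindex_cong)
    show "inj_on (replicate_mset k) ?I"
      using assms by (intro inj_onI) (metis count_replicate_mset neq0_conv)
  qed auto
  finally show ?thesis .
qed

lemma hinge_exponents:
  assumes "finite I" "set_mset M \<subseteq> I"
  shows "hinge t (exponents M) = (\<Sum>i\<in>I. count M i - t)"
proof -
  have "hinge t (exponents M) = (\<Sum>i\<in>set_mset M. count M i - t)"
    by (simp add: hinge_def exponents_def multiset.map_comp o_def sum_unfold_sum_mset)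
  also have "\<dots> = (\<Sum>i\<in>I. count M i - t)"
    by (rule sum.mono_neutral_left) (use assms in \<open>auto simp: not_in_iff\<close>)
  finally show ?thesis .
qed

text \<open>A monomial of the product distributes the parts \<open>A\<close> among the variables, so
  its exponents are sums of parts; merging parts moves upwards in the majorization order.\<close>

lemma sf_coeff_psum_nonzero:
  assumes "0 \<notin># A" "sf_coeff (psum A :: ratfun symfun) M \<noteq> 0"
  shows "majorized A (exponents M)"
  using assms
proof (induction A arbitrary: M)
  case empty
  then have "M = {#}" by (auto simp: one_symfun.rep_eq split: if_splits)
  then show ?case by (simp add: exponents_def)
next
  case (add k A)
  have k: "k > 0" using add.prems by auto
  obtain i where i: "i \<in># M" "k \<le> count M i" "sf_coeff (psum A :: ratfun symfun) (M - replicate_mset k i) \<noteq> 0"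
    using add.prems(2) k by (auto simp: sf_coeff_power_sum_mult dest: sum.not_neutral_contains_not_neutral)
  let ?N = "M - replicate_mset k i"
  have IH: "majorized A (exponents ?N)" using add i by simp
  have "hinge t (add_mset k A) \<le> hinge t (exponents M)" for t
  proof -
    have "hinge t (exponents ?N) = (\<Sum>j\<in>set_mset M. count ?N j - t)"
      by (rule hinge_exponents) (auto dest: in_diffD)
    also have "\<dots> = (count M i - k - t) + (\<Sum>j\<in>set_mset M - {i}. count ?N j - t)"
      using i(1) by (subst sum.remove[of _ i]) auto
    also have "(\<Sum>j\<in>set_mset M - {i}. count ?N j - t) = (\<Sum>j\<in>set_mset M - {i}. count M j - t)"
      by (rule sum.cong) auto
    \<comment> \<open>Truncation is superadditive:
      \<open>(k - t) + (c - t) \<le> (k + c) - t\<close>.\<close>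
    finally have "(k - t) + hinge t (exponents ?N) \<le> (count M i - t) + (\<Sum>j\<in>set_mset M - {i}. count M j - t)"
      using i(2) by simp
    also have "\<dots> = hinge t (exponents M)"
      unfolding hinge_exponents[of "set_mset M" M, simplified] using i(1)
      by (subst (2) sum.remove[of _ i]) auto
    finally show ?thesis using IH unfolding majorized_def hinge_simps
      by (meson add_le_cancel_left le_trans)
  qed
  moreover have "sum_mset (exponents M) = k + sum_mset (exponents ?N)"
    unfolding sum_mset_exponents using i(2)
    by (simp add: size_Diff_submset count_le_replicate_mset_subset_eq[symmetric])
      (metis count_le_size le_add_diff_inverse le_trans)
  ultimately show ?case using IH by (simp add: majorized_def)
qed

lemma sf_coeff_psum_nonneg: "0 \<notin># A \<Longrightarrow> sf_coeff (psum A :: ratfun symfun) M \<ge> 0"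
  by (induction A arbitrary: M) (auto simp: one_symfun.rep_eq sf_coeff_power_sum_mult intro!: sum_nonneg)

lemma exponents_diff_replicate:
  assumes "i \<in># M"
  shows "exponents M = add_mset (count M i) (exponents (M - replicate_mset (count M i) i))"
proof -
  let ?N = "M - replicate_mset (count M i) i"
  have s: "set_mset ?N = set_mset M - {i}"
    by (auto simp: count_greater_zero_iff[symmetric] simp del: count_greater_zero_iff split: if_splits)
  have "mset_set (set_mset M) = add_mset i (mset_set (set_mset M - {i}))"
    using assms by (simp add: mset_set.remove)
  moreover have "image_mset (count M) (mset_set (set_mset M - {i})) = image_mset (count ?N) (mset_set (set_mset M - {i}))"
    by (rule image_mset_cong) auto
  ultimately show ?thesis by (simp add: exponents_def s)
qed

text \<open>All summands are nonnegative, and a variable with exponent exactly \<open>k\<close>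
  contributes a positive one, so nothing cancels.\<close>

lemma sf_coeff_psum_pos:
  assumes "0 \<notin># A" "exponents M = A"
  shows "sf_coeff (psum A :: ratfun symfun) M > 0"
  using assms
proof (induction A arbitrary: M)
  case empty
  then have "M = {#}" by (metis size_empty size_eq_0_iff_empty sum_mset.empty sum_mset_exponents)
  then show ?case by (simp add: one_symfun.rep_eq)
next
  case (add k A)
  have k: "k > 0" using add.prems by auto
  from add.prems have "k \<in># exponents M" by simp
  then obtain i where i: "i \<in># M" "count M i = k" by (auto simp: exponents_def)
  have "exponents (M - replicate_mset k i) = A"
    using exponents_diff_replicate[OF i(1)] add.prems i by simp
  then have pos: "sf_coeff (psum A :: ratfun symfun) (M - replicate_mset k i) > 0"
    using add by simp
  show ?case unfolding psum_simps sf_coeff_power_sum_mult[OF k]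
    by (rule sum_pos2[where i = i]) (use i pos add.prems in \<open>auto intro: sf_coeff_psum_nonneg\<close>)
qed

text \<open>The monomial in which x_i has the i-th part as exponent: the representative at which the
  coefficient of \<open>monomial_sym l\<close> is read off.\<close>

definition part_monomial :: "partition \<Rightarrow> nat multiset" where
  "part_monomial l = Abs_multiset (part l)"

lemma count_part_monomial [simp]: "count (part_monomial l) = part l"
  using finite_support_part[of l] by (simp add: part_monomial_def)

lemma exponents_part_monomial [simp]: "exponents (part_monomial l) = parts_mset l"
  by (simp add: exponents_def parts_mset_def set_mset_def neq0_conv)

lemma sf_coeff_exponents:
  assumes "exponents M = exponents N"
  shows "sf_coeff f M = sf_coeff f N"
proof -
  let ?I = "set_mset M \<union> set_mset N"
  \<comment> \<open>Padding with zeros over the joint support turns equal exponents into equal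
    multisets of values, which yields a permutation of that support.\<close>
  have split: "image_mset (count L) (mset_set ?I) = exponents L + replicate_mset (card ?I - card (set_mset L)) 0"
    if L: "set_mset L \<subseteq> ?I" for L
  proof -
    have "?I = set_mset L \<union> (?I - set_mset L)" using L by blast
    then have "mset_set ?I = mset_set (set_mset L) + mset_set (?I - set_mset L)"
      by (metis Diff_disjoint finite_Diff finite_UnI finite_set_mset mset_set_Union)
    moreover have "image_mset (count L) (mset_set (?I - set_mset L)) = image_mset (\<lambda>_. 0) (mset_set (?I - set_mset L))"
      by (rule image_mset_cong) (auto simp: not_in_iff)
    ultimately show ?thesis
      using L by (simp add: exponents_def image_mset_const_eq card_Diff_subset)
  qed
  have "card (set_mset M) = card (set_mset N)"
    using arg_cong[OF assms, of size] by (simp add: exponents_def)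
  then have "image_mset (count M) (mset_set ?I) = image_mset (count N) (mset_set ?I)"
    using assms by (simp add: split)
  then obtain p where p: "p permutes ?I" "\<forall>x\<in>?I. count M x = count N (p x)"
    using image_mset_eq_implies_permutes[of ?I "count M" "count N"] by auto
  have "count M x = count N (p x)" for x
  proof (cases "x \<in> ?I")
    case False
    then have "p x = x" using p(1) by (simp add: permutes_not_in)
    then show ?thesis using False by (simp add: not_in_iff)
  qed (use p in auto)
  moreover have bij: "bij p" using p(1) by (rule permutes_bij)
  ultimately have "image_mset p M = N"
     proof (intro multiset_eqI)
    fix y
    obtain x where x: "y = p x" using bij by (metis bij_pointE)
    have "p -` {p x} = {x}" using bij by (auto dest: bij_is_inj injD)
    then show "count (image_mset p M) y = count N y"
      using \<open>\<And>x. count M x = count N (p x)\<close> by (cases "x \<in># M") (auto simp: count_image_mset x not_in_iff)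
  qed
  then show ?thesis using sf_coeff[of f] bij by auto
qed

lemma zero_notin_exponents [simp]: "0 \<notin># exponents M"
  by (auto simp: exponents_def count_eq_zero_iff)

lemma sf_coeff_monomial_sym [simp]:
  "sf_coeff (monomial_sym l) (part_monomial m) = (if l = m then 1 else 0)"
  by (auto simp: monomial_sym.rep_eq)

lemma monomial_expansion:
  obtains S where "finite S" "f = (\<Sum>l\<in>S. sf_scale (sf_coeff f (part_monomial l)) (monomial_sym l))"
proof -
  obtain d where d: "\<And>M. sf_coeff f M \<noteq> 0 \<Longrightarrow> size M \<le> d" using sf_coeff[of f] by auto
  let ?S = "{l. weight l \<le> d}"
  have "f = (\<Sum>l\<in>?S. sf_scale (sf_coeff f (part_monomial l)) (monomial_sym l))"
  proof (rule symfun_eqI)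
    fix M
    obtain m where m: "parts_mset m = exponents M" using ex_parts_mset[of "exponents M"] by auto
    have fm: "sf_coeff g M = sf_coeff g (part_monomial m)" for g :: "'a symfun"
      by (rule sf_coeff_exponents) (simp add: m)
    have "(\<Sum>l\<in>?S. sf_coeff f (part_monomial l) * sf_coeff (monomial_sym l) M) =
        (\<Sum>l\<in>?S. if l = m then sf_coeff f (part_monomial m) else 0)"
      unfolding fm by (rule sum.cong) auto
    also have "\<dots> = (if m \<in> ?S then sf_coeff f (part_monomial m) else 0)"
      by (simp add: finite_weight_le)
    also have "\<dots> = sf_coeff f M"
    proof -
      have "weight m = size M" using m by (metis sum_mset_exponents sum_parts_mset)
      then show ?thesis using d[of M] fm[of f] by auto
    qed
    finally show "sf_coeff f M = sf_coeff (\<Sum>l\<in>?S. sf_scale (sf_coeff f (part_monomial l)) (monomial_sym l)) M"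
      by simp
  qed
  then show ?thesis using that finite_weight_le by blast
qed

lemma monomial_triangular:
  fixes f :: "ratfun symfun"
  assumes "\<And>m. sf_coeff f (part_monomial m) \<noteq> 0 \<Longrightarrow> R m"
  shows "f - sf_scale (sf_coeff f (part_monomial l)) (monomial_sym l) \<in> sf.span {monomial_sym m | m. R m \<and> m \<noteq> l}"
proof -
  obtain S where S: "finite S" "f = (\<Sum>l\<in>S. sf_scale (sf_coeff f (part_monomial l)) (monomial_sym l))"
    by (rule monomial_expansion)
  let ?t = "\<lambda>l. sf_scale (sf_coeff f (part_monomial l)) (monomial_sym l)"
  \<comment> \<open>If \<open>S\<close> omits \<open>l\<close>, the added term has coefficient
    0.\<close>
  have "f = sum ?t (insert l S)"
  proof (cases "l \<in> S")
    case False
    have "sf_coeff f (part_monomial l) = (\<Sum>m\<in>S. sf_coeff f (part_monomial m) * (if m = l then 1 else 0))"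
      by (subst S(2)) simp
    then have "sf_coeff f (part_monomial l) = 0" using False S(1) by (simp add: sum.delta if_distrib cong: if_cong)
    then show ?thesis using S False by simp
  qed (use S in \<open>simp add: insert_absorb\<close>)
  then have "f - ?t l = sum ?t (S - {l})"
    using S(1) by (metis add_diff_cancel_left' sum.insert_remove)
  also have "\<dots> \<in> sf.span {monomial_sym m | m. R m \<and> m \<noteq> l}"
  proof (rule sf.span_sum)
    fix m assume m: "m \<in> S - {l}"
    show "?t m \<in> sf.span {monomial_sym m | m. R m \<and> m \<noteq> l}"
    proof (cases "sf_coeff f (part_monomial m) = 0")
      case True then show ?thesis by (simp add: sf.span_zero)
    next
      case False
      then show ?thesis using m assms by (intro sf.span_scale sf.span_base) auto
    qed
  qed
  finally show ?thesis .
qed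

lemma finite_part_le [simp]:
  "finite {m. l \<unlhd> m \<and> R m}" "finite {m. m \<unlhd> l \<and> R m}"
  by (rule finite_subset[OF _ finite_weight_le[of "weight l"]], auto dest: part_le_weight)+

lemma sf_coeff_psum_parts:
  "sf_coeff (psum (parts_mset l) :: ratfun symfun) (part_monomial m) \<noteq> 0 \<Longrightarrow> l \<unlhd> m"
  unfolding part_le_def using sf_coeff_psum_nonzero[of "parts_mset l" "part_monomial m"] by simp

lemma monomial_sym_in_span_psum:
  "monomial_sym l \<in> sf.span {psum (parts_mset m) | m. True}"
proof -
  let ?c = "\<lambda>l. sf_coeff (psum (parts_mset l) :: ratfun symfun) (part_monomial l)"
  have "monomial_sym l - sf_scale (inverse (?c l)) (psum (parts_mset l))
      \<in> sf.span {psum (parts_mset m) | m. l \<unlhd> m \<and> m \<noteq> l}"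
  proof (rule sf.triangular_inverse)
    fix l :: partition
    show "?c l \<noteq> 0 \<and> psum (parts_mset l) - sf_scale (?c l) (monomial_sym l) \<in> sf.span {monomial_sym m |m. l \<unlhd> m \<and> m \<noteq> l}"
      using sf_coeff_psum_pos[of "parts_mset l" "part_monomial l"] monomial_triangular[OF sf_coeff_psum_parts[of l]]
      by simp
  qed (auto dest: part_le_trans part_le_antisym)
  then have "monomial_sym l - sf_scale (inverse (?c l)) (psum (parts_mset l)) \<in> sf.span {psum (parts_mset m) | m. True}"
    by (rule sf.span_mono[THEN subsetD, rotated]) auto
  then have "monomial_sym l - sf_scale (inverse (?c l)) (psum (parts_mset l)) + sf_scale (inverse (?c l)) (psum (parts_mset l))
      \<in> sf.span {psum (parts_mset m) | m. True}"
    by (rule sf.span_add) (intro sf.span_scale sf.span_base, auto)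
  then show ?thesis by simp
qed

text \<open>The zero function is covered by scaling with 0. Linear identities thereby reduce to
  products of power sums, without explicit basis expansions.\<close>

lemma symfun_induct [case_names add scale psum]:
  fixes f :: "ratfun symfun"
  assumes "\<And>f g. Q f \<Longrightarrow> Q g \<Longrightarrow> Q (f + g)" "\<And>c f. Q f \<Longrightarrow> Q (sf_scale c f)"
    "\<And>A. 0 \<notin># A \<Longrightarrow> Q (psum A)"
  shows "Q f"
proof -
  have sub: "sf.subspace {f. Q f}"
    unfolding sf.subspace_def using assms(1,2) assms(2)[OF assms(3)[of "{#}"], of 0] by simp
  have "sf.span {psum (parts_mset m) | m. True} \<subseteq> {f. Q f}"
    by (rule sf.span_minimal[OF _ sub]) (auto intro: assms(3))
  then have m: "Q (monomial_sym l)" for l using monomial_sym_in_span_psum by blast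
  obtain S where "f = (\<Sum>l\<in>S. sf_scale (sf_coeff f (part_monomial l)) (monomial_sym l))"
    by (rule monomial_expansion)
  then show ?thesis
    using sf.subspace_sum[OF sub, of S "\<lambda>l. sf_scale (sf_coeff f (part_monomial l)) (monomial_sym l)"] m assms(2)
    by auto
qed

lemma symfun_mult_induct [case_names add scale one mult]:
  fixes f :: "ratfun symfun"
  assumes "\<And>f g. Q f \<Longrightarrow> Q g \<Longrightarrow> Q (f + g)" "\<And>c f. Q f \<Longrightarrow> Q (sf_scale c f)"
    "Q 1" "\<And>k f. k > 0 \<Longrightarrow> Q f \<Longrightarrow> Q (power_sum k * f)"
  shows "Q f"
proof (induction f rule: symfun_induct)
  case (psum A) then show ?case by (induction A) (auto intro: assms)
qed (fact assms)+

text \<open>Compare coefficients at the monomial of \<open>l\<close>: by triangularity only the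
  \<open>m\<close> below \<open>l\<close> contribute, and those other than \<open>l\<close> have
  coefficient 0 by induction.\<close>

lemma psum_sum_eq_0:
  assumes "finite S" "(\<Sum>l\<in>S. sf_scale (c l) (psum (parts_mset l))) = (0 :: ratfun symfun)" "l \<in> S"
  shows "c l = 0"
  using assms(3)
proof (induction "card {m. m \<unlhd> l \<and> m \<noteq> l}" arbitrary: l rule: less_induct)
  case less
  let ?p = "\<lambda>m. sf_coeff (psum (parts_mset m) :: ratfun symfun) (part_monomial l)"
  have "c m * ?p m = 0" if "m \<in> S" "m \<noteq> l" for m
  proof (cases "m \<unlhd> l")
    case True
    then have "{k. k \<unlhd> m \<and> k \<noteq> m} \<subset> {k. k \<unlhd> l \<and> k \<noteq> l}"
      using that part_le_trans part_le_antisym by blast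
    then have "card {k. k \<unlhd> m \<and> k \<noteq> m} < card {k. k \<unlhd> l \<and> k \<noteq> l}"
      by (rule psubset_card_mono[OF finite_part_le(2)])
    then show ?thesis using less that by simp
  next
    case False
    then show ?thesis using sf_coeff_psum_parts[of m l] by auto
  qed
  then have "(\<Sum>m\<in>S. c m * ?p m) = c l * ?p l"
    using assms(1) less.prems by (subst sum.remove[of _ l]) (auto intro!: sum.neutral simp del: mult_eq_0_iff)
  moreover have "(\<Sum>m\<in>S. c m * ?p m) = 0"
    using arg_cong[OF assms(2), of "\<lambda>f. sf_coeff f (part_monomial l)"] by simp
  ultimately show ?case using sf_coeff_psum_pos[of "parts_mset l" "part_monomial l"] by simp
qed

lemma inj_psum: "inj_on (psum :: _ \<Rightarrow> ratfun symfun) {A. 0 \<notin># A}"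
proof (rule inj_onI, rule ccontr)
  fix A B :: "nat multiset" assume *: "A \<in> {A. 0 \<notin># A}" "B \<in> {A. 0 \<notin># A}" "psum A = (psum B :: ratfun symfun)" "A \<noteq> B"
  obtain l m where lm: "parts_mset l = A" "parts_mset m = B" using * ex_parts_mset by (metis mem_Collect_eq)
  then have "l \<noteq> m" using * by auto
  then have "(\<Sum>k\<in>{l, m}. sf_scale (if k = l then 1 else -1) (psum (parts_mset k))) = (0 :: ratfun symfun)"
    using * lm by simp
  then show False using psum_sum_eq_0[of "{l, m}" "\<lambda>k. if k = l then 1 else -1" l] by simp
qed

lemma independent_psum: "sf.independent (psum ` {A. 0 \<notin># A})"
  unfolding sf.dependent_explicit
proof clarify
  fix T :: "ratfun symfun set" and u v assume T: "finite T" "T \<subseteq> psum ` {A. 0 \<notin># A}" "(\<Sum>v\<in>T. sf_scale (u v) v) = 0" "v \<in> T" "u v \<noteq> 0"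
  let ?S = "{l. psum (parts_mset l) \<in> T}"
  have inj: "inj_on (\<lambda>l. psum (parts_mset l) :: ratfun symfun) X" for X
    by (rule inj_onI) (use inj_psum in \<open>auto dest: inj_onD\<close>)
  have img: "(\<lambda>l. psum (parts_mset l)) ` ?S = T"
    using T(2) by (auto 0 3 elim: ex_parts_mset simp: image_iff)
  have "finite ((\<lambda>l. psum (parts_mset l) :: ratfun symfun) ` ?S)" unfolding img by (rule T(1))
  then have "finite ?S" by (rule finite_imageD[OF _ inj])
  moreover have "(\<Sum>l\<in>?S. sf_scale (u (psum (parts_mset l))) (psum (parts_mset l))) = 0"
    using T(3) sum.reindex[OF inj, of "\<lambda>v. sf_scale (u v) v" ?S] img by simp
  moreover obtain l where "l \<in> ?S" "v = psum (parts_mset l)" using T(4) img by blast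
  ultimately show False using T(5) psum_sum_eq_0[of ?S "\<lambda>l. u (psum (parts_mset l))" l] by simp
qed

text \<open>The common source of the scalar product, of \<open>psum_adj\<close> and of
  \<open>specialize\<close>, all prescribed by their values on power sums.\<close>

lemma ex_linear_on_psum:
  assumes "vector_space s"
  obtains L where "Vector_Spaces.linear sf_scale s L" "\<And>A. 0 \<notin># A \<Longrightarrow> L (psum A :: ratfun symfun) = h A"
proof -
  interpret vector_space_pair "sf_scale :: ratfun \<Rightarrow> ratfun symfun \<Rightarrow> _" s
    using assms by (intro vector_space_pair.intro vector_space_sf_scale)
  let ?B = "psum ` {A. 0 \<notin># A}"
  let ?L = "construct ?B (\<lambda>b. h (inv_into {A. 0 \<notin># A} psum b))"
  have "?L (psum A) = h A" if "0 \<notin># A" for A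
    using that construct_basis[OF independent_psum, of "psum A"] inv_into_f_f[OF inj_psum, of A] by simp
  then show ?thesis using that[of ?L] linear_construct[OF independent_psum] by blast
qed

section \<open>The scalar product and the operators adjoint to power sums\<close>

text \<open>The order of the fraction field compares leading coefficients, so \<alpha> even exceeds
  every rational number.\<close>

lemma \<alpha>_pos: "\<alpha> > 0"
proof -
  have "[:0, 1:] > (0 :: rat poly)" by (simp add: less_poly_def pos_poly_pCons)
  then show ?thesis unfolding \<alpha>_def by (subst zero_less_Fract_iff) auto
qed

lemma \<alpha>_nonzero [simp]: "\<alpha> \<noteq> 0" using \<alpha>_pos by simp

lemma of_nat_fract: "(of_nat n :: ratfun) = Fract (of_nat n) 1"
  by (induction n) (simp_all add: Zero_fract_def One_fract_def)

lemma \<alpha>_independent: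
  assumes "of_nat a * \<alpha> + of_nat b = of_nat c * \<alpha> + (of_nat d :: ratfun)"
  shows "a = c"
proof -
  have eq: "of_nat a * \<alpha> + of_nat b = Fract [:of_nat b, of_nat a:] 1" for a b
    by (simp add: of_nat_fract \<alpha>_def of_nat_poly)
  have "[:of_nat b, of_nat a:] = [:of_nat d, (of_nat c :: rat):]"
    using assms unfolding eq by (simp add: eq_fract)
  then show ?thesis by simp
qed

lemma linear_sf_simps:
  assumes "Vector_Spaces.linear sf_scale s L"
  shows "L (f + g) = L f + L g" "L (sf_scale c f) = s c (L f)" "L 0 = 0" "L (- f) = - L f"
    "L (f - g) = L f - L g" "L (sum h S) = (\<Sum>x\<in>S. L (h x))"
proof -
  interpret Vector_Spaces.linear sf_scale s L by fact
  show "L (f + g) = L f + L g" "L (sf_scale c f) = s c (L f)" "L 0 = 0" "L (- f) = - L f"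
    "L (f - g) = L f - L g" "L (sum h S) = (\<Sum>x\<in>S. L (h x))"
    by (simp_all add: add scale zero neg diff sum)
qed

lemma linearI_sf:
  assumes "vector_space s" "\<And>f g. L (f + g) = L f + L g" "\<And>c f. L (sf_scale c f) = s c (L f)"
  shows "Vector_Spaces.linear (sf_scale :: ratfun \<Rightarrow> _) s L"
proof -
  interpret s: vector_space s by fact
  show ?thesis
    by (intro Vector_Spaces.linear.intro module_hom.intro module_hom_axioms.intro
      vector_space_sf_scale sf.module_axioms s.module_axioms assms) 
qed

lemma vector_space_ratfun: "vector_space ((*) :: ratfun \<Rightarrow> _)"
  by unfold_locales (auto simp: algebra_simps)

section \<open>Existence, uniqueness and definiteness of the scalar product\<close>

definition z_mset :: "nat multiset \<Rightarrow> nat" where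
  "z_mset A = (\<Prod>i\<in>set_mset A. i ^ count A i * fact (count A i))"

definition psum_norm :: "nat multiset \<Rightarrow> ratfun" where
  "psum_norm A = of_nat (z_mset A) * \<alpha> ^ size A"

lemma psum_norm_pos: "0 \<notin># A \<Longrightarrow> psum_norm A > 0"
  using \<alpha>_pos by (auto simp: psum_norm_def z_mset_def intro!: mult_pos_pos prod_pos gr0I)

lemma psum_norm_add:
  assumes "k > 0"
  shows "psum_norm (add_mset k A) = \<alpha> * of_nat (k * Suc (count A k)) * psum_norm A"
proof -
  let ?I = "insert k (set_mset A)"
  have "z_mset B = (\<Prod>i\<in>?I. i ^ count B i * fact (count B i))" if "set_mset B \<subseteq> ?I" for B
    unfolding z_mset_def by (rule prod.mono_neutral_left) (use that in \<open>auto simp: not_in_iff\<close>)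
  then have *: "z_mset B = (k ^ count B k * fact (count B k)) * (\<Prod>i\<in>?I - {k}. i ^ count B i * fact (count B i))"
    if "set_mset B \<subseteq> ?I" for B using that by (subst prod.remove[symmetric]) auto
  have "z_mset A = (k ^ count A k * fact (count A k)) * (\<Prod>i\<in>?I - {k}. i ^ count A i * fact (count A i))"
    by (rule *) auto
  moreover have "(\<Prod>i\<in>?I - {k}. i ^ count (add_mset k A) i * fact (count (add_mset k A) i)) =
      (\<Prod>i\<in>?I - {k}. i ^ count A i * fact (count A i))"
    by (rule prod.cong) auto
  moreover have "z_mset (add_mset k A) = (k ^ Suc (count A k) * fact (Suc (count A k))) *
      (\<Prod>i\<in>?I - {k}. i ^ count (add_mset k A) i * fact (count (add_mset k A) i))"
    using *[of "add_mset k A"] by simp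
  ultimately have "z_mset (add_mset k A) = k * Suc (count A k) * z_mset A"
    by (simp add: mult_ac del: mult_Suc mult_Suc_right)
  then show ?thesis by (simp add: psum_norm_def algebra_simps)
qed

text \<open>Names the description that defines \<open>jack_inner\<close>, so that existence and
  uniqueness can be shown for it.\<close>

definition is_jack_inner :: "(ratfun symfun \<Rightarrow> ratfun symfun \<Rightarrow> ratfun) \<Rightarrow> bool" where
  "is_jack_inner B \<longleftrightarrow>
     (\<forall>f. Vector_Spaces.linear sf_scale (*) (\<lambda>g. B f g)) \<and>
     (\<forall>g. Vector_Spaces.linear sf_scale (*) (\<lambda>f. B f g)) \<and>
     (\<forall>l m. B (power_sum_part l) (power_sum_part m) =
        (if l = m then of_nat (z_part l) * \<alpha> ^ num_parts l else 0))"

lemma is_jack_inner_psum: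
  assumes "is_jack_inner B" "0 \<notin># A" "0 \<notin># A'"
  shows "B (psum A) (psum A') = (if A = A' then psum_norm A else 0)"
proof -
  obtain l m where lm: "parts_mset l = A" "parts_mset m = A'" using assms ex_parts_mset by metis
  have "B (power_sum_part l) (power_sum_part m) =
        (if l = m then of_nat (z_part l) * \<alpha> ^ num_parts l else 0)"
    using assms(1) by (simp add: is_jack_inner_def)
  then show ?thesis
    by (simp add: power_sum_part_eq psum_norm_def z_mset_def z_part_def flip: lm size_parts_mset)
qed

text \<open>Two linear extensions in turn: \<open>coord A\<close> is the pairing with
  \<open>psum A\<close>, and \<open>B h\<close> extends the values \<open>coord A h\<close> to all
  second arguments.\<close>

lemma ex_is_jack_inner: "\<exists>B. is_jack_inner B"
proof -
  note vs = vector_space_ratfun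
  have "\<exists>L. Vector_Spaces.linear sf_scale (*) L \<and> (\<forall>B. 0 \<notin># B \<longrightarrow> L (psum B :: ratfun symfun) = (if A = B then psum_norm A else 0))" for A
    by (rule ex_linear_on_psum[OF vs, where h = "\<lambda>B. if A = B then psum_norm A else 0"]) blast
  then obtain coord where coord: "\<And>A. Vector_Spaces.linear sf_scale (*) (coord A)"
    "\<And>A B. 0 \<notin># B \<Longrightarrow> coord A (psum B :: ratfun symfun) = (if A = B then psum_norm A else 0)" by metis
  have "\<exists>L. Vector_Spaces.linear sf_scale (*) L \<and> (\<forall>A. 0 \<notin># A \<longrightarrow> L (psum A :: ratfun symfun) = coord A h)" for h
    by (rule ex_linear_on_psum[OF vs, where h = "\<lambda>A. coord A h"]) blast
  then obtain B where B: "\<And>h. Vector_Spaces.linear sf_scale (*) (B h)"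
    "\<And>A h. 0 \<notin># A \<Longrightarrow> B h (psum A :: ratfun symfun) = coord A h" by metis
  have "B (h + h') f = B h f + B h' f" for h h' f
    by (induction f rule: symfun_induct)
      (simp_all add: B(2) linear_sf_simps[OF B(1)] linear_sf_simps[OF coord(1)] algebra_simps)
  moreover have "B (sf_scale c h) f = c * B h f" for c h f
    by (induction f rule: symfun_induct)
      (simp_all add: B(2) linear_sf_simps[OF B(1)] linear_sf_simps[OF coord(1)] algebra_simps)
  ultimately have "Vector_Spaces.linear sf_scale (*) (\<lambda>h. B h f)" for f
    by (intro linearI_sf vs)
  moreover have "B (power_sum_part m) (power_sum_part l) =
        (if l = m then of_nat (z_part l) * \<alpha> ^ num_parts l else 0)" for l m
    by (auto simp: power_sum_part_eq B coord z_part_def psum_norm_def z_mset_def size_parts_mset)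
  ultimately have "is_jack_inner (\<lambda>f h. B h f)" using B(1) by (simp add: is_jack_inner_def)
  then show ?thesis by blast
qed

lemma is_jack_inner_unique:
  assumes B: "is_jack_inner B" and C: "is_jack_inner C"
  shows "B = C"
proof (intro ext)
  fix f h
  have lin: "Vector_Spaces.linear sf_scale (*) (\<lambda>g. X f g)" "Vector_Spaces.linear sf_scale (*) (\<lambda>f. X f g)"
    if "is_jack_inner X" for X f g using that by (simp_all add: is_jack_inner_def)
  have "B (psum A) h = C (psum A) h" if "0 \<notin># A" for A
    by (induction h rule: symfun_induct)
      (simp_all add: that is_jack_inner_psum[OF B] is_jack_inner_psum[OF C]
        linear_sf_simps[OF lin(1)[OF B]] linear_sf_simps[OF lin(1)[OF C]])
  then show "B f h = C f h"
    by (induction f rule: symfun_induct)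
      (simp_all add: linear_sf_simps[OF lin(2)[OF B]] linear_sf_simps[OF lin(2)[OF C]])
qed

lemma is_jack_inner_jack_inner: "is_jack_inner jack_inner"
proof -
  have "is_jack_inner (THE B. is_jack_inner B)"
    by (rule theI'[of is_jack_inner]) (metis ex_is_jack_inner is_jack_inner_unique)
  then show ?thesis unfolding jack_inner_def is_jack_inner_def[symmetric] .
qed

lemmas jack_inner_psum = is_jack_inner_psum[OF is_jack_inner_jack_inner]

lemma linear_jack_inner:
  "Vector_Spaces.linear sf_scale (*) (\<lambda>g. jack_inner f g)"
  "Vector_Spaces.linear sf_scale (*) (\<lambda>f. jack_inner f g)"
  using is_jack_inner_jack_inner by (simp_all add: is_jack_inner_def)

lemmas jack_inner_simps [simp] =
  linear_sf_simps[OF linear_jack_inner(1)] linear_sf_simps[OF linear_jack_inner(2)]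

lemma jack_inner_commute: "jack_inner f h = jack_inner h f"
proof -
  have "jack_inner (psum A) h = jack_inner h (psum A)" if "0 \<notin># A" for A
    by (induction h rule: symfun_induct) (auto simp: that jack_inner_psum)
  then show ?thesis by (induction f rule: symfun_induct) simp_all
qed

text \<open>Power sums are orthogonal with positive norms, so the pairing of \<open>f\<close> with
  itself is a positive combination of squares in an ordered field.\<close>

lemma jack_inner_eq_0_iff [simp]: "jack_inner f f = 0 \<longleftrightarrow> f = 0"
proof
  assume f0: "jack_inner f f = 0"
  let ?P = "psum ` {A. 0 \<notin># A} :: ratfun symfun set"
  have "f \<in> sf.span ?P"
    by (induction f rule: symfun_induct) (auto intro: sf.span_add sf.span_scale sf.span_base)
  then obtain T r where T: "finite T" "T \<subseteq> ?P" "f = (\<Sum>a\<in>T. sf_scale (r a) a)"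
    unfolding sf.span_explicit by blast
  have orth: "jack_inner a b = 0" if ab: "a \<in> T" "b \<in> T" "a \<noteq> b" for a b
  proof -
    obtain A B :: "nat multiset" where "a = psum A" "b = psum B" "0 \<notin># A" "0 \<notin># B" using ab T(2) by blast
    then show ?thesis using ab by (auto simp: jack_inner_psum)
  qed
  have pos: "jack_inner a a > 0" if "a \<in> T" for a
    using that T(2) by (auto simp: jack_inner_psum psum_norm_pos)
  have "jack_inner f f = (\<Sum>a\<in>T. \<Sum>b\<in>T. r a * (r b * jack_inner b a))"
    unfolding T(3) by (simp add: sum_distrib_left)
  also have "\<dots> = (\<Sum>a\<in>T. \<Sum>b\<in>T. if b = a then r a * r a * jack_inner a a else 0)"
    by (intro sum.cong refl) (auto simp: orth)
  also have "\<dots> = (\<Sum>a\<in>T. r a * r a * jack_inner a a)" using T(1) by simp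
  finally have "(\<Sum>a\<in>T. r a * r a * jack_inner a a) = 0" using f0 by simp
  moreover have "0 \<le> r a * r a * jack_inner a a" if "a \<in> T" for a using pos[OF that] by simp
  ultimately have "r a = 0" if "a \<in> T" for a
    using T(1) that pos[OF that] by (subst (asm) sum_nonneg_eq_0_iff) auto
  then show "f = 0" unfolding T(3) by simp
qed simp

text \<open>In the variables \<open>p\<^sub>1, p\<^sub>2, \<dots>\<close> this is \<open>\<alpha> k \<partial>/\<partial>p\<^sub>k\<close>.\<close>

definition psum_adj :: "nat \<Rightarrow> ratfun symfun \<Rightarrow> ratfun symfun" where
  "psum_adj k = (SOME L. Vector_Spaces.linear sf_scale sf_scale L \<and>
     (\<forall>A. 0 \<notin># A \<longrightarrow> L (psum A) = sf_scale (\<alpha> * of_nat (k * count A k)) (psum (A - {#k#}))))"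

lemma psum_adj_spec: "Vector_Spaces.linear sf_scale sf_scale (psum_adj k) \<and>
     (\<forall>A. 0 \<notin># A \<longrightarrow> psum_adj k (psum A) = sf_scale (\<alpha> * of_nat (k * count A k)) (psum (A - {#k#})))"
  proof -
  have "\<exists>L. Vector_Spaces.linear sf_scale sf_scale L \<and>
     (\<forall>A. 0 \<notin># A \<longrightarrow> L (psum A :: ratfun symfun) = sf_scale (\<alpha> * of_nat (k * count A k)) (psum (A - {#k#})))"
    by (rule ex_linear_on_psum[OF vector_space_sf_scale, where h = "\<lambda>A. sf_scale (\<alpha> * of_nat (k * count A k)) (psum (A - {#k#}))"]) blast
  from someI_ex[OF this] show ?thesis unfolding psum_adj_def .
qed

lemmas linear_psum_adj = psum_adj_spec[THEN conjunct1]
lemmas psum_adj_psum = psum_adj_spec[THEN conjunct2, rule_format]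
lemmas psum_adj_simps [simp] = linear_sf_simps[OF linear_psum_adj]

lemma psum_adj_1 [simp]: "psum_adj k 1 = 0"
  using psum_adj_psum[of "{#}" k] by simp

text \<open>The Heisenberg commutation relation between power sums and their adjoints; the Leibniz
  rule and the commutation of adjoints follow from it by induction.\<close>

lemma psum_adj_power_sum_mult:
  assumes "j > 0"
  shows "psum_adj k (power_sum j * f) = sf_scale (if j = k then \<alpha> * of_nat k else 0) f + power_sum j * psum_adj k f"
proof (induction f rule: symfun_induct)
  case (psum A)
  have "psum_adj k (psum (add_mset j A)) = sf_scale (\<alpha> * of_nat (k * count (add_mset j A) k)) (psum (add_mset j A - {#k#}))"
    using psum assms by (intro psum_adj_psum) auto
  moreover have "add_mset j A - {#k#} = (if j = k then A else add_mset j (A - {#k#}))" by auto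
  moreover have "count A k = 0 \<or> power_sum k * psum (A - {#k#}) = (psum A :: ratfun symfun)"
    by (auto simp: psum_simps(2)[symmetric] not_in_iff[symmetric] simp del: psum_simps)
  ultimately show ?case using psum assms
    by (cases "j = k") (auto simp: psum_adj_psum sf.scale_left_distrib algebra_simps)
qed (simp_all add: algebra_simps sf.scale_right_distrib)

lemma psum_adj_mult: "psum_adj k (f * h) = psum_adj k f * h + f * psum_adj k h"
  by (induction f rule: symfun_mult_induct)
    (simp_all add: distrib_left distrib_right sf.scale_right_distrib psum_adj_power_sum_mult mult.assoc)

lemma psum_adj_power_sum: "j > 0 \<Longrightarrow> psum_adj k (power_sum j) = sf_scale (if j = k then \<alpha> * of_nat k else 0) 1"
  using psum_adj_power_sum_mult[of j k 1] by simp

lemma psum_adj_commute: "psum_adj i (psum_adj j f) = psum_adj j (psum_adj i f)"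
  by (induction f rule: symfun_mult_induct) (auto simp: psum_adj_power_sum_mult)

lemma psum_adj_prod:
  "psum_adj k (\<Prod>i\<in>I. F i) = (\<Sum>i\<in>I. psum_adj k (F i) * (\<Prod>j\<in>I - {i}. F j))"
proof (induction I rule: infinite_finite_induct)
  case (insert x I)
  have "(\<Prod>j\<in>insert x I - {i}. F j) = F x * (\<Prod>j\<in>I - {i}. F j)" if "i \<in> I" for i
  proof -
    have "insert x I - {i} = insert x (I - {i})" using insert that by auto
    then show ?thesis using insert by simp
  qed
  then have "(\<Sum>i\<in>I. psum_adj k (F i) * (\<Prod>j\<in>insert x I - {i}. F j)) = F x * psum_adj k (\<Prod>i\<in>I. F i)"
    unfolding insert.IH sum_distrib_left by (intro sum.cong) (simp_all add: mult_ac)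
  then show ?case using insert by (simp add: psum_adj_mult)
qed simp_all

lemma psum_adj_bounded: "\<exists>n. \<forall>k>n. psum_adj k f = 0"
proof (induction f rule: symfun_mult_induct)
  case (add f g)
  then obtain n m where "\<forall>k>n. psum_adj k f = 0" "\<forall>k>m. psum_adj k g = 0" by blast
  then show ?case by (intro exI[of _ "max n m"]) simp
next
  case (mult j f)
  then obtain n where "\<forall>k>n. psum_adj k f = 0" by blast
  then show ?case using mult(1) by (intro exI[of _ "max n j"]) (simp add: psum_adj_power_sum_mult)
qed auto

lemma jack_inner_power_sum:
  assumes "k > 0"
  shows "jack_inner (power_sum k * f) h = jack_inner f (psum_adj k h)"
proof -
  have "jack_inner (power_sum k * psum A) h = jack_inner (psum A) (psum_adj k h)" if A: "0 \<notin># A" for A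
  proof (induction h rule: symfun_induct)
    case (psum B)
    have "jack_inner (psum (add_mset k A)) (psum B) = (if add_mset k A = B then psum_norm (add_mset k A) else 0)"
      using psum A assms by (intro jack_inner_psum) auto
    moreover have "jack_inner (psum A) (psum (B - {#k#})) = (if A = B - {#k#} then psum_norm A else 0)"
      using psum A by (intro jack_inner_psum) (auto dest: in_diffD)
    moreover have "psum_norm (add_mset k A) = \<alpha> * of_nat (k * count B k) * psum_norm A" if "add_mset k A = B"
      using that by (auto simp: psum_norm_add[OF assms] simp del: of_nat_mult mult_Suc_right)
    moreover have "add_mset k A = B \<longleftrightarrow> count B k > 0 \<and> A = B - {#k#}" by auto
    ultimately show ?case using psum
      by (cases "count B k = 0") (simp_all add: psum_adj_psum del: of_nat_mult)
  qed (simp_all add: algebra_simps)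
  then show ?thesis by (induction f rule: symfun_induct) (simp_all add: algebra_simps)
qed

section \<open>Generating series\<close>

text \<open>The coefficients of \<open>exp (\<theta> \<Sum>\<^sub>k p\<^sub>k y\<^sup>k / k)\<close>. For \<open>\<theta> = 1 / \<alpha>\<close> these are the functions
  dual to the monomials; for \<open>\<theta> = -1\<close> they are \<open>(-1)\<^sup>n e\<^sub>n\<close>.\<close>

fun gen :: "ratfun \<Rightarrow> nat \<Rightarrow> ratfun symfun" where
  "gen \<theta> 0 = 1"
| "gen \<theta> (Suc n) = sf_scale (\<theta> / of_nat (Suc n)) (\<Sum>k\<le>n. power_sum (Suc k) * gen \<theta> (n - k))"

declare gen.simps(2) [simp del]

lemma gen_rec:
  "sf_scale \<theta> (\<Sum>k<n. power_sum (Suc k) * gen \<theta> (n - Suc k)) = sf_scale (of_nat n) (gen \<theta> n)"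
proof (cases n)
  case (Suc m)
  have "of_nat (Suc m) * (\<theta> / of_nat (Suc m)) = \<theta>" by (simp del: of_nat_Suc)
  then show ?thesis by (simp add: Suc gen.simps(2) lessThan_Suc_atMost del: of_nat_Suc)
qed simp

lemma gen_1: "gen \<theta> 1 = sf_scale \<theta> (power_sum 1)"
  by (simp add: gen.simps(2)[of \<theta> 0, simplified])

lemma sf_scale_of_nat_cancel: "n > 0 \<Longrightarrow> sf_scale (of_nat n :: ratfun) f = sf_scale (of_nat n) g \<Longrightarrow> f = g"
  by simp

text \<open>\<open>psum_adj k\<close> multiplies the exponential series by \<alpha> \<theta> y^k. On
  coefficients this follows from Newton's recursion, which expresses \<open>n\<close> times the n-th
  one.\<close>

lemma psum_adj_gen:
  assumes "k > 0"
  shows "psum_adj k (gen \<theta> n) = (if k \<le> n then sf_scale (\<alpha> * \<theta>) (gen \<theta> (n - k)) else 0)"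
proof (induction n rule: less_induct)
  case (less n)
  show ?case
  proof (cases "n = 0")
    case False
    let ?S = "\<lambda>f. \<Sum>j<n. power_sum (Suc j) * f j"
    have "sf_scale (of_nat n) (psum_adj k (gen \<theta> n)) = psum_adj k (sf_scale \<theta> (?S (\<lambda>j. gen \<theta> (n - Suc j))))"
      by (simp only: gen_rec psum_adj_simps)
    also have "\<dots> = sf_scale \<theta> (\<Sum>j<n. sf_scale (if Suc j = k then \<alpha> * of_nat k else 0) (gen \<theta> (n - Suc j)))
        + sf_scale \<theta> (?S (\<lambda>j. psum_adj k (gen \<theta> (n - Suc j))))"
      by (simp add: psum_adj_power_sum_mult sum.distrib sf.scale_right_distrib)
    also have "(\<Sum>j<n. sf_scale (if Suc j = k then \<alpha> * of_nat k else 0) (gen \<theta> (n - Suc j)))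
        = (\<Sum>j<n. if j = k - 1 then sf_scale (\<alpha> * of_nat k) (gen \<theta> (n - k)) else 0)"
      using assms by (intro sum.cong) auto
    also have "\<dots> = (if k \<le> n then sf_scale (\<alpha> * of_nat k) (gen \<theta> (n - k)) else 0)"
      using assms by auto
    also have "?S (\<lambda>j. psum_adj k (gen \<theta> (n - Suc j))) =
        (\<Sum>j<n - k. power_sum (Suc j) * sf_scale (\<alpha> * \<theta>) (gen \<theta> (n - k - Suc j)))"
      using assms by (intro sum.mono_neutral_cong_right) (auto simp: less diff_right_commute add.commute)
    also have "\<dots> = sf_scale \<alpha> (sf_scale \<theta> (\<Sum>j<n - k. power_sum (Suc j) * gen \<theta> (n - k - Suc j)))"
      by (simp add: sf.scale_sum_right)
    also have "\<dots> = sf_scale (\<alpha> * of_nat (n - k)) (gen \<theta> (n - k))" by (simp only: gen_rec sf.scale_scale)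
    also have "sf_scale \<theta> (if k \<le> n then sf_scale (\<alpha> * of_nat k) (gen \<theta> (n - k)) else 0) +
          sf_scale \<theta> (sf_scale (\<alpha> * of_nat (n - k)) (gen \<theta> (n - k))) =
        sf_scale (of_nat n) (if k \<le> n then sf_scale (\<alpha> * \<theta>) (gen \<theta> (n - k)) else 0)"
    proof (cases "k \<le> n")
      case True
      have "\<theta> * (\<alpha> * of_nat k) + \<theta> * (\<alpha> * of_nat (n - k)) = of_nat n * (\<alpha> * \<theta>)"
        using True by (simp add: of_nat_diff algebra_simps)
      then show ?thesis using True by (simp add: sf.scale_left_distrib[symmetric])
    qed simp
    finally have "sf_scale (of_nat n) (psum_adj k (gen \<theta> n)) =
        sf_scale (of_nat n) (if k \<le> n then sf_scale (\<alpha> * \<theta>) (gen \<theta> (n - k)) else 0)" .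
    then show ?thesis by (rule sf_scale_of_nat_cancel[rotated]) (use False in simp)
  qed (use assms in simp)
qed

definition gen_prod :: "ratfun \<Rightarrow> nat multiset \<Rightarrow> ratfun symfun" where
  "gen_prod \<theta> A = (\<Prod>k\<in>#A. gen \<theta> k)"

lemma gen_prod_simps [simp]:
  "gen_prod \<theta> {#} = 1" "gen_prod \<theta> (add_mset k A) = gen \<theta> k * gen_prod \<theta> A"
  "gen_prod \<theta> (A + B) = gen_prod \<theta> A * gen_prod \<theta> B"
  by (simp_all add: gen_prod_def)

lemma jack_inner_1_gen: "jack_inner 1 (gen \<theta> n * h) = (if n = 0 then jack_inner 1 h else 0)"
proof (cases n)
  case (Suc m)
  have "jack_inner 1 (power_sum (Suc k) * f) = 0" for k f
    by (simp add: jack_inner_commute[of 1] jack_inner_power_sum)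
  then show ?thesis
    by (simp add: Suc gen.simps(2) sum_distrib_right mult.assoc)
qed simp

text \<open>For \<theta> = 1/\<alpha> the adjoint of p_k lowers the index of one factor by
  \<open>k\<close> with coefficient 1. By the Leibniz rule this is the same sum as the one for the
  coefficients of p_k f.\<close>

lemma jack_inner_gen_prod: "jack_inner f (gen_prod (1 / \<alpha>) (exponents M)) = sf_coeff f M"
proof (induction f arbitrary: M rule: symfun_mult_induct)
  case one
  have "jack_inner 1 (gen_prod (1 / \<alpha>) A) = (if A = {#} then 1 else 0)" if "0 \<notin># A" for A
  proof (cases A)
    case empty
    then show ?thesis using jack_inner_psum[of "{#}" "{#}"] by (simp add: psum_norm_def z_mset_def)
  qed (use that in \<open>auto simp: jack_inner_1_gen\<close>)
  moreover have "exponents M = {#} \<longleftrightarrow> M = {#}"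
    by (simp add: exponents_def mset_set_empty_iff)
  ultimately show ?case by (simp add: one_symfun.rep_eq)
next
  case (mult k f)
  let ?G = "\<lambda>N. \<Prod>i\<in>set_mset M. gen (1 / \<alpha>) (count N i)"
  have G: "gen_prod (1 / \<alpha>) (exponents N) = ?G N" if "set_mset N \<subseteq> set_mset M" for N
  proof -
    have "gen_prod (1 / \<alpha>) (exponents N) = (\<Prod>i\<in>set_mset N. gen (1 / \<alpha>) (count N i))"
      by (simp add: gen_prod_def exponents_def multiset.map_comp o_def prod_unfold_prod_mset)
    also have "\<dots> = ?G N" by (rule prod.mono_neutral_left) (use that in \<open>auto simp: not_in_iff\<close>)
    finally show ?thesis .
  qed
  have "psum_adj k (?G M) = (\<Sum>i\<in>set_mset M. psum_adj k (gen (1 / \<alpha>) (count M i)) * (\<Prod>j\<in>set_mset M - {i}. gen (1 / \<alpha>) (count M j)))"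
    by (rule psum_adj_prod)
  also have "\<dots> = (\<Sum>i | i \<in># M \<and> k \<le> count M i. ?G (M - replicate_mset k i))"
  proof (rule sum.mono_neutral_cong_right)
    show "psum_adj k (gen (1 / \<alpha>) (count M i)) * (\<Prod>j\<in>set_mset M - {i}. gen (1 / \<alpha>) (count M j)) =
        ?G (M - replicate_mset k i)" if i: "i \<in> {i. i \<in># M \<and> k \<le> count M i}" for i
      using i mult(1) by (subst (2) prod.remove[of _ i]) (auto simp: psum_adj_gen intro!: prod.cong)
  qed (use mult(1) in \<open>auto simp: psum_adj_gen\<close>)
  also have "\<dots> = (\<Sum>i | i \<in># M \<and> k \<le> count M i. gen_prod (1 / \<alpha>) (exponents (M - replicate_mset k i)))"
    by (intro sum.cong refl G[symmetric]) (auto dest: in_diffD)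
  finally have "psum_adj k (gen_prod (1 / \<alpha>) (exponents M)) =
      (\<Sum>i | i \<in># M \<and> k \<le> count M i. gen_prod (1 / \<alpha>) (exponents (M - replicate_mset k i)))"
    by (simp add: G)
  then show ?case
    using mult by (simp add: jack_inner_power_sum sf_coeff_power_sum_mult)
qed simp_all

lemma jack_inner_gen_prod_parts:
  "jack_inner f (gen_prod (1 / \<alpha>) (parts_mset l)) = sf_coeff f (part_monomial l)"
  using jack_inner_gen_prod[of f "part_monomial l"] by simp

section \<open>The Laplace-Beltrami operator\<close>

lemma jack_inner_psum_adj:
  "k > 0 \<Longrightarrow> jack_inner (psum_adj k f) h = jack_inner f (power_sum k * h)"
  using jack_inner_power_sum[of k h f] by (simp add: jack_inner_commute)

text \<open>In variables \<open>x\<^sub>1, \<dots>, x\<^sub>n\<close> this is \<open>\<alpha>/2 \<Sum>\<^sub>i x\<^sub>i\<^sup>2 \<partial>\<^sub>i\<^sup>2 + \<Sum>\<^sub>i\<^sub><\<^sub>j x\<^sub>i x\<^sub>j / (x\<^sub>i - x\<^sub>j) (\<partial>\<^sub>i - \<partial>\<^sub>j)\<close>.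
  Written in power sums it is visibly self-adjoint. For each \<open>f\<close>, only finitely many terms of
  the infinite sums are nonzero, so they are truncated at a bound depending on \<open>f\<close>.\<close>

definition laplace_upto :: "nat \<Rightarrow> ratfun symfun \<Rightarrow> ratfun symfun" where
  "laplace_upto n f = sf_scale (1 / (2 * \<alpha>))
    ((\<Sum>(i, j)\<in>{..<n} \<times> {..<n}.
        power_sum (Suc (Suc (i + j))) * psum_adj (Suc i) (psum_adj (Suc j) f) +
        power_sum (Suc i) * (power_sum (Suc j) * psum_adj (Suc (Suc (i + j))) f)) +
     sf_scale (\<alpha> - 1) (\<Sum>i<n. sf_scale (of_nat i) (power_sum (Suc i) * psum_adj (Suc i) f)))"

definition laplace :: "ratfun symfun \<Rightarrow> ratfun symfun" where
  "laplace f = laplace_upto (SOME n. \<forall>k>n. psum_adj k f = 0) f"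

lemma laplace_upto_le:
  assumes "\<forall>k>n. psum_adj k f = 0" "n \<le> m"
  shows "laplace_upto m f = laplace_upto n f"
proof -
  \<comment> \<open>When only \<open>i\<close> reaches the bound, the two adjoints are interchanged
    first.\<close>
  have 0: "psum_adj (Suc i) (psum_adj (Suc j) f) = 0" "psum_adj (Suc (Suc (i + j))) f = 0"
    if "i \<ge> n \<or> j \<ge> n" for i j
    using that assms(1) psum_adj_commute[of "Suc i" "Suc j" f] by auto
  let ?A = "\<lambda>(i, j). power_sum (Suc (Suc (i + j))) * psum_adj (Suc i) (psum_adj (Suc j) f) +
        power_sum (Suc i) * (power_sum (Suc j) * psum_adj (Suc (Suc (i + j))) f)"
  have "sum ?A ({..<m} \<times> {..<m}) = sum ?A ({..<n} \<times> {..<n})"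
  proof (rule sum.mono_neutral_right)
    show "\<forall>x\<in>{..<m} \<times> {..<m} - {..<n} \<times> {..<n}. ?A x = 0"
    proof
      fix x assume "x \<in> {..<m} \<times> {..<m} - {..<n} \<times> {..<n}"
      moreover obtain i j where x: "x = (i, j)" by (cases x)
      ultimately have "i \<ge> n \<or> j \<ge> n" by auto
      then show "?A x = 0" by (simp add: 0 x)
    qed
  qed (use assms in auto)
  moreover have "(\<Sum>i<m. sf_scale (of_nat i) (power_sum (Suc i) * psum_adj (Suc i) f)) =
      (\<Sum>i<n. sf_scale (of_nat i) (power_sum (Suc i) * psum_adj (Suc i) f))"
    by (rule sum.mono_neutral_right) (use assms in auto)
  ultimately show ?thesis unfolding laplace_upto_def by simp
qed

lemma laplace_eq:
  assumes "\<forall>k>n. psum_adj k f = 0"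
  shows "laplace f = laplace_upto n f"
proof -
  let ?m = "SOME n. \<forall>k>n. psum_adj k f = 0"
  have "\<forall>k>?m. psum_adj k f = 0" by (rule someI_ex) (rule psum_adj_bounded)
  from laplace_upto_le[OF this, of "max n ?m"] laplace_upto_le[OF assms, of "max n ?m"]
  show ?thesis by (simp add: laplace_def)
qed

lemma common_bound:
  obtains n where "\<forall>k>n. psum_adj k f = 0" "\<forall>k>n. psum_adj k g = 0" "\<forall>k>n. psum_adj k h = 0"
proof -
  obtain a b c where "\<forall>k>a. psum_adj k f = 0" "\<forall>k>b. psum_adj k g = 0" "\<forall>k>c. psum_adj k h = 0"
    using psum_adj_bounded by metis
  then show ?thesis by (intro that[of "max a (max b c)"]) auto
qed

lemma laplace_upto_simps:
  "laplace_upto n (f + g) = laplace_upto n f + laplace_upto n g"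
  "laplace_upto n (sf_scale c f) = sf_scale c (laplace_upto n f)"
proof -
  show "laplace_upto n (f + g) = laplace_upto n f + laplace_upto n g"
    by (simp add: laplace_upto_def split_def algebra_simps sf.scale_right_distrib sum.distrib)
  show "laplace_upto n (sf_scale c f) = sf_scale c (laplace_upto n f)"
    by (simp add: laplace_upto_def split_def sf.scale_right_distrib sf.scale_sum_right mult_ac)
qed

lemma linear_laplace: "Vector_Spaces.linear sf_scale sf_scale laplace"
proof (rule linearI_sf[OF vector_space_sf_scale])
  fix f g :: "ratfun symfun" and c
  obtain n where n: "\<forall>k>n. psum_adj k f = 0" "\<forall>k>n. psum_adj k g = 0" by (rule common_bound)
  show "laplace (f + g) = laplace f + laplace g"
    using n by (simp add: laplace_eq[of n] laplace_upto_simps)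
  show "laplace (sf_scale c f) = sf_scale c (laplace f)"
    using n by (simp add: laplace_eq[of n] laplace_upto_simps)
qed

lemmas laplace_simps [simp] = linear_sf_simps[OF linear_laplace]

text \<open>The terms with two adjoints and those with two power sums are adjoint to each other; the
  remaining ones are self-adjoint.\<close>

lemma jack_inner_laplace: "jack_inner (laplace f) h = jack_inner f (laplace h)"
proof -
  obtain n where n: "\<forall>k>n. psum_adj k f = 0" "\<forall>k>n. psum_adj k h = 0" by (rule common_bound)
  have *: "jack_inner (power_sum k * psum_adj i (psum_adj j f)) h = jack_inner f (power_sum j * (power_sum i * psum_adj k h))"
    "jack_inner (power_sum i * (power_sum j * psum_adj k f)) h = jack_inner f (power_sum k * psum_adj j (psum_adj i h))"
    if "i > 0" "j > 0" "k > 0" for i j k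
    using that by (simp_all add: jack_inner_power_sum jack_inner_psum_adj)
  have "jack_inner (laplace_upto n f) h = jack_inner f (laplace_upto n h)"
    unfolding laplace_upto_def
    by (simp add: split_def * sum.distrib jack_inner_power_sum jack_inner_psum_adj psum_adj_commute
        mult.left_commute algebra_simps)
  then show ?thesis using n by (simp add: laplace_eq[of n])
qed

text \<open>The operator has order two: its deviation from being a derivation is a biderivation.\<close>

definition laplace_bracket :: "ratfun symfun \<Rightarrow> ratfun symfun \<Rightarrow> ratfun symfun" where
  "laplace_bracket f h = laplace (f * h) - f * laplace h - laplace f * h"

lemma laplace_mult: "laplace (f * h) = f * laplace h + laplace f * h + laplace_bracket f h"
  by (simp add: laplace_bracket_def)

text \<open>Only the terms with two adjoints violate the Leibniz rule. Each cross term arises from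
  \<open>(i, j)\<close> and from the swapped pair, which cancels the factor 1/2.\<close>

lemma laplace_bracket_eq:
  assumes "\<forall>k>n. psum_adj k f = 0" "\<forall>k>n. psum_adj k h = 0"
  shows "laplace_bracket f h = sf_scale (1 / \<alpha>)
    (\<Sum>(i, j)\<in>{..<n} \<times> {..<n}. power_sum (Suc (Suc (i + j))) * (psum_adj (Suc i) f * psum_adj (Suc j) h))"
proof -
  let ?I = "{..<n} \<times> {..<n}"
  let ?X = "\<lambda>(i, j). power_sum (Suc (Suc (i + j))) * (psum_adj (Suc i) f * psum_adj (Suc j) h)"
  let ?A = "\<lambda>f (i, j). power_sum (Suc (Suc (i + j))) * psum_adj (Suc i) (psum_adj (Suc j) f) +
        power_sum (Suc i) * (power_sum (Suc j) * psum_adj (Suc (Suc (i + j))) f)"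
  let ?B = "\<lambda>f i. sf_scale (of_nat i) (power_sum (Suc i) * psum_adj (Suc i) f)"
  have "sum (?A (f * h)) ?I = (\<Sum>x\<in>?I. f * ?A h x + ?A f x * h + ?X x + ?X (prod.swap x))"
    by (rule sum.cong) (auto simp: psum_adj_mult algebra_simps)
  also have "\<dots> = f * sum (?A h) ?I + sum (?A f) ?I * h + sum ?X ?I + (\<Sum>x\<in>?I. ?X (prod.swap x))"
    by (simp only: sum.distrib sum_distrib_left sum_distrib_right)
  also have "(\<Sum>x\<in>?I. ?X (prod.swap x)) = sum ?X ?I"
    by (rule sum.reindex_bij_witness[of _ prod.swap prod.swap]) auto
  finally have A: "sum (?A (f * h)) ?I = f * sum (?A h) ?I + sum (?A f) ?I * h + sf_scale 2 (sum ?X ?I)"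
    using sf.scale_left_distrib[of 1 1 "sum ?X ?I"] by (simp add: add.assoc)
  have B: "(\<Sum>i<n. ?B (f * h) i) = f * (\<Sum>i<n. ?B h i) + (\<Sum>i<n. ?B f i) * h"
    unfolding sum_distrib_left sum_distrib_right sum.distrib[symmetric]
    by (rule sum.cong) (auto simp: psum_adj_mult algebra_simps sf.scale_right_distrib)
  have "laplace_upto n (f * h) = f * laplace_upto n h + laplace_upto n f * h + sf_scale (1 / \<alpha>) (sum ?X ?I)"
    unfolding laplace_upto_def A B by (simp add: algebra_simps sf.scale_right_distrib)
  moreover have "\<forall>k>n. psum_adj k (f * h) = 0" using assms by (simp add: psum_adj_mult)
  ultimately show ?thesis using assms by (simp add: laplace_bracket_def laplace_eq[of n] algebra_simps)
qed

lemma laplace_bracket_simps [simp]: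
  "laplace_bracket f (g + h) = laplace_bracket f g + laplace_bracket f h"
  "laplace_bracket f (sf_scale c h) = sf_scale c (laplace_bracket f h)"
  by (simp_all add: laplace_bracket_def algebra_simps sf.scale_right_diff_distrib)

lemma laplace_bracket_mult:
  "laplace_bracket f (g * h) = g * laplace_bracket f h + laplace_bracket f g * h"
proof -
  obtain n where n: "\<forall>k>n. psum_adj k f = 0" "\<forall>k>n. psum_adj k g = 0" "\<forall>k>n. psum_adj k h = 0"
    by (rule common_bound)
  moreover from n have "\<forall>k>n. psum_adj k (g * h) = 0" by (simp add: psum_adj_mult)
  ultimately show ?thesis
    by (simp add: laplace_bracket_eq[of n] psum_adj_mult sf.scale_right_distrib[symmetric]
        sum_distrib_left sum_distrib_right sum.distrib[symmetric] split_def algebra_simps)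
qed

lemma laplace_1 [simp]: "laplace 1 = 0"
  using laplace_eq[of 0 1] by (simp add: laplace_upto_def)

lemma laplace_bracket_1 [simp]: "laplace_bracket f 1 = 0"
  by (simp add: laplace_bracket_def)

section \<open>The operator on generating functions and their products\<close>

lemma of_nat_mult_symfun: "of_nat n * f = sf_scale (of_nat n) (f :: ratfun symfun)"
  by (induction n) (simp_all add: algebra_simps sf.scale_left_distrib)

text \<open>The quadratic equation says that \<open>?S\<close>, weighted by \<open>i\<close>, and
  \<open>?T\<close>, weighted by \<open>a - 1 - i\<close>, enter with the same coefficient. The
  weights then add up to the constant \<open>a - 1\<close>, and Newton's recursion collapses the
  sum.\<close>

lemma laplace_gen:
  assumes \<theta>: "\<theta> \<noteq> 0" "(\<alpha> * \<theta> - 1) * (\<theta> + 1) = 0"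
  shows "laplace (gen \<theta> a) = sf_scale (of_nat a * (of_nat a - 1) / (2 * \<theta>)) (gen \<theta> a)"
proof (cases a)
  case (Suc b)
  let ?g = "gen \<theta>" and ?p = "power_sum :: nat \<Rightarrow> ratfun symfun"
  let ?S = "\<Sum>i<a. sf_scale (of_nat i) (?p (Suc i) * ?g (a - Suc i))"
  let ?T = "\<Sum>i<a. sf_scale (of_nat (a - Suc i)) (?p (Suc i) * ?g (a - Suc i))"
  \<comment> \<open>There are \<open>k + 1\<close> pairs with \<open>i + j = k\<close>; after the
    index shift this becomes the weight \<open>i\<close>.\<close>
  have S: "(\<Sum>i<b. \<Sum>j\<le>i. F (Suc i)) = (\<Sum>i<a. sf_scale (of_nat i) (F i))" for F :: "nat \<Rightarrow> ratfun symfun"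
    unfolding Suc sum.lessThan_Suc_shift by (simp add: of_nat_mult_symfun del: of_nat_Suc)
  have "(\<Sum>(i, j)\<in>{..<a} \<times> {..<a}. ?p (Suc (Suc (i + j))) * psum_adj (Suc i) (psum_adj (Suc j) (?g a))) =
     (\<Sum>(i, j)\<in>{(i, j). i + j < b}. sf_scale (\<alpha> * \<theta> * (\<alpha> * \<theta>)) (?p (Suc (Suc (i + j))) * ?g (a - Suc (Suc (i + j)))))"
    by (rule sum.mono_neutral_cong_right) (auto simp: Suc psum_adj_gen add.commute split: if_splits)
  also have "\<dots> = (\<Sum>k<b. \<Sum>i\<le>k. sf_scale (\<alpha> * \<theta> * (\<alpha> * \<theta>)) (?p (Suc (Suc k)) * ?g (a - Suc (Suc k))))"
    unfolding sum.triangle_reindex by (intro sum.cong) auto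
  also have "\<dots> = sf_scale (\<alpha> * \<theta> * (\<alpha> * \<theta>)) ?S"
    unfolding sf.scale_sum_right[symmetric] S[of "\<lambda>i. ?p (Suc i) * ?g (a - Suc i)"] by simp
  finally have 1: "(\<Sum>(i, j)\<in>{..<a} \<times> {..<a}. ?p (Suc (Suc (i + j))) * psum_adj (Suc i) (psum_adj (Suc j) (?g a))) =
     sf_scale (\<alpha> * \<theta> * (\<alpha> * \<theta>)) ?S" .
  have "(\<Sum>(i, j)\<in>{..<a} \<times> {..<a}. ?p (Suc i) * (?p (Suc j) * psum_adj (Suc (Suc (i + j))) (?g a))) =
      (\<Sum>i<a. \<Sum>j<a. ?p (Suc i) * (?p (Suc j) * psum_adj (Suc (Suc (i + j))) (?g a)))"
    by (simp add: sum.cartesian_product)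
  also have "\<dots> = (\<Sum>i<a. \<Sum>j<a - Suc i. sf_scale (\<alpha> * \<theta>) (?p (Suc i) * (?p (Suc j) * ?g (a - Suc i - Suc j))))"
    by (intro sum.cong[OF refl] sum.mono_neutral_cong_right) (auto simp: psum_adj_gen split: if_splits)
  also have "\<dots> = (\<Sum>i<a. sf_scale \<alpha> (?p (Suc i) * sf_scale \<theta> (\<Sum>j<a - Suc i. ?p (Suc j) * ?g (a - Suc i - Suc j))))"
    by (simp add: sf.scale_sum_right sum_distrib_left)
  also have "\<dots> = sf_scale \<alpha> ?T"
    unfolding gen_rec by (simp add: sf.scale_sum_right)
  finally have 2: "(\<Sum>(i, j)\<in>{..<a} \<times> {..<a}. ?p (Suc i) * (?p (Suc j) * psum_adj (Suc (Suc (i + j))) (?g a))) =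
     sf_scale \<alpha> ?T" .
  have 3: "(\<Sum>i<a. sf_scale (of_nat i) (?p (Suc i) * psum_adj (Suc i) (?g a))) = sf_scale (\<alpha> * \<theta>) ?S"
    by (simp add: psum_adj_gen sf.scale_sum_right mult_ac)
  have "?S + ?T = (\<Sum>i<a. sf_scale (of_nat b) (?p (Suc i) * ?g (a - Suc i)))"
    unfolding sum.distrib[symmetric] sf.scale_left_distrib[symmetric]
    by (intro sum.cong) (auto simp: Suc of_nat_add[symmetric] simp del: of_nat_add)
  also have "\<dots> = sf_scale (of_nat b) (\<Sum>i<a. ?p (Suc i) * ?g (a - Suc i))"
    by (simp add: sf.scale_sum_right)
  finally have "sf_scale \<theta> (?S + ?T) = sf_scale (of_nat b) (sf_scale \<theta> (\<Sum>i<a. ?p (Suc i) * ?g (a - Suc i)))"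
    by (simp add: mult.commute)
  then have 4: "sf_scale \<theta> (?S + ?T) = sf_scale (of_nat b) (sf_scale (of_nat a) (?g a))"
    by (simp only: gen_rec)
  have quad: "1 / (2 * \<alpha>) * (\<alpha> * \<theta> * (\<alpha> * \<theta>) + (\<alpha> - 1) * (\<alpha> * \<theta>)) = 1 / 2"
  proof -
    have "\<alpha> * \<theta> * \<theta> + (\<alpha> - 1) * \<theta> = 1" using \<theta>(2) by (simp add: algebra_simps)
    then have "\<alpha> * \<theta> * (\<alpha> * \<theta>) + (\<alpha> - 1) * (\<alpha> * \<theta>) = \<alpha>"
      by (metis (no_types, lifting) distrib_left mult.assoc mult.left_commute mult.right_neutral)
    then show ?thesis by simp
  qed
  have "laplace (?g a) = laplace_upto a (?g a)" by (rule laplace_eq) (simp add: psum_adj_gen)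
  also have "\<dots> = sf_scale (1 / (2 * \<alpha>)) (sf_scale (\<alpha> * \<theta> * (\<alpha> * \<theta>)) ?S + sf_scale \<alpha> ?T + sf_scale (\<alpha> - 1) (sf_scale (\<alpha> * \<theta>) ?S))"
    unfolding laplace_upto_def 1[symmetric] 2[symmetric] 3[symmetric] by (simp add: split_def sum.distrib)
  also have "\<dots> = sf_scale (1 / (2 * \<alpha>) * (\<alpha> * \<theta> * (\<alpha> * \<theta>) + (\<alpha> - 1) * (\<alpha> * \<theta>))) ?S + sf_scale (1 / 2) ?T"
    by (simp add: sf.scale_right_distrib sf.scale_left_distrib distrib_left)
  also have "\<dots> = sf_scale (1 / (2 * \<theta>)) (sf_scale \<theta> (?S + ?T))"
    unfolding quad using \<theta> by (simp add: sf.scale_right_distrib)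
  also have "\<dots> = sf_scale (of_nat a * (of_nat a - 1) / (2 * \<theta>)) (?g a)"
    unfolding 4 by (simp add: Suc mult.commute)
  finally show ?thesis .
qed simp

text \<open>The bracket of two generating functions divided by \<alpha> \<theta>, so that its
  relations have integer coefficients.\<close>

definition gen_bracket :: "ratfun \<Rightarrow> nat \<Rightarrow> nat \<Rightarrow> ratfun symfun" where
  "gen_bracket \<theta> a b = sf_scale \<theta> (\<Sum>i<a. \<Sum>j<b.
     power_sum (Suc (Suc (i + j))) * (gen \<theta> (a - Suc i) * gen \<theta> (b - Suc j)))"

lemma laplace_bracket_gen:
  "laplace_bracket (gen \<theta> a) (gen \<theta> b) = sf_scale (\<alpha> * \<theta>) (gen_bracket \<theta> a b)"
proof -
  let ?n = "max a b"
  let ?F = "\<lambda>(i, j). power_sum (Suc (Suc (i + j))) * (gen \<theta> (a - Suc i) * gen \<theta> (b - Suc j))"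
  have "(\<Sum>(i, j)\<in>{..<?n} \<times> {..<?n}. power_sum (Suc (Suc (i + j))) *
      (psum_adj (Suc i) (gen \<theta> a) * psum_adj (Suc j) (gen \<theta> b))) =
      (\<Sum>x\<in>{..<a} \<times> {..<b}. sf_scale (\<alpha> * \<theta> * (\<alpha> * \<theta>)) (?F x))"
    by (rule sum.mono_neutral_cong_right) (auto simp: psum_adj_gen split: if_splits)
  also have "\<dots> = sf_scale (\<alpha> * \<theta> * (\<alpha> * \<theta>)) (\<Sum>i<a. \<Sum>j<b. ?F (i, j))"
    by (simp add: sf.scale_sum_right[symmetric] sum.cartesian_product)
  finally show ?thesis
    by (subst laplace_bracket_eq[of ?n]) (simp_all add: psum_adj_gen gen_bracket_def)
qed

lemma gen_bracket_commute: "gen_bracket \<theta> a b = gen_bracket \<theta> b a"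
  unfolding gen_bracket_def by (subst sum.swap) (simp add: mult.commute add.commute)

text \<open>Both double sums share their interior; the border terms in which they differ are those
  supplied by Newton's recursion for \<open>Suc a\<close> and \<open>Suc b\<close>.\<close>

lemma gen_bracket_rec:
  "gen_bracket \<theta> a (Suc b) + sf_scale (of_nat (Suc b)) (gen \<theta> a * gen \<theta> (Suc b)) =
   gen_bracket \<theta> (Suc a) b + sf_scale (of_nat (Suc a)) (gen \<theta> (Suc a) * gen \<theta> b)"
proof -
  let ?g = "gen \<theta>" and ?p = "power_sum :: nat \<Rightarrow> ratfun symfun"
  let ?U = "\<lambda>a. \<Sum>i<a. ?p (Suc (Suc i)) * ?g (a - Suc i)"
  let ?X = "\<Sum>i<a. \<Sum>j<b. ?p (Suc (Suc (Suc (i + j)))) * (?g (a - Suc i) * ?g (b - Suc j))"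
  have 1: "(\<Sum>i<a. \<Sum>j<Suc b. ?p (Suc (Suc (i + j))) * (?g (a - Suc i) * ?g (Suc b - Suc j))) = ?U a * ?g b + ?X"
    unfolding sum.lessThan_Suc_shift by (simp add: sum.distrib sum_distrib_right mult.assoc)
  have 2: "(\<Sum>i<Suc a. \<Sum>j<b. ?p (Suc (Suc (i + j))) * (?g (Suc a - Suc i) * ?g (b - Suc j))) = ?U b * ?g a + ?X"
    unfolding sum.lessThan_Suc_shift by (simp add: sum.distrib sum_distrib_left sum_distrib_right mult_ac)
  have 3: "sf_scale (of_nat (Suc a)) (?g (Suc a)) = sf_scale \<theta> (?p 1 * ?g a + ?U a)" for a
    unfolding gen_rec[symmetric] sum.lessThan_Suc_shift by simp
  have "sf_scale (of_nat (Suc b)) (?g a * ?g (Suc b)) = ?g a * sf_scale (of_nat (Suc b)) (?g (Suc b))" 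
    "sf_scale (of_nat (Suc a)) (?g (Suc a) * ?g b) = sf_scale (of_nat (Suc a)) (?g (Suc a)) * ?g b"
    by simp_all
  then show ?thesis
    unfolding gen_bracket_def 1 2 3 by (simp add: algebra_simps sf.scale_right_distrib)
qed

text \<open>The recursion moves units from the smaller index to the larger one until a bracket with
  index 0 remains, which vanishes; every step adds a more unequal product.\<close>

lemma gen_bracket_in_span:
  assumes "b \<le> a"
  shows "gen_bracket \<theta> a b + sf_scale (of_nat b) (gen \<theta> a * gen \<theta> b) \<in>
    sf.span {gen \<theta> (a + s) * gen \<theta> (b - s) | s. 1 \<le> s \<and> s \<le> b}"
  using assms
proof (induction b arbitrary: a)
  case 0
  then show ?case by (simp add: gen_bracket_def sf.span_zero)
next
  case (Suc b)
  let ?S = "{gen \<theta> (a + s) * gen \<theta> (Suc b - s) | s. 1 \<le> s \<and> s \<le> Suc b}"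
  have "gen_bracket \<theta> (Suc a) b + sf_scale (of_nat b) (gen \<theta> (Suc a) * gen \<theta> b) \<in>
      sf.span {gen \<theta> (Suc a + s) * gen \<theta> (b - s) | s. 1 \<le> s \<and> s \<le> b}"
    using Suc.IH[of "Suc a"] Suc.prems by simp
  also have "\<dots> \<subseteq> sf.span ?S"
  proof (rule sf.span_mono, clarify)
    fix s assume "1 \<le> s" "s \<le> b"
    then show "\<exists>s'. gen \<theta> (Suc a + s) * gen \<theta> (b - s) = gen \<theta> (a + s') * gen \<theta> (Suc b - s') \<and> 1 \<le> s' \<and> s' \<le> Suc b"
      by (intro exI[of _ "Suc s"]) simp
  qed
  finally have 1: "gen_bracket \<theta> (Suc a) b + sf_scale (of_nat b) (gen \<theta> (Suc a) * gen \<theta> b) \<in> sf.span ?S" .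
  have "gen \<theta> (Suc a) * gen \<theta> b \<in> ?S" by (rule CollectI) (rule exI[of _ 1], simp)
  then have 2: "sf_scale (of_nat (Suc a) - of_nat b) (gen \<theta> (Suc a) * gen \<theta> b) \<in> sf.span ?S"
    by (intro sf.span_scale sf.span_base)
  show ?case
    using sf.span_add[OF 1 2] unfolding gen_bracket_rec
    by (simp add: sf.scale_left_distrib sf.scale_left_diff_distrib algebra_simps)
qed

lemma strictly_majorized_pair:
  assumes "b \<le> a" "1 \<le> s" "s \<le> b"
  shows "strictly_majorized {#a, b#} {#a + s, b - s#}"
  unfolding strictly_majorized_def majorized_def
\<comment> \<open>At the threshold \<open>a\<close> the first hinge is 0 and the second is
  \<open>s\<close>.\<close>
proof (intro conjI allI exI[of _ a])
  show "hinge t {#a, b#} \<le> hinge t {#a + s, b - s#}" for t using assms by simp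
qed (use assms in auto)

lemma span_mult_mono:
  assumes "f \<in> sf.span S" "\<And>x. x \<in> S \<Longrightarrow> h * x \<in> sf.span T"
  shows "h * f \<in> sf.span T"
  using assms(1)
proof (induction rule: sf.span_induct_alt)
  case (step c x y)
  then show ?case using assms(2)
    by (simp add: distrib_left sf.span_add sf.span_scale)
qed (simp add: sf.span_zero)

text \<open>The derivation rule treats one factor at a time. The error terms serve twice: being
  strictly larger they give triangularity of the operator, and having an index above
  \<open>N\<close> they vanish modulo the ideal for \<open>N\<close>.\<close>

lemma laplace_bracket_gen_prod:
  "laplace_bracket (gen \<theta> N) (gen_prod \<theta> A) +
     sf_scale (\<alpha> * \<theta> * of_nat (\<Sum>b\<in>#A. min N b)) (gen_prod \<theta> (add_mset N A)) \<in>
   sf.span {gen_prod \<theta> C | C. strictly_majorized (add_mset N A) C \<and> (\<exists>x\<in>#C. N < x)}"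
proof (induction A)
  case empty
  then show ?case by (simp add: sf.span_zero)
next
  case (add b A)
  let ?T = "\<lambda>A. {gen_prod \<theta> C | C. strictly_majorized (add_mset N A) C \<and> (\<exists>x\<in>#C. N < x)}"
  let ?g = "gen \<theta>"
  have 1: "?g b * (laplace_bracket (?g N) (gen_prod \<theta> A) +
     sf_scale (\<alpha> * \<theta> * of_nat (\<Sum>b\<in>#A. min N b)) (gen_prod \<theta> (add_mset N A))) \<in> sf.span (?T (add_mset b A))"
  proof (rule span_mult_mono[OF add.IH])
    fix x assume "x \<in> ?T A"
    then obtain C where C: "x = gen_prod \<theta> C" "strictly_majorized (add_mset N A) C" "\<exists>x\<in>#C. N < x" by blast
    then have "strictly_majorized (add_mset N (add_mset b A)) (add_mset b C)"
      using strictly_majorized_add[of "add_mset N A" C "{#b#}"] by (simp add: add_mset_commute)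
    then have "gen_prod \<theta> (add_mset b C) \<in> ?T (add_mset b A)"
      using C(3) by (intro CollectI exI[of _ "add_mset b C"]) auto
    then show "?g b * x \<in> sf.span (?T (add_mset b A))" using C(1) by (simp add: sf.span_base)
  qed
  \<comment> \<open>The larger index has to come first; since \<open>N \<le> u\<close>, each error
    term has an index \<open>u + s\<close> above \<open>N\<close>.\<close>
  define u v where "u = max N b" and "v = min N b"
  have uv: "v \<le> u" "N \<le> u" "{#N, b#} = {#u, v#}" "gen_bracket \<theta> N b = gen_bracket \<theta> u v" "?g N * ?g b = ?g u * ?g v"
    by (auto simp: u_def v_def max_def min_def gen_bracket_commute)
  have "gen_prod \<theta> A * (gen_bracket \<theta> N b + sf_scale (of_nat v) (?g N * ?g b)) \<in> sf.span (?T (add_mset b A))"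
    unfolding uv
  proof (rule span_mult_mono[OF gen_bracket_in_span])
    fix x assume "x \<in> {?g (u + s) * ?g (v - s) | s. 1 \<le> s \<and> s \<le> v}"
    then obtain s where s: "x = ?g (u + s) * ?g (v - s)" "1 \<le> s" "s \<le> v" by blast
    have "strictly_majorized ({#u, v#} + A) ({#u + s, v - s#} + A)"
      using s uv by (intro strictly_majorized_add strictly_majorized_pair)
    moreover have "{#u, v#} + A = add_mset N (add_mset b A)" unfolding uv(3)[symmetric] by simp
    ultimately have "strictly_majorized (add_mset N (add_mset b A)) ({#u + s, v - s#} + A)" by metis
    then have "gen_prod \<theta> ({#u + s, v - s#} + A) \<in> ?T (add_mset b A)"
      using uv(2) s by (intro CollectI exI[of _ "{#u + s, v - s#} + A"]) auto
    then show "gen_prod \<theta> A * x \<in> sf.span (?T (add_mset b A))"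
      using s(1) by (intro sf.span_base) (simp add: mult_ac)
  qed (rule uv)
  then have 2: "sf_scale (\<alpha> * \<theta>) (gen_prod \<theta> A * (gen_bracket \<theta> N b + sf_scale (of_nat v) (?g N * ?g b))) \<in> sf.span (?T (add_mset b A))"
    by (rule sf.span_scale)
  show ?case using sf.span_add[OF 1 2]
    by (simp add: laplace_bracket_mult laplace_bracket_gen v_def algebra_simps sf.scale_right_distrib sf.scale_left_distrib)
qed

text \<open>The Laplace-Beltrami eigenvalue: for \<theta> = 1/\<alpha> the sum of \<alpha> j - i
  over the boxes, for \<theta> = -1 the same with rows and columns exchanged.\<close>

definition content_sum :: "ratfun \<Rightarrow> partition \<Rightarrow> ratfun" where
  "content_sum \<theta> l = (\<Sum>(i, j)\<in>diagram l. of_nat j / \<theta> - \<alpha> * \<theta> * of_nat i)"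

lemma diagram_drop_row:
  "diagram l = {0} \<times> {..<part l 0} \<union> (\<lambda>(i, j). (Suc i, j)) ` diagram (drop_row l)"
proof (rule set_eqI)
  fix x show "x \<in> diagram l \<longleftrightarrow> x \<in> {0} \<times> {..<part l 0} \<union> (\<lambda>(i, j). (Suc i, j)) ` diagram (drop_row l)"
    by (cases x; cases "fst x") (auto simp: diagram_def drop_row.rep_eq image_iff)
qed

text \<open>Placed in an arbitrary commutative monoid to serve both content sums and hook
  products.\<close>

lemma (in comm_monoid_set) split_first_row:
  "F h (diagram l) = F (\<lambda>j. h (0, j)) {..<part l 0} \<^bold>* F (\<lambda>(i, j). h (Suc i, j)) (diagram (drop_row l))"
proof -
  have "F h (diagram l) = F h ({0} \<times> {..<part l 0}) \<^bold>* F h ((\<lambda>(i, j). (Suc i, j)) ` diagram (drop_row l))"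
    unfolding diagram_drop_row[of l] by (rule union_disjoint) (auto simp: finite_diagram)
  also have "F h ({0} \<times> {..<part l 0}) = F (\<lambda>j. h (0, j)) {..<part l 0}"
    by (rule reindex_bij_witness[of _ "\<lambda>j. (0, j)" snd]) auto
  also have "F h ((\<lambda>(i, j). (Suc i, j)) ` diagram (drop_row l)) = F (\<lambda>(i, j). h (Suc i, j)) (diagram (drop_row l))"
    by (subst reindex) (auto simp: inj_on_def split_def)
  finally show ?thesis .
qed

lemma content_sum_drop_row:
  "content_sum \<theta> l = of_nat (part l 0) * (of_nat (part l 0) - 1) / (2 * \<theta>) +
     content_sum \<theta> (drop_row l) - \<alpha> * \<theta> * of_nat (weight (drop_row l))"
proof -
  have gauss: "(\<Sum>j<n. of_nat j) = of_nat n * (of_nat n - 1) / (2 :: ratfun)" for n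
    by (induction n) (simp_all add: field_simps)
  have "(\<Sum>j<n. of_nat j / \<theta>) = of_nat n * (of_nat n - 1) / (2 * \<theta>)" for n
    by (simp only: sum_divide_distrib[symmetric] gauss divide_divide_eq_left)
  moreover have "(\<Sum>(i, j)\<in>diagram (drop_row l). of_nat j / \<theta> - \<alpha> * \<theta> * of_nat (Suc i)) =
      content_sum \<theta> (drop_row l) - \<alpha> * \<theta> * of_nat (weight (drop_row l))"
    by (simp add: content_sum_def weight_eq_card split_def algebra_simps sum.distrib sum_subtractf)
  ultimately show ?thesis
    unfolding content_sum_def sum.split_first_row[of _ l] by (simp add: content_sum_def)
qed

lemma gen_prod_drop_row:
  "gen_prod \<theta> (parts_mset l) = gen \<theta> (part l 0) * gen_prod \<theta> (parts_mset (drop_row l))"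
  by (cases "part l 0 = 0") (simp add: drop_row_trivial, subst parts_mset_drop_row, simp)

lemma gen_prod_as_partition:
  obtains m where "gen_prod \<theta> C = gen_prod \<theta> (parts_mset m)" "\<And>t. hinge t (parts_mset m) = hinge t C"
proof -
  obtain m where m: "parts_mset m = filter_mset (\<lambda>x. x \<noteq> 0) C"
    by (rule ex_parts_mset[of "filter_mset (\<lambda>x. x \<noteq> 0) C"]) auto
  have "gen_prod \<theta> (filter_mset (\<lambda>x. x \<noteq> 0) C) = gen_prod \<theta> C" by (induction C) auto
  moreover have "hinge t (filter_mset (\<lambda>x. x \<noteq> 0) C) = hinge t C" for t by (induction C) auto
  ultimately show ?thesis using that m by metis
qed

lemma strictly_majorized_span:
  "sf.span {gen_prod \<theta> C | C. strictly_majorized (parts_mset l) C} =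
   sf.span {gen_prod \<theta> (parts_mset m) | m. l \<unlhd> m \<and> m \<noteq> l}"
proof (rule arg_cong[of _ _ sf.span], intro set_eqI iffI)
  fix x assume "x \<in> {gen_prod \<theta> C | C. strictly_majorized (parts_mset l) C}"
  then obtain C where C: "x = gen_prod \<theta> C" "strictly_majorized (parts_mset l) C" by blast
  obtain m where m: "gen_prod \<theta> C = gen_prod \<theta> (parts_mset m)" "\<And>t. hinge t (parts_mset m) = hinge t C"
    using gen_prod_as_partition by metis
  moreover have "sum_mset (parts_mset m) = sum_mset C" using m(2)[of 0] by simp
  ultimately have "strictly_majorized (parts_mset l) (parts_mset m)"
    using C(2) by (simp add: strictly_majorized_def majorized_def)
  then show "x \<in> {gen_prod \<theta> (parts_mset m) | m. l \<unlhd> m \<and> m \<noteq> l}"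
    using C m by (auto simp: strictly_majorized_parts)
qed (use strictly_majorized_parts in blast)

text \<open>Peel off the first row. It is the largest index, so every \<open>min ?N b\<close> is
  \<open>b\<close>, and the bracket contributes -\<alpha> \<theta> times the remaining weight: the
  correction term of \<open>content_sum_drop_row\<close>.\<close>

lemma laplace_gen_prod:
  assumes \<theta>: "\<theta> \<noteq> 0" "(\<alpha> * \<theta> - 1) * (\<theta> + 1) = 0"
  shows "laplace (gen_prod \<theta> (parts_mset l)) - sf_scale (content_sum \<theta> l) (gen_prod \<theta> (parts_mset l)) \<in>
    sf.span {gen_prod \<theta> (parts_mset m) | m. l \<unlhd> m \<and> m \<noteq> l}"
  unfolding strictly_majorized_span[symmetric]
proof (induction l rule: partition_induct)
  case (empty l)
  have "parts_mset l = {#}" using empty by (subst parts_mset_drop_row) simp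
  moreover have "diagram l = {}" using empty part_le_first[of l] by (auto simp: diagram_def)
  ultimately show ?case by (simp add: content_sum_def sf.span_zero)
next
  case (row l)
  let ?N = "part l 0" and ?m = "drop_row l"
  let ?f = "gen_prod \<theta> (parts_mset ?m)"
  let ?T = "\<lambda>l. {gen_prod \<theta> C | C. strictly_majorized (parts_mset l) C}"
  have l: "parts_mset l = add_mset ?N (parts_mset ?m)" using row by (subst parts_mset_drop_row) simp
  have "min ?N b = b" if "b \<in># parts_mset ?m" for b
    using parts_mset_le[of b l] that by (simp add: l)
  then have "(\<Sum>b\<in>#parts_mset ?m. min ?N b) = (\<Sum>b\<in>#parts_mset ?m. b)"
    by (intro arg_cong[of _ _ sum_mset] image_mset_cong)
  then have min: "(\<Sum>b\<in>#parts_mset ?m. min ?N b) = weight ?m" by (simp add: sum_parts_mset)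
  have 1: "gen \<theta> ?N * (laplace ?f - sf_scale (content_sum \<theta> ?m) ?f) \<in> sf.span (?T l)"
  proof (rule span_mult_mono[OF row(2)])
    fix x assume "x \<in> ?T ?m"
    then obtain C where C: "x = gen_prod \<theta> C" "strictly_majorized (parts_mset ?m) C" by blast
    then have "strictly_majorized (parts_mset l) (add_mset ?N C)"
      using strictly_majorized_add[of "parts_mset ?m" C "{#?N#}"] by (simp add: l)
    then have "gen_prod \<theta> (add_mset ?N C) \<in> ?T l" by blast
    then show "gen \<theta> ?N * x \<in> sf.span (?T l)" using C by (simp add: sf.span_base)
  qed
  have "laplace_bracket (gen \<theta> ?N) ?f + sf_scale (\<alpha> * \<theta> * of_nat (weight ?m)) (gen \<theta> ?N * ?f) \<in>
      sf.span {gen_prod \<theta> C | C. strictly_majorized (parts_mset l) C \<and> (\<exists>x\<in>#C. ?N < x)}"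
    using laplace_bracket_gen_prod[of \<theta> ?N "parts_mset ?m"] by (simp add: l min)
  then have 2: "laplace_bracket (gen \<theta> ?N) ?f + sf_scale (\<alpha> * \<theta> * of_nat (weight ?m)) (gen \<theta> ?N * ?f) \<in> sf.span (?T l)"
    by (rule sf.span_mono[THEN subsetD, rotated]) auto
  show ?case using sf.span_add[OF 1 2]
    unfolding gen_prod_drop_row[of \<theta> l] content_sum_drop_row[of \<theta> l] laplace_mult laplace_gen[OF \<theta>]
    by (simp add: algebra_simps sf.scale_left_distrib sf.scale_left_diff_distrib)
qed

section \<open>Triangularity of Jack functions\<close>

lemma jack_inner_span_eq_0:
  assumes "f \<in> sf.span S" "\<And>x. x \<in> S \<Longrightarrow> jack_inner h x = 0"
  shows "jack_inner h f = 0"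
  using assms(1)
proof (induction rule: sf.span_induct_alt)
  case (step c x y)
  then show ?case using assms(2)[of x] by simp
qed simp

text \<open>Guarantees that the coefficient normalized in \<open>is_jack_family\<close> belongs to a
  term of the sum.\<close>

lemma dominated_single_column: "dominated (single_column (weight l)) l"
proof -
  have supp: "{i. part (single_column n) i \<noteq> 0} = {..<n}" for n
    by (auto simp: single_column.rep_eq)
  have w: "weight (single_column n) = n" for n
    unfolding weight_def supp by (simp add: single_column.rep_eq)
  have "(\<Sum>i<k. part (single_column (weight l)) i) \<le> (\<Sum>i<k. part l i)" for k
  \<comment> \<open>If one of the first \<open>k\<close> parts vanishes, these rows already hold the
    whole weight.\<close>
  proof (cases "\<forall>i<k. part l i \<noteq> 0")
    case True
    then show ?thesis by (intro sum_mono) (auto simp: single_column.rep_eq Suc_le_eq)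
  next
    case False
    then obtain j where j: "j < k" "part l j = 0" by auto
    have "i < k" if "part l i \<noteq> 0" for i
      using antimonoD[OF antimono_part[of l], of j i] j that by (cases "j \<le> i") auto
    then have sub: "{i. part l i \<noteq> 0} \<subseteq> {..<k}" by auto
    have "(\<Sum>i<k. part (single_column (weight l)) i) \<le> (\<Sum>i<max k (weight l). part (single_column (weight l)) i)"
      by (rule sum_mono2) auto
    also have "\<dots> = weight (single_column (weight l))"
      unfolding weight_def by (rule sum.mono_neutral_right) (auto simp: single_column.rep_eq)
    also have "\<dots> = (\<Sum>i | part l i \<noteq> 0. part l i)" by (simp only: w) (simp add: weight_def)
    also have "\<dots> \<le> (\<Sum>i<k. part l i)" by (rule sum_mono2) (use sub in auto)
    finally show ?thesis .
  qed
  then show ?thesis by (simp add: dominated_def w)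
qed

locale jack_family =
  fixes J :: "partition \<Rightarrow> ratfun symfun"
  assumes is_jack_family: "is_jack_family J"
begin

definition norm2 :: "partition \<Rightarrow> ratfun" where
  "norm2 l = jack_inner (J l) (J l)"

definition lead :: "partition \<Rightarrow> ratfun" where
  "lead l = sf_coeff (J l) (part_monomial l)"

lemma J_orth: "l \<noteq> m \<Longrightarrow> jack_inner (J l) (J m) = 0"
  using is_jack_family by (simp add: is_jack_family_def)

lemma J_coeff: "sf_coeff (J l) (part_monomial m) \<noteq> 0 \<Longrightarrow> m \<unlhd> l"
  and J_coeff_column: "sf_coeff (J l) (part_monomial (single_column (weight l))) = fact (weight l)"
proof -
  obtain v where v: "J l = (\<Sum>m | dominated m l. sf_scale (v m) (monomial_sym m))"
    "v (single_column (weight l)) = fact (weight l)"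
    using is_jack_family unfolding is_jack_family_def by metis
  have c: "sf_coeff (J l) (part_monomial m) = (if dominated m l then v m else 0)" for m
  proof -
    have "sf_coeff (J l) (part_monomial m) = (\<Sum>k | dominated k l. if k = m then v k else 0)"
      unfolding v(1) sf_coeff_sum by (rule sum.cong) auto
    then show ?thesis by (simp add: finite_dominated)
  qed
  show "sf_coeff (J l) (part_monomial m) \<noteq> 0 \<Longrightarrow> m \<unlhd> l"
    by (auto simp: c split: if_splits intro: dominated_imp_part_le)
  show "sf_coeff (J l) (part_monomial (single_column (weight l))) = fact (weight l)"
    by (simp add: c dominated_single_column v(2))
qed

lemma J_nonzero: "J l \<noteq> 0"
  using J_coeff_column[of l] by auto

lemma norm2_nonzero [simp]: "norm2 l \<noteq> 0"
  by (simp add: norm2_def J_nonzero)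

lemma J_monomial: "J l - sf_scale (lead l) (monomial_sym l) \<in> sf.span {monomial_sym m | m. m \<unlhd> l \<and> m \<noteq> l}"
  unfolding lead_def by (rule monomial_triangular) (rule J_coeff)

text \<open>The leading coefficient cannot vanish: otherwise \<open>J l\<close> would lie in the span of the smaller
  Jack functions, to which it is orthogonal, and the scalar product is definite.\<close>

lemma lead_nonzero_and_monomial:
  "lead l \<noteq> 0 \<and> monomial_sym l \<in> sf.span {J m | m. m \<unlhd> l}"
proof (induction "card {m. m \<unlhd> l \<and> m \<noteq> l}" arbitrary: l rule: less_induct)
  case less
  have "monomial_sym m \<in> sf.span {J k | k. k \<unlhd> l \<and> k \<noteq> l}" if m: "m \<unlhd> l" "m \<noteq> l" for m
  proof -
    have "{k. k \<unlhd> m \<and> k \<noteq> m} \<subset> {k. k \<unlhd> l \<and> k \<noteq> l}"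
      using m part_le_trans part_le_antisym by blast
    then have "card {k. k \<unlhd> m \<and> k \<noteq> m} < card {k. k \<unlhd> l \<and> k \<noteq> l}"
      by (rule psubset_card_mono[OF finite_part_le(2)])
    then have "monomial_sym m \<in> sf.span {J k | k. k \<unlhd> m}" using less by blast
    also have "\<dots> \<subseteq> sf.span {J k | k. k \<unlhd> l \<and> k \<noteq> l}"
      by (rule sf.span_mono) (use m part_le_trans part_le_antisym in blast)
    finally show ?thesis .
  qed
  then have "sf.span {monomial_sym m | m. m \<unlhd> l \<and> m \<noteq> l} \<subseteq> sf.span {J k | k. k \<unlhd> l \<and> k \<noteq> l}"
    by (intro sf.span_minimal) auto
  then have rest: "J l - sf_scale (lead l) (monomial_sym l) \<in> sf.span {J k | k. k \<unlhd> l \<and> k \<noteq> l}"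
    using J_monomial by blast
  have "lead l \<noteq> 0"
  proof
    assume "lead l = 0"
    then have "J l \<in> sf.span {J k | k. k \<unlhd> l \<and> k \<noteq> l}" using rest by simp
    then have "jack_inner (J l) (J l) = 0"
      by (rule jack_inner_span_eq_0) (auto simp: J_orth)
    then show False using J_nonzero by simp
  qed
  moreover have "sf_scale (inverse (lead l)) (J l - (J l - sf_scale (lead l) (monomial_sym l))) \<in> sf.span {J m | m. m \<unlhd> l}"
    by (intro sf.span_scale sf.span_diff sf.span_base rest[THEN sf.span_mono[THEN subsetD, rotated]]) auto
  ultimately show ?case by simp
qed

lemmas lead_nonzero [simp] = lead_nonzero_and_monomial[THEN conjunct1]
lemmas monomial_in_span_J = lead_nonzero_and_monomial[THEN conjunct2]

lemma J_span: "f \<in> sf.span (range J)"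
proof -
  have m: "monomial_sym l \<in> sf.span (range J)" for l
    using monomial_in_span_J[of l] by (rule sf.span_mono[THEN subsetD, rotated]) auto
  obtain S where "f = (\<Sum>l\<in>S. sf_scale (sf_coeff f (part_monomial l)) (monomial_sym l))"
    by (rule monomial_expansion)
  moreover have "\<dots> \<in> sf.span (range J)" by (intro sf.span_sum sf.span_scale m)
  ultimately show ?thesis by simp
qed

lemma inj_J: "inj J"
  by (rule injI) (metis J_orth jack_inner_eq_0_iff J_nonzero)

lemma J_expansion:
  obtains S where "finite S" "f = (\<Sum>l\<in>S. sf_scale (jack_inner f (J l) / norm2 l) (J l))"
    "\<And>l. jack_inner f (J l) \<noteq> 0 \<Longrightarrow> l \<in> S"
proof -
  obtain T r where T: "finite T" "T \<subseteq> range J" "f = (\<Sum>a\<in>T. sf_scale (r a) a)"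
    using J_span[of f] unfolding sf.span_explicit by blast
  obtain S where S: "T = J ` S" using T(2) by (auto simp: subset_image_iff)
  have fin: "finite S" using T(1) inj_J unfolding S by (meson finite_imageD inj_on_subset subset_UNIV)
  have f: "f = (\<Sum>l\<in>S. sf_scale (r (J l)) (J l))"
    unfolding T(3) S by (subst sum.reindex) (use inj_J inj_on_subset in auto)
  have "jack_inner f (J l) = (if l \<in> S then r (J l) * norm2 l else 0)" for l
  proof -
    have "jack_inner f (J l) = (\<Sum>m\<in>S. if m = l then r (J l) * norm2 l else 0)"
      by (subst f, subst jack_inner_simps) (auto intro!: sum.cong simp: J_orth norm2_def)
    then show ?thesis using fin by simp
  qed
  note ip = this
  have "f = (\<Sum>l\<in>S. sf_scale (jack_inner f (J l) / norm2 l) (J l))"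
    by (subst f) (auto intro!: sum.cong simp: ip)
  then show ?thesis
  proof (rule that[OF fin])
    show "jack_inner f (J l) \<noteq> 0 \<Longrightarrow> l \<in> S" for l unfolding ip by (auto split: if_splits)
  qed
qed

lemma J_in_span:
  assumes "\<And>l. jack_inner f (J l) \<noteq> 0 \<Longrightarrow> P l"
  shows "f \<in> sf.span {J l | l. P l}"
proof -
  obtain S where S: "f = (\<Sum>l\<in>S. sf_scale (jack_inner f (J l) / norm2 l) (J l))" by (rule J_expansion)
  have "sf_scale (jack_inner f (J l) / norm2 l) (J l) \<in> sf.span {J l | l. P l}" for l
  proof (cases "jack_inner f (J l) = 0")
    case False
    then show ?thesis using assms by (intro sf.span_scale sf.span_base) auto
  qed (simp add: sf.span_zero)
  then show ?thesis by (subst S) (rule sf.span_sum)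
qed

lemma jack_inner_J_gen_prod:
  "jack_inner (J n) (gen_prod (1 / \<alpha>) (parts_mset l)) \<noteq> 0 \<Longrightarrow> l \<unlhd> n"
  unfolding jack_inner_gen_prod_parts by (rule J_coeff)

text \<open>By duality with monomials, Jack functions being triangular downwards in monomials makes
  the generating products triangular upwards in Jack functions; inverting this turns the diagonal
  entry into its reciprocal.\<close>

lemma J_gen_prod:
  "J l - sf_scale (norm2 l / lead l) (gen_prod (1 / \<alpha>) (parts_mset l)) \<in>
     sf.span {gen_prod (1 / \<alpha>) (parts_mset m) | m. l \<unlhd> m \<and> m \<noteq> l}"
proof -
  let ?c = "\<lambda>l. lead l / norm2 l" and ?g = "\<lambda>l. gen_prod (1 / \<alpha>) (parts_mset l)"
  have "J l - sf_scale (inverse (?c l)) (?g l) \<in> sf.span {?g m | m. l \<unlhd> m \<and> m \<noteq> l}"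
  proof (rule sf.triangular_inverse)
    fix l
    have "?g l - sf_scale (?c l) (J l) \<in> sf.span {J m | m. l \<unlhd> m \<and> m \<noteq> l}"
    proof (rule J_in_span)
      fix m assume m: "jack_inner (?g l - sf_scale (?c l) (J l)) (J m) \<noteq> 0"
      have "jack_inner (?g l) (J l) = lead l"
        by (simp only: jack_inner_commute[of "?g l"] jack_inner_gen_prod_parts lead_def)
      then have "jack_inner (?g l - sf_scale (?c l) (J l)) (J l) = 0"
        by (simp add: norm2_def[symmetric])
      then have "m \<noteq> l" using m by auto
      then have "jack_inner (J m) (?g l) \<noteq> 0"
        using m J_orth by (auto simp: jack_inner_commute[of _ "J m"])
      then show "l \<unlhd> m \<and> m \<noteq> l" using jack_inner_J_gen_prod \<open>m \<noteq> l\<close> by blast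
    qed
    then show "?c l \<noteq> 0 \<and> ?g l - sf_scale (?c l) (J l) \<in> sf.span {J m | m. l \<unlhd> m \<and> m \<noteq> l}" by simp
  qed (auto dest: part_le_trans part_le_antisym)
  then show ?thesis by (simp add: inverse_eq_divide)
qed

lemma J_in_span_gen_prod: "J l \<in> sf.span {gen_prod (1 / \<alpha>) (parts_mset m) | m. l \<unlhd> m}"
proof -
  have "J l - sf_scale (norm2 l / lead l) (gen_prod (1 / \<alpha>) (parts_mset l)) + sf_scale (norm2 l / lead l) (gen_prod (1 / \<alpha>) (parts_mset l))
    \<in> sf.span {gen_prod (1 / \<alpha>) (parts_mset m) | m. l \<unlhd> m}"
    by (intro sf.span_add sf.span_scale sf.span_base J_gen_prod[THEN sf.span_mono[THEN subsetD, rotated]]) auto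
  then show ?thesis by simp
qed

text \<open>Triangularity on generating products restricts \<open>laplace (J l)\<close> to
  partitions below \<open>l\<close>; by self-adjointness it is restricted to those above
  \<open>l\<close> as well.\<close>

lemma laplace_J: "laplace (J l) = sf_scale (content_sum (1 / \<alpha>) l) (J l)"
proof -
  let ?g = "\<lambda>l. gen_prod (1 / \<alpha>) (parts_mset l)"
  note tri = laplace_gen_prod[of "1 / \<alpha>", simplified]
  have lower: "m \<unlhd> l" if "jack_inner (laplace (J l)) (J m) \<noteq> 0" for l m
  proof (rule ccontr)
    assume nle: "\<not> m \<unlhd> l"
    have "jack_inner (laplace (J l)) (J m) = 0"
    proof (rule jack_inner_span_eq_0[OF J_in_span_gen_prod])
      fix x assume "x \<in> {?g k | k. m \<unlhd> k}"
      then obtain k where k: "x = ?g k" "m \<unlhd> k" by blast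
      have 0: "jack_inner (J l) (?g n) = 0" if "k \<unlhd> n" for n
        using jack_inner_J_gen_prod[of l n] nle k(2) that part_le_trans by blast
      have "jack_inner (J l) (laplace (?g k) - sf_scale (content_sum (1 / \<alpha>) k) (?g k)) = 0"
        by (rule jack_inner_span_eq_0[OF tri]) (auto simp: 0)
      then show "jack_inner (laplace (J l)) x = 0" by (simp add: k jack_inner_laplace 0)
    qed
    then show False using that by simp
  qed
  have "laplace (J l) \<in> sf.span {J m | m. m = l}"
  proof (rule J_in_span)
    fix m assume m: "jack_inner (laplace (J l)) (J m) \<noteq> 0"
    then have "jack_inner (laplace (J m)) (J l) \<noteq> 0"
      by (simp add: jack_inner_laplace jack_inner_commute[of "J m"])
    then show "m = l" using lower m part_le_antisym by blast
  qed
  then obtain c where c: "laplace (J l) = sf_scale c (J l)"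
    by (auto simp: sf.span_singleton)
  \<comment> \<open>Pairing with the generating product of \<open>l\<close> itself reads off the
    eigenvalue.\<close>
  have "jack_inner (J l) (laplace (?g l) - sf_scale (content_sum (1 / \<alpha>) l) (?g l)) = 0"
    by (rule jack_inner_span_eq_0[OF tri]) (use jack_inner_J_gen_prod part_le_antisym in blast)
  then have "c * jack_inner (J l) (?g l) = content_sum (1 / \<alpha>) l * jack_inner (J l) (?g l)"
    using jack_inner_laplace[of "J l" "?g l"] by (simp add: c)
  moreover have "jack_inner (J l) (?g l) \<noteq> 0"
    unfolding jack_inner_gen_prod_parts using lead_nonzero[of l] by (simp add: lead_def)
  ultimately show ?thesis by (simp add: c)
qed

end

section \<open>Adjoints of the signed elementary functions\<close>

fun gen_adj :: "nat \<Rightarrow> ratfun symfun \<Rightarrow> ratfun symfun" where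
  "gen_adj 0 f = f"
| "gen_adj (Suc n) f = sf_scale (- 1 / of_nat (Suc n)) (\<Sum>k\<le>n. gen_adj (n - k) (psum_adj (Suc k) f))"

declare gen_adj.simps(2) [simp del]

lemma gen_adj_rec: "sf_scale (of_nat n) (gen_adj n f) = - (\<Sum>k<n. gen_adj (n - Suc k) (psum_adj (Suc k) f))"
proof (cases n)
  case (Suc m)
  have "of_nat (Suc m) * (- 1 / of_nat (Suc m)) = (- 1 :: ratfun)" by (simp del: of_nat_Suc)
  then show ?thesis
    by (simp add: Suc gen_adj.simps(2) lessThan_Suc_atMost del: of_nat_Suc)
qed simp

lemma jack_inner_gen_adj: "jack_inner (gen (- 1) n * f) h = jack_inner f (gen_adj n h)"
proof (induction n arbitrary: h rule: less_induct)
  case (less n)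
  show ?case
  proof (cases n)
    case (Suc m)
    then show ?thesis
      by (simp add: gen.simps(2) gen_adj.simps(2) sum_distrib_right mult.assoc jack_inner_power_sum less)
  qed simp
qed

lemma gen_adj_simps [simp]:
  "gen_adj n (f + g) = gen_adj n f + gen_adj n g" "gen_adj n (sf_scale c f) = sf_scale c (gen_adj n f)"
proof -
  show "gen_adj n (f + g) = gen_adj n f + gen_adj n g"
  proof (induction n arbitrary: f g rule: less_induct)
    case (less n)
    then show ?case by (cases n) (simp_all add: gen_adj.simps(2) sum.distrib sf.scale_right_distrib)
  qed
  show "gen_adj n (sf_scale c f) = sf_scale c (gen_adj n f)"
  proof (induction n arbitrary: f rule: less_induct)
    case (less n)
    then show ?case by (cases n) (simp_all add: gen_adj.simps(2) sf.scale_sum_right mult.commute)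
  qed
qed

lemma gen_adj_0 [simp]: "gen_adj n 0 = 0"
  using gen_adj_simps(2)[of n 0 0] by simp

lemma gen_adj_1: "gen_adj n 1 = (if n = 0 then 1 else 0)"
  by (cases n) (simp_all add: gen_adj.simps(2))

text \<open>With series variables z for the adjoints and y for the generating functions, moving one
  series past the other costs exp(- sum of (y z)^k / k) = 1 - y z, hence just two terms.\<close>

lemma gen_adj_gen_mult:
  "gen_adj n (gen (1 / \<alpha>) a * h) = gen (1 / \<alpha>) a * gen_adj n h -
     (if a = 0 \<or> n = 0 then 0 else gen (1 / \<alpha>) (a - 1) * gen_adj (n - 1) h)"
proof (induction n arbitrary: a h rule: less_induct)
  case (less n)
  show ?case
  proof (cases n)
    case (Suc m)
    let ?g = "gen (1 / \<alpha>)" and ?d = "\<lambda>k. psum_adj (Suc k)"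
    \<comment> \<open>By induction, each term in which \<open>psum_adj\<close> hits the generating
      function is a difference of consecutive \<open>T\<close>, so their sum telescopes.\<close>
    define T where "T k = (if k < a \<and> k \<le> m then ?g (a - Suc k) * gen_adj (m - k) h else 0)" for k
    let ?h = "if a = 0 then 0 else ?g (a - 1)"
    have 1: "gen_adj (n - Suc k) (?d k (?g a * h)) = T k - T (Suc k) + ?g a * gen_adj (n - Suc k) (?d k h)
        - ?h * (if k < m then gen_adj (m - Suc k) (?d k h) else 0)" if "k < n" for k
    proof -
      have "?d k (?g a * h) = (if k < a then ?g (a - Suc k) * h else 0) + ?g a * ?d k h"
        by (simp add: psum_adj_mult psum_adj_gen)
      moreover have "gen_adj (n - Suc k) (?g (a - Suc k) * h) = T k - T (Suc k)" if "k < a"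
      proof -
        have "gen_adj (m - k) (?g (a - Suc k) * h) = ?g (a - Suc k) * gen_adj (m - k) h -
            (if a - Suc k = 0 \<or> m - k = 0 then 0 else ?g (a - Suc k - 1) * gen_adj (m - k - 1) h)"
          by (rule less) (simp add: Suc)
        then show ?thesis using that \<open>k < n\<close> by (auto simp: T_def Suc)
      qed
      moreover have "T k - T (Suc k) = 0" if "\<not> k < a" using that by (simp add: T_def)
      moreover have "gen_adj (n - Suc k) (?g a * ?d k h) = ?g a * gen_adj (n - Suc k) (?d k h)
        - ?h * (if k < m then gen_adj (m - Suc k) (?d k h) else 0)"
        using \<open>k < n\<close> by (subst less) (auto simp: Suc)
      ultimately show ?thesis by (cases "k < a") simp_all
    qed
    have "(\<Sum>k<n. gen_adj (n - Suc k) (?d k (?g a * h))) = (\<Sum>k<n. T k - T (Suc k)) +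
        ?g a * (\<Sum>k<n. gen_adj (n - Suc k) (?d k h)) - ?h * (\<Sum>k<n. if k < m then gen_adj (m - Suc k) (?d k h) else 0)"
      unfolding sum_distrib_left sum.distrib[symmetric] sum_subtractf[symmetric]
      by (rule sum.cong) (use 1 in auto)
    also have "(\<Sum>k<n. T k - T (Suc k)) = T 0 - T n" by (simp add: sum_lessThan_telescope')
    also have "T 0 - T n = ?h * gen_adj m h" by (simp add: T_def Suc)
    also have "(\<Sum>k<n. if k < m then gen_adj (m - Suc k) (?d k h) else 0) = (\<Sum>k<m. gen_adj (m - Suc k) (?d k h))"
      by (rule sum.mono_neutral_cong_right) (auto simp: Suc)
    also have "\<dots> = - sf_scale (of_nat m) (gen_adj m h)" by (simp add: gen_adj_rec)
    also have "(\<Sum>k<n. gen_adj (n - Suc k) (?d k h)) = - sf_scale (of_nat n) (gen_adj n h)" by (simp add: gen_adj_rec)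
    finally have "(\<Sum>k<n. gen_adj (n - Suc k) (?d k (?g a * h))) =
        - sf_scale (of_nat n) (?g a * gen_adj n h - ?h * gen_adj m h)"
      by (simp add: Suc algebra_simps sf.scale_right_diff_distrib sf.scale_left_distrib)
    then have "sf_scale (of_nat n) (gen_adj n (?g a * h)) = sf_scale (of_nat n) (?g a * gen_adj n h - ?h * gen_adj m h)"
      unfolding gen_adj_rec by simp
    then have "gen_adj n (?g a * h) = ?g a * gen_adj n h - ?h * gen_adj m h"
      by (rule sf_scale_of_nat_cancel[rotated]) (simp add: Suc)
    then show ?thesis by (simp add: Suc)
  qed simp
qed

text \<open>By the two-term rule each index stays or drops by one, with \<open>n\<close> drops in
  total; an entry losing at most one unit gives the shifted hinge bound.\<close>

lemma gen_adj_gen_prod_in_span: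
  "gen_adj n (gen_prod (1 / \<alpha>) A) \<in> sf.span {gen_prod (1 / \<alpha>) B | B.
     sum_mset A = n + sum_mset B \<and> (\<forall>t. hinge (Suc t) A \<le> hinge t B)}"
proof (induction A arbitrary: n)
  case empty
  then show ?case by (auto simp: gen_adj_1 sf.span_zero intro!: sf.span_base exI[of _ "{#}"])
next
  case (add a A)
  let ?P = "\<lambda>n A B. sum_mset A = n + sum_mset B \<and> (\<forall>t. hinge (Suc t) A \<le> hinge t B)"
  let ?T = "\<lambda>n A. {gen_prod (1 / \<alpha>) B | B. ?P n A B}"
  have step: "gen (1 / \<alpha>) b * gen_adj k (gen_prod (1 / \<alpha>) A) \<in> sf.span (?T n (add_mset a A))"
    if k: "n + b = k + a" "a \<le> Suc b" for k b
  proof (rule span_mult_mono[OF add.IH])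
    fix x assume "x \<in> ?T k A"
    then obtain B where B: "x = gen_prod (1 / \<alpha>) B" "?P k A B" by blast
    have "hinge (Suc t) (add_mset a A) \<le> hinge t (add_mset b B)" for t
      using B(2) k(2) by (simp add: add_mono)
    moreover have "sum_mset (add_mset a A) = n + sum_mset (add_mset b B)" using B(2) k(1) by simp
    ultimately have "gen_prod (1 / \<alpha>) (add_mset b B) \<in> ?T n (add_mset a A)" by blast
    then show "gen (1 / \<alpha>) b * x \<in> sf.span (?T n (add_mset a A))" using B(1) by (simp add: sf.span_base)
  qed
  have 1: "gen (1 / \<alpha>) a * gen_adj n (gen_prod (1 / \<alpha>) A) \<in> sf.span (?T n (add_mset a A))"
    by (rule step) auto
  have 2: "(if a = 0 \<or> n = 0 then 0 else gen (1 / \<alpha>) (a - 1) * gen_adj (n - 1) (gen_prod (1 / \<alpha>) A)) \<in> sf.span (?T n (add_mset a A))"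
    using step[where k = "n - 1" and b = "a - 1"] by (auto simp: sf.span_zero)
  show ?case using sf.span_diff[OF 1 2] by (simp only: gen_prod_simps gen_adj_gen_mult)
qed

lemma gen_adj_gen_prod_size:
  assumes "0 \<notin># A"
  shows "size A < n \<Longrightarrow> gen_adj n (gen_prod (1 / \<alpha>) A) = 0"
    "gen_adj (size A) (gen_prod (1 / \<alpha>) A) = sf_scale ((- 1) ^ size A) (gen_prod (1 / \<alpha>) (image_mset (\<lambda>x. x - 1) A))"
proof -
  show 0: "gen_adj n (gen_prod (1 / \<alpha>) A) = 0" if "size A < n" for n A
    using that by (induction A arbitrary: n) (auto simp: gen_adj_1 gen_adj_gen_mult)
  show "gen_adj (size A) (gen_prod (1 / \<alpha>) A) = sf_scale ((- 1) ^ size A) (gen_prod (1 / \<alpha>) (image_mset (\<lambda>x. x - 1) A))"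
    using assms by (induction A) (auto simp: gen_adj_gen_mult 0)
qed

lemma gen_prod_drop_column:
  "gen_prod \<theta> (parts_mset (drop_column l)) = gen_prod \<theta> (image_mset (\<lambda>x. x - 1) (parts_mset l))"
proof -
  let ?A = "image_mset (\<lambda>x. x - 1) (parts_mset l)"
  have "hinge t (filter_mset (\<lambda>x. x \<noteq> 0) (image_mset (\<lambda>x. x - 1) A)) = hinge (Suc t) A" for t A
    by (induction A) auto
  then have "filter_mset (\<lambda>x. x \<noteq> 0) ?A = parts_mset (drop_column l)"
    by (intro hinge_inject) (auto simp: hinge_drop_column)
  moreover have "gen_prod \<theta> (filter_mset (\<lambda>x. x \<noteq> 0) A) = gen_prod \<theta> A" for A by (induction A) auto
  ultimately show ?thesis by metis
qed

lemma parts_mset_weight_0: "weight l = 0 \<Longrightarrow> parts_mset l = {#}"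
  using sum_parts_mset[of l] zero_notin_parts[of l] by (metis multiset_nonemptyE sum_mset_0_iff)

text \<open>The combinatorial content is the Gale-Ryser condition: a \<open>0\<close>-\<open>1\<close> matrix with row sums \<open>l\<close>
  and column sums \<open>C\<close> exists only if \<open>C\<close> is majorized by the transpose of \<open>l\<close>.\<close>

lemma jack_inner_gen_prod_dual:
  "jack_inner (gen_prod (- 1) (parts_mset l)) (gen_prod (1 / \<alpha>) C) \<noteq> 0 \<Longrightarrow> majorized C (parts_mset (transpose l))"
proof (induction l arbitrary: C rule: partition_induct)
  case (empty l)
  then have l: "parts_mset l = {#}" by (simp add: parts_mset_drop_row)
  then have "weight l = 0" using sum_parts_mset[of l] by simp
  then have "parts_mset (transpose l) = {#}" by (simp add: parts_mset_weight_0)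
  moreover have "\<forall>x\<in>#C. x = 0"
    using empty(2) unfolding l by (induction C) (auto simp: jack_inner_1_gen split: if_splits)
  then have "hinge t C = 0" for t by (auto simp: hinge_eq_0_iff)
  moreover from this[of 0] have "sum_mset C = 0" by simp
  ultimately show ?case by (simp add: majorized_def)
next
  case (row l)
  let ?n = "part l 0"
  have "jack_inner (gen_prod (- 1) (parts_mset (drop_row l))) (gen_adj ?n (gen_prod (1 / \<alpha>) C)) \<noteq> 0"
    using row(3) by (simp add: gen_prod_drop_row[of _ l] jack_inner_gen_adj)
  then obtain B where B: "sum_mset C = ?n + sum_mset B" "\<And>t. hinge (Suc t) C \<le> hinge t B"
    "jack_inner (gen_prod (- 1) (parts_mset (drop_row l))) (gen_prod (1 / \<alpha>) B) \<noteq> 0"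
    using jack_inner_span_eq_0[OF gen_adj_gen_prod_in_span[of ?n C]] by blast
  have maj: "majorized B (parts_mset (transpose (drop_row l)))" by (rule row) fact
  have sum: "sum_mset C = sum_mset (parts_mset (transpose l))"
    using B(1) maj weight_drop_row[of l] by (simp add: majorized_def sum_parts_mset)
  have "hinge t C \<le> hinge t (parts_mset (transpose l))" for t
  proof (cases t)
    case (Suc s)
    have "hinge s B \<le> hinge (Suc s) (parts_mset (transpose l))"
      using maj by (simp add: majorized_def transpose_drop_row hinge_drop_column)
    then show ?thesis using B(2)[of s] Suc by simp
  qed (use sum in simp)
  then show ?case using sum by (simp add: majorized_def)
qed

text \<open>The first row is as long as the transpose has parts, so every entry must drop by one:
  the extremal 0-1 matrix is unique.\<close>

lemma jack_inner_gen_prod_dual_diag: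
  "jack_inner (gen_prod (- 1) (parts_mset l)) (gen_prod (1 / \<alpha>) (parts_mset (transpose l))) = (- 1) ^ weight l"
proof (induction l rule: partition_induct)
  case (empty l)
  then have l: "parts_mset l = {#}" by (simp add: parts_mset_drop_row)
  then have w: "weight l = 0" using sum_parts_mset[of l] by simp
  then have "parts_mset (transpose l) = {#}" by (simp add: parts_mset_weight_0)
  then show ?case using w l jack_inner_psum[of "{#}" "{#}"] by (simp add: psum_norm_def z_mset_def)
next
  case (row l)
  let ?n = "part l 0" and ?t = "parts_mset (transpose l)"
  have n: "?n = size ?t" by (simp add: size_parts_mset num_parts_eq)
  have "jack_inner (gen_prod (- 1) (parts_mset l)) (gen_prod (1 / \<alpha>) ?t) =
      jack_inner (gen_prod (- 1) (parts_mset (drop_row l))) (gen_adj (size ?t) (gen_prod (1 / \<alpha>) ?t))"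
    by (simp add: gen_prod_drop_row[of _ l] jack_inner_gen_adj n)
  also have "\<dots> = (- 1) ^ ?n * (- 1) ^ weight (drop_row l)"
    using row(2) by (simp add: gen_adj_gen_prod_size gen_prod_drop_column transpose_drop_row n)
  also have "\<dots> = (- 1) ^ weight l" by (simp add: weight_drop_row[of l] power_add)
  finally show ?case .
qed

text \<open>Up to sign the product of the elementary functions e_k over the column lengths of
  \<open>l\<close>, indexed so that its leading monomial is that of \<open>l\<close>.\<close>

definition dual_prod :: "partition \<Rightarrow> ratfun symfun" where
  "dual_prod l = gen_prod (- 1) (parts_mset (transpose l))"

lemma dual_prod_coeff:
  "sf_coeff (dual_prod l) (part_monomial m) \<noteq> 0 \<Longrightarrow> m \<unlhd> l"
  "sf_coeff (dual_prod l) (part_monomial l) = (- 1) ^ weight l"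
  using jack_inner_gen_prod_dual[of "transpose l" "parts_mset m"] jack_inner_gen_prod_dual_diag[of "transpose l"]
  by (simp_all add: dual_prod_def part_le_def flip: jack_inner_gen_prod_parts)

lemma monomial_dual_prod:
  "monomial_sym l - sf_scale ((- 1) ^ weight l) (dual_prod l) \<in> sf.span {dual_prod m | m. m \<unlhd> l \<and> m \<noteq> l}"
proof -
  have "monomial_sym l - sf_scale (inverse ((- 1) ^ weight l)) (dual_prod l) \<in> sf.span {dual_prod m | m. m \<unlhd> l \<and> m \<noteq> l}"
  proof (rule sf.triangular_inverse[where i = l and y = monomial_sym and x = dual_prod
        and lt = "\<lambda>l m. m \<unlhd> l \<and> m \<noteq> l" and c = "\<lambda>l. (- 1) ^ weight l"])
    fix l :: partition
    show "(- 1) ^ weight l \<noteq> (0 :: ratfun) \<and> dual_prod l - sf_scale ((- 1) ^ weight l) (monomial_sym l) \<in> sf.span {monomial_sym m | m. m \<unlhd> l \<and> m \<noteq> l}"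
      using monomial_triangular[of "dual_prod l" "\<lambda>m. m \<unlhd> l" l] by (simp add: dual_prod_coeff)
  qed (auto dest: part_le_trans part_le_antisym)
  then show ?thesis by (simp flip: power_inverse)
qed

context jack_family
begin

lemma J_dual_prod:
  "J l - sf_scale ((- 1) ^ weight l * lead l) (dual_prod l) \<in> sf.span {dual_prod m | m. m \<unlhd> l \<and> m \<noteq> l}"
proof -
  have "monomial_sym m \<in> sf.span {dual_prod m | m. m \<unlhd> l \<and> m \<noteq> l}" if m: "m \<unlhd> l" "m \<noteq> l" for m
  proof -
    have "monomial_sym m - sf_scale ((- 1) ^ weight m) (dual_prod m) \<in> sf.span {dual_prod m | m. m \<unlhd> l \<and> m \<noteq> l}"
      using monomial_dual_prod[of m] by (rule sf.span_mono[THEN subsetD, rotated]) (use m part_le_trans part_le_antisym in blast)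
    then have "monomial_sym m - sf_scale ((- 1) ^ weight m) (dual_prod m) + sf_scale ((- 1) ^ weight m) (dual_prod m)
        \<in> sf.span {dual_prod m | m. m \<unlhd> l \<and> m \<noteq> l}"
      by (rule sf.span_add) (intro sf.span_scale sf.span_base, use m in auto)
    then show ?thesis by simp
  qed
  then have "sf.span {monomial_sym m | m. m \<unlhd> l \<and> m \<noteq> l} \<subseteq> sf.span {dual_prod m | m. m \<unlhd> l \<and> m \<noteq> l}"
    by (intro sf.span_minimal) auto
  then have "J l - sf_scale (lead l) (monomial_sym l) \<in> sf.span {dual_prod m | m. m \<unlhd> l \<and> m \<noteq> l}"
    using J_monomial by blast
  from sf.span_add[OF this sf.span_scale[OF monomial_dual_prod, of "lead l"]]
  show ?thesis by (simp add: sf.scale_right_diff_distrib mult.commute)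
qed

lemma jack_inner_J_dual_prod:
  assumes "jack_inner (J n) (dual_prod l) \<noteq> 0" shows "n \<unlhd> l"
proof -
  have sub: "sf.span {monomial_sym m | m. m \<unlhd> l} \<subseteq> sf.span {J k | k. k \<unlhd> l}"
  proof (rule sf.span_minimal, clarify)
    fix m assume "m \<unlhd> l"
    then show "monomial_sym m \<in> sf.span {J k | k. k \<unlhd> l}"
      using monomial_in_span_J[of m] part_le_trans by (elim sf.span_mono[THEN subsetD, rotated]) blast
  qed simp
  let ?c = "sf_scale (sf_coeff (dual_prod l) (part_monomial l)) (monomial_sym l)"
  have "dual_prod l - ?c + ?c \<in> sf.span {monomial_sym m | m. m \<unlhd> l}"
    by (intro sf.span_add sf.span_scale sf.span_base
        monomial_triangular[OF dual_prod_coeff(1), THEN sf.span_mono[THEN subsetD, rotated]]) auto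
  then have "dual_prod l \<in> sf.span {J k | k. k \<unlhd> l}" using sub by auto
  moreover have "jack_inner (J n) x = 0" if "x \<in> {J k | k. k \<unlhd> l}" "\<not> n \<unlhd> l" for x
    using that by (auto intro!: J_orth)
  ultimately show ?thesis using assms jack_inner_span_eq_0 by blast
qed

end

section \<open>Removing the first row or column\<close>

lemma ex_cons_row:
  assumes "part s 0 \<le> N"
  obtains m where "part m 0 = N" "drop_row m = s"
proof -
  define p where "p i = (case i of 0 \<Rightarrow> N | Suc i \<Rightarrow> part s i)" for i
  have "antimono p"
  proof (rule antimonoI)
    fix i j :: nat assume "i \<le> j"
    then show "p j \<le> p i"
      using assms part_le_first[of s] antimonoD[OF antimono_part[of s]]
      by (auto simp: p_def split: nat.splits intro: order_trans)
  qed
  moreover have "finite {i. p i \<noteq> 0}"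
  proof (rule finite_subset)
    show "{i. p i \<noteq> 0} \<subseteq> insert 0 (Suc ` {i. part s i \<noteq> 0})"
    proof
      fix i assume "i \<in> {i. p i \<noteq> 0}"
      then show "i \<in> insert 0 (Suc ` {i. part s i \<noteq> 0})" by (cases i) (auto simp: p_def)
    qed
  qed (simp add: finite_support_part del: neq0_conv)
  ultimately have "part (Abs_partition p) = p" by (simp add: Abs_partition_inverse)
  then show ?thesis
    by (intro that[of "Abs_partition p"] partition_eqI) (simp_all add: drop_row.rep_eq p_def)
qed

lemma content_sum_inverse_\<alpha>:
  "content_sum (1 / \<alpha>) l = of_nat (\<Sum>(i, j)\<in>diagram l. j) * \<alpha> - of_nat (\<Sum>(i, j)\<in>diagram l. i)"
  by (simp add: content_sum_def split_def sum_subtractf sum_distrib_right)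

lemma content_sum_minus_1: "content_sum (- 1) l = content_sum (1 / \<alpha>) (transpose l)"
  unfolding content_sum_def diagram_transpose
  by (subst sum.reindex) (auto simp: inj_on_def split_def algebra_simps)

lemma sum_diagram_columns: "(\<Sum>(i, j)\<in>diagram l. j) = (\<Sum>x\<in>#parts_mset l. \<Sum>{..<x})"
proof -
  have "diagram l = Sigma {i. part l i \<noteq> 0} (\<lambda>i. {..<part l i})" by (auto simp: diagram_def)
  then have "(\<Sum>(i, j)\<in>diagram l. j) = (\<Sum>i | part l i \<noteq> 0. \<Sum>{..<part l i})"
    using finite_support_part[of l] by (simp add: sum.Sigma[symmetric] del: neq0_conv)
  then show ?thesis
    by (simp add: parts_mset_def multiset.map_comp o_def sum_unfold_sum_mset)
qed

text \<open>As \<alpha> is independent of the rationals, the coefficients of \<alpha> agree; these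
  are the sums of x choose 2 over the parts, which grow strictly along dominance.\<close>

lemma part_le_content_sum_eq:
  assumes "l \<unlhd> m" "content_sum (1 / \<alpha>) l = content_sum (1 / \<alpha>) m"
  shows "l = m"
proof (rule part_le_sum_choose_eq[OF assms(1)])
  have "of_nat (\<Sum>(i, j)\<in>diagram l. j) * \<alpha> + of_nat (\<Sum>(i, j)\<in>diagram m. i) =
      of_nat (\<Sum>(i, j)\<in>diagram m. j) * \<alpha> + of_nat (\<Sum>(i, j)\<in>diagram l. i)"
    using assms(2) unfolding content_sum_inverse_\<alpha> by (simp only: diff_eq_eq add_diff_eq)
  then show "(\<Sum>x\<in>#parts_mset l. \<Sum>{..<x}) = (\<Sum>x\<in>#parts_mset m. \<Sum>{..<x})"
    unfolding sum_diagram_columns[symmetric] by (rule \<alpha>_independent)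
qed

text \<open>Rows and columns are treated alike: \<open>\<theta> = 1 / \<alpha>\<close> with \<open>\<sigma> = id\<close> yields the statements about
  rows, and \<open>\<theta> = -1\<close> with \<open>\<sigma> = transpose\<close> those about columns.\<close>

locale jack_strip = jack_family +
  fixes \<theta> :: ratfun and \<sigma> :: "partition \<Rightarrow> partition"
    and R :: "partition \<Rightarrow> partition \<Rightarrow> bool" and w :: "partition \<Rightarrow> ratfun"
  assumes \<theta>_nonzero: "\<theta> \<noteq> 0" and \<theta>_quadratic: "(\<alpha> * \<theta> - 1) * (\<theta> + 1) = 0"
    and \<sigma>_\<sigma> [simp]: "\<sigma> (\<sigma> l) = l"
    and R_refl: "R l l" and R_trans: "R k l \<Longrightarrow> R l m \<Longrightarrow> R k m" and R_antisym: "R l m \<Longrightarrow> R m l \<Longrightarrow> l = m"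
    and R_weight: "R l m \<Longrightarrow> weight l = weight m"
    and R_head: "R l m \<Longrightarrow> part l 0 \<le> part m 0"
    and R_drop_row: "part l 0 = part m 0 \<Longrightarrow> R (drop_row l) (drop_row m) \<longleftrightarrow> R l m"
    and R_content: "R l m \<Longrightarrow> content_sum \<theta> l = content_sum \<theta> m \<Longrightarrow> l = m"
    and J_triangular: "J (\<sigma> l) - sf_scale (w l) (gen_prod \<theta> (parts_mset l)) \<in>
      sf.span {gen_prod \<theta> (parts_mset m) | m. R l m \<and> m \<noteq> l}"
    and J_nonorth: "jack_inner (J (\<sigma> n)) (gen_prod \<theta> (parts_mset l)) \<noteq> 0 \<Longrightarrow> R l n"
    and laplace_J_\<sigma>: "laplace (J (\<sigma> l)) = sf_scale (content_sum \<theta> l) (J (\<sigma> l))"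
begin

section \<open>Reduction modulo products with a large index\<close>

abbreviation "K l \<equiv> J (\<sigma> l)"
abbreviation "G l \<equiv> gen_prod \<theta> (parts_mset l)"
abbreviation "ideal N \<equiv> sf.span {gen_prod \<theta> C | C. \<exists>x\<in>#C. N < x}"

text \<open>Divided by the norm of \<open>K l\<close> it is the coefficient of \<open>K l\<close> in
  this product; divided by the norm of \<open>K (drop_row l)\<close> it is the coefficient in the
  adjoint reduction of \<open>K l\<close>.\<close>

definition strip :: "partition \<Rightarrow> ratfun" where
  "strip l = jack_inner (K l) (gen \<theta> (part l 0) * K (drop_row l))"

lemma K_orth: "l \<noteq> m \<Longrightarrow> jack_inner (K l) (K m) = 0"
  by (metis J_orth \<sigma>_\<sigma>)

lemma K_in_span_G: "K l \<in> sf.span {G m | m. R l m}"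
proof -
  have "K l - sf_scale (w l) (G l) \<in> sf.span {G m | m. R l m}"
    using J_triangular by (rule sf.span_mono[THEN subsetD, rotated]) auto
  moreover have "sf_scale (w l) (G l) \<in> sf.span {G m | m. R l m}"
    by (intro sf.span_scale sf.span_base) (use R_refl in auto)
  ultimately have "K l - sf_scale (w l) (G l) + sf_scale (w l) (G l) \<in> sf.span {G m | m. R l m}" by (rule sf.span_add)
  then show ?thesis by simp
qed

lemma K_in_span:
  assumes "\<And>l. jack_inner f (K l) \<noteq> 0 \<Longrightarrow> P l"
  shows "f \<in> sf.span {K l | l. P l}"
proof -
  have "f \<in> sf.span {J l | l. P (\<sigma> l)}" by (rule J_in_span) (use assms[of "\<sigma> _"] in simp)
  moreover have "{J l | l. P (\<sigma> l)} \<subseteq> {K l | l. P l}" 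
  proof clarify
    fix l assume "P (\<sigma> l)"
    then show "\<exists>m. J l = K m \<and> P m" by (intro exI[of _ "\<sigma> l"]) simp
  qed
  ultimately show ?thesis using sf.span_mono by blast
qed

text \<open>The ideal is introduced as a linear span; it absorbs factors because the
  \<open>G m\<close> span the whole ring, which is inherited from the Jack functions.\<close>

lemma ideal_mult:
  assumes "f \<in> ideal N" shows "h * f \<in> ideal N"
proof -
  have "h * gen_prod \<theta> C \<in> ideal N" if C: "\<exists>x\<in>#C. N < x" for C
  proof -
    have "gen_prod \<theta> C * h \<in> ideal N" if "h \<in> sf.span {G m | m. True}" for h
    proof (rule span_mult_mono[OF that])
      fix x assume "x \<in> {G m | m. True}"
      then obtain m where "x = G m" by blast
      then have "gen_prod \<theta> C * x = gen_prod \<theta> (C + parts_mset m)" by simp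
      moreover have "\<exists>x\<in>#C + parts_mset m. N < x" using C by auto
      ultimately show "gen_prod \<theta> C * x \<in> ideal N" by (intro sf.span_base) blast
    qed
    moreover have "h \<in> sf.span {G m | m. True}"
    proof -
      have "K l \<in> sf.span {G m | m. True}" for l
        using K_in_span_G by (rule sf.span_mono[THEN subsetD, rotated]) auto
      then have "sf.span {K l | l. True} \<subseteq> sf.span {G m | m. True}" by (intro sf.span_minimal) auto
      then show ?thesis using K_in_span[of h "\<lambda>_. True"] by blast
    qed
    ultimately show ?thesis by (simp add: mult.commute)
  qed
  then show ?thesis by (intro span_mult_mono[OF assms]) auto
qed

lemma K_in_ideal: "N < part l 0 \<Longrightarrow> K l \<in> ideal N"
proof -
  assume l: "N < part l 0"
  have "\<exists>x\<in>#parts_mset m. N < x" if "R l m" for m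
    using R_head[OF that] l by (subst parts_mset_drop_row) auto
  then have "{G m | m. R l m} \<subseteq> {gen_prod \<theta> C | C. \<exists>x\<in>#C. N < x}" by auto
  from sf.span_mono[OF this] show ?thesis using K_in_span_G by blast
qed

text \<open>A product with an index above \<open>N\<close> is \<open>G m\<close> for some
  \<open>m\<close> with first part above \<open>N\<close>, and a nonzero pairing with
  \<open>K n\<close> would force \<open>R m n\<close>.\<close>

lemma jack_inner_ideal:
  assumes "part n 0 \<le> N" "f \<in> ideal N"
  shows "jack_inner (K n) f = 0"
  using assms(2)
proof (rule jack_inner_span_eq_0)
  fix x assume "x \<in> {gen_prod \<theta> C | C. \<exists>x\<in>#C. N < x}"
  then obtain C where C: "x = gen_prod \<theta> C" "\<exists>x\<in>#C. N < x" by blast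
  obtain m where m: "gen_prod \<theta> C = G m" "\<And>t. hinge t (parts_mset m) = hinge t C"
    using gen_prod_as_partition by metis
  have "hinge N (parts_mset m) \<noteq> 0" using C(2) unfolding m(2) hinge_eq_0_iff by (meson leD)
  then have "N < part m 0" using parts_mset_le[of _ m] unfolding hinge_eq_0_iff by force
  then show "jack_inner (K n) x = 0"
    using J_nonorth[of n m] R_head[of m n] assms(1) C(1) m(1) by force
qed

lemma gen_mult_G_nonorth:
  assumes "jack_inner (K n) (gen \<theta> N * G s) \<noteq> 0" "part n 0 \<le> N"
  shows "part n 0 = N" "R s (drop_row n)"
proof -
  have s: "part s 0 \<le> N"
  proof (rule ccontr)
    assume "\<not> part s 0 \<le> N"
    then have "gen_prod \<theta> (add_mset N (parts_mset s)) \<in> ideal N"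
      by (intro sf.span_base CollectI exI[of _ "add_mset N (parts_mset s)"] conjI refl)
        (subst parts_mset_drop_row, auto)
    then show False using jack_inner_ideal[OF assms(2)] assms(1) by simp
  qed
  obtain m where m: "part m 0 = N" "drop_row m = s" using ex_cons_row[OF s] .
  have "R m n" using assms(1) m by (intro J_nonorth) (simp add: gen_prod_drop_row[of \<theta> m])
  then show "part n 0 = N" using R_head[of m n] assms(2) m by simp
  then show "R s (drop_row n)" using \<open>R m n\<close> R_drop_row[of m n] m by simp
qed

text \<open>If all parts are at most \<open>N\<close>, the minima add up to the weight; otherwise
  the product with \<open>gen \<theta> N\<close> lies in the ideal anyway.\<close>

lemma laplace_bracket_ideal:
  "laplace_bracket (gen \<theta> N) (K t) + sf_scale (\<alpha> * \<theta> * of_nat (weight t)) (gen \<theta> N * K t) \<in> ideal N"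
proof -
  let ?L = "\<lambda>f. laplace_bracket (gen \<theta> N) f + sf_scale (\<alpha> * \<theta> * of_nat (weight t)) (gen \<theta> N * f)"
  have G: "?L (G s) \<in> ideal N" if s: "R t s" for s
  proof -
    let ?min = "\<Sum>b\<in>#parts_mset s. min N b"
    have 1: "laplace_bracket (gen \<theta> N) (G s) + sf_scale (\<alpha> * \<theta> * of_nat ?min) (gen_prod \<theta> (add_mset N (parts_mset s))) \<in> ideal N"
      using laplace_bracket_gen_prod[of \<theta> N "parts_mset s"]
      by (rule sf.span_mono[THEN subsetD, rotated]) auto
    have 2: "sf_scale (\<alpha> * \<theta> * of_nat (weight t) - \<alpha> * \<theta> * of_nat ?min) (gen \<theta> N * G s) \<in> ideal N"
    proof (cases "part s 0 \<le> N")
      case True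
      have "min N b = b" if "b \<in># parts_mset s" for b using parts_mset_le[OF that] True by simp
      then have "?min = weight s" by (simp add: sum_parts_mset[symmetric] cong: image_mset_cong)
      then show ?thesis using R_weight[OF s] by (simp add: sf.span_zero)
    next
      case False
      then have "gen_prod \<theta> (add_mset N (parts_mset s)) \<in> ideal N"
        by (intro sf.span_base CollectI exI[of _ "add_mset N (parts_mset s)"] conjI refl)
          (subst parts_mset_drop_row, auto)
      then show ?thesis by (intro sf.span_scale) simp
    qed
    show ?thesis using sf.span_add[OF 1 2] by (simp add: sf.scale_left_diff_distrib)
  qed
  have "?L f \<in> ideal N" if "f \<in> sf.span {G m | m. R t m}" for f
    using that
  proof (induction rule: sf.span_induct_alt)
    case base
    show ?case using laplace_bracket_simps(2)[of "gen \<theta> N" 0 0] by (simp add: sf.span_zero)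
  next
    case (step c x y)
    have "?L (sf_scale c x + y) = sf_scale c (?L x) + ?L y"
      by (simp add: sf.scale_right_distrib distrib_left mult.commute)
    moreover have "?L x \<in> ideal N" using step(1) G by blast
    ultimately show ?case using step(2) by (simp only:) (rule sf.span_add[OF sf.span_scale])
  qed
  then show ?thesis using K_in_span_G by blast
qed

text \<open>Triangularity leaves every \<open>n\<close> whose reduction lies above \<open>t\<close>.
  Modulo the ideal the product is an eigenvector, and comparing eigenvalues singles out the
  reduction \<open>t\<close> among comparable partitions.\<close>

lemma gen_mult_K_nonorth:
  assumes nz: "jack_inner (K n) (gen \<theta> N * K t) \<noteq> 0" and n: "part n 0 \<le> N"
  shows "part n 0 = N" "drop_row n = t"
proof -
  have "\<exists>s. R t s \<and> jack_inner (K n) (gen \<theta> N * G s) \<noteq> 0"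
  proof (rule ccontr)
    assume "\<not> ?thesis"
    moreover have "gen \<theta> N * K t \<in> sf.span {gen \<theta> N * G s | s. R t s}"
      by (rule span_mult_mono[OF K_in_span_G]) (auto intro: sf.span_base)
    ultimately show False using nz jack_inner_span_eq_0 by blast
  qed
  then obtain s where s: "R t s" "jack_inner (K n) (gen \<theta> N * G s) \<noteq> 0" by blast
  show N: "part n 0 = N" using gen_mult_G_nonorth[OF s(2) n] by simp
  have R: "R t (drop_row n)" using gen_mult_G_nonorth[OF s(2) n] s(1) R_trans by blast
  let ?X = "jack_inner (K n) (gen \<theta> N * K t)" and ?\<epsilon> = "of_nat N * (of_nat N - 1) / (2 * \<theta>)"
  have br: "jack_inner (K n) (laplace_bracket (gen \<theta> N) (K t)) = - (\<alpha> * \<theta> * of_nat (weight t)) * ?X"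
    using jack_inner_ideal[OF n laplace_bracket_ideal[of N t]] by (simp add: eq_neg_iff_add_eq_0)
  have "content_sum \<theta> n * ?X = jack_inner (K n) (laplace (gen \<theta> N * K t))"
    using jack_inner_laplace[of "K n" "gen \<theta> N * K t"] by (simp add: laplace_J_\<sigma>)
  also have "\<dots> = content_sum \<theta> t * ?X + ?\<epsilon> * ?X - \<alpha> * \<theta> * of_nat (weight t) * ?X"
    by (simp add: laplace_mult laplace_J_\<sigma> laplace_gen[OF \<theta>_nonzero \<theta>_quadratic] br)
  also have "\<dots> = (content_sum \<theta> t + ?\<epsilon> - \<alpha> * \<theta> * of_nat (weight t)) * ?X"
    by (simp add: distrib_right left_diff_distrib)
  finally have "content_sum \<theta> n = content_sum \<theta> t + ?\<epsilon> - \<alpha> * \<theta> * of_nat (weight t)" using nz by simp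
  then have "content_sum \<theta> t = content_sum \<theta> (drop_row n)"
    using content_sum_drop_row[of \<theta> n] N R_weight[OF R] by simp
  then show "drop_row n = t" using R_content[OF R] by simp
qed

lemma norm2_eq: "norm2 (\<sigma> l) = w l * jack_inner (K l) (G l)"
proof -
  have "jack_inner (K l) (K l - sf_scale (w l) (G l)) = 0"
    by (rule jack_inner_span_eq_0[OF J_triangular]) (use J_nonorth R_antisym in blast)
  then show ?thesis by (simp add: norm2_def)
qed

lemma w_nonzero [simp]: "w l \<noteq> 0" and K_G_nonzero: "jack_inner (K l) (G l) \<noteq> 0"
  using norm2_eq[of l] norm2_nonzero[of "\<sigma> l"] by auto

lemma strip_eq: "strip l = w (drop_row l) * jack_inner (K l) (G l)"
proof -
  let ?N = "part l 0" and ?m = "drop_row l"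
  have "gen \<theta> ?N * (K ?m - sf_scale (w ?m) (G ?m)) \<in> sf.span {gen \<theta> ?N * G s | s. R ?m s \<and> s \<noteq> ?m}"
    by (rule span_mult_mono[OF J_triangular]) (auto intro: sf.span_base)
  then have "jack_inner (K l) (gen \<theta> ?N * (K ?m - sf_scale (w ?m) (G ?m))) = 0"
    by (rule jack_inner_span_eq_0) (use gen_mult_G_nonorth(2)[of l ?N] R_antisym in blast)
  then show ?thesis by (simp add: strip_def gen_prod_drop_row[of \<theta> l] right_diff_distrib)
qed

lemma strip_nonzero [simp]: "strip l \<noteq> 0"
  by (simp add: strip_eq K_G_nonzero)

text \<open>A recursion along first rows for the leading coefficient; its factor is the quotient
  that specialization determines.\<close>

lemma w_eq: "w l = norm2 (\<sigma> l) / strip l * w (drop_row l)"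
  using K_G_nonzero[of l] by (simp add: norm2_eq strip_eq)

lemma gen_mult_K_drop_row:
  "gen \<theta> (part l 0) * K (drop_row l) - sf_scale (strip l / norm2 (\<sigma> l)) (K l) \<in> ideal (part l 0)" (is "?f \<in> _")
proof -
  have "?f \<in> sf.span {K n | n. part l 0 < part n 0}"
  proof (rule K_in_span, rule ccontr)
    fix n assume n: "jack_inner ?f (K n) \<noteq> 0" "\<not> part l 0 < part n 0"
    have "jack_inner ?f (K l) = 0"
      by (simp add: jack_inner_commute[of "gen \<theta> (part l 0) * K (drop_row l)"] strip_def[symmetric] norm2_def[symmetric])
    then have "n \<noteq> l" using n(1) by auto
    then have "jack_inner (K n) (gen \<theta> (part l 0) * K (drop_row l)) \<noteq> 0"
      using n(1) by (simp add: jack_inner_commute[of _ "K n"] K_orth)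
    then have "part n 0 = part l 0" "drop_row n = drop_row l"
      using gen_mult_K_nonorth n(2) by auto
    then have "R n l" "R l n" using R_drop_row[of n l] R_drop_row[of l n] R_refl by auto
    then show False using R_antisym \<open>n \<noteq> l\<close> by blast
  qed
  moreover have "sf.span {K n | n. part l 0 < part n 0} \<subseteq> ideal (part l 0)"
    by (rule sf.span_minimal) (auto intro: K_in_ideal)
  ultimately show ?thesis by blast
qed

lemma jack_inner_gen_mult:
  "jack_inner (K l) (gen \<theta> (part l 0) * f) = strip l / norm2 (\<sigma> (drop_row l)) * jack_inner (K (drop_row l)) f"
proof -
  let ?m = "drop_row l"
  let ?h = "f - sf_scale (jack_inner (K ?m) f / norm2 (\<sigma> ?m)) (K ?m)"
  have "?h \<in> sf.span {K t | t. t \<noteq> ?m}"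
    by (rule K_in_span) (auto simp: jack_inner_commute[of f] norm2_def[symmetric])
  then have "gen \<theta> (part l 0) * ?h \<in> sf.span {gen \<theta> (part l 0) * K t | t. t \<noteq> ?m}"
    by (rule span_mult_mono) (auto intro: sf.span_base)
  then have "jack_inner (K l) (gen \<theta> (part l 0) * ?h) = 0"
    by (rule jack_inner_span_eq_0) (use gen_mult_K_nonorth(2)[of l "part l 0"] in auto)
  then show ?thesis by (simp add: right_diff_distrib strip_def[symmetric])
qed

text \<open>The first scalar stems from replacing \<open>K m\<close> modulo the ideal, which
  \<open>K l\<close> annihilates as the first rows agree; the second from moving
  \<open>gen \<theta> (part l 0)\<close> off the pairing.\<close>

lemma jack_inner_drop_row:
  assumes "part l 0 = part m 0"
  shows "jack_inner (K l) (K m * f) =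
    (norm2 (\<sigma> m) / strip m) * (strip l / norm2 (\<sigma> (drop_row l))) * jack_inner (K (drop_row l)) (K (drop_row m) * f)"
proof -
  let ?c = "strip m / norm2 (\<sigma> m)"
  have "(gen \<theta> (part m 0) * K (drop_row m) - sf_scale ?c (K m)) * f \<in> ideal (part m 0)"
    using ideal_mult[OF gen_mult_K_drop_row[of m], of f] by (simp add: mult.commute)
  then have "jack_inner (K l) ((gen \<theta> (part m 0) * K (drop_row m) - sf_scale ?c (K m)) * f) = 0"
    by (rule jack_inner_ideal[rotated]) (simp add: assms)
  then have "jack_inner (K l) (gen \<theta> (part l 0) * (K (drop_row m) * f)) = ?c * jack_inner (K l) (K m * f)"
    by (simp add: left_diff_distrib mult.assoc assms)
  then have "strip l / norm2 (\<sigma> (drop_row l)) * jack_inner (K (drop_row l)) (K (drop_row m) * f) = ?c * jack_inner (K l) (K m * f)"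
    by (simp only: jack_inner_gen_mult)
  then show ?thesis by (simp add: field_simps)
qed

end

sublocale jack_family \<subseteq> row: jack_strip J "1 / \<alpha>" "\<lambda>l. l" "(\<unlhd>)" "\<lambda>l. norm2 l / lead l"
proof (unfold_locales, goal_cases)
  case 10
  then show ?case by (rule part_le_content_sum_eq)
next
  case (11 l)
  then show ?case by (rule J_gen_prod)
next
  case 12
  then show ?case by (rule jack_inner_J_gen_prod)
next
  case 13
  then show ?case by (rule laplace_J)
qed (auto intro: part_le_trans part_le_antisym part_le_weight part_le_part_0 simp: part_le_drop_row)

text \<open>Partitions of the locale are conjugates here, so its first row is the first column of
  the Jack index. The choice of \<open>R\<close> builds in that conjugation reverses
  dominance.\<close>

sublocale jack_family \<subseteq> column: jack_strip J "- 1" transpose "\<lambda>l m. transpose m \<unlhd> transpose l"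
  "\<lambda>l. (- 1) ^ weight l * lead (transpose l)"
proof (unfold_locales, goal_cases)
  case 6
  then show ?case using part_le_antisym by fastforce
next
  case 7
  then show ?case using part_le_weight by fastforce
next
  case 8
  then show ?case using part_le_transpose_0 by fastforce
next
  case 9
  then show ?case by (simp add: transpose_drop_row part_le_drop_column)
next
  case 10
  then show ?case using part_le_content_sum_eq by (fastforce simp: content_sum_minus_1)
next
  case (11 l)
  have eq: "{gen_prod (- 1) (parts_mset m) |m. transpose m \<unlhd> transpose l \<and> m \<noteq> l} =
      {dual_prod m |m. m \<unlhd> transpose l \<and> m \<noteq> transpose l}"
    unfolding dual_prod_def by (intro set_eqI iffI; clarify) (metis transpose_transpose)+
  show ?case using J_dual_prod[of "transpose l"] unfolding eq by (simp add: dual_prod_def)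
next
  case (12 n l)
  then show ?case using jack_inner_J_dual_prod[of "transpose n" "transpose l"] by (simp add: dual_prod_def)
next
  case (13 l)
  then show ?case by (simp add: laplace_J content_sum_minus_1)
qed (auto intro: part_le_trans)

section \<open>The Pieri rule for the first power sum\<close>

text \<open>\<open>psum_adj 1\<close> lowers a single index by one, so the large index of a product
  drops at most to a value above \<open>N\<close>.\<close>

lemma (in jack_strip) psum_adj_1_ideal:
  assumes "f \<in> ideal (Suc N)" shows "psum_adj 1 f \<in> ideal N"
  using assms
proof (induction rule: sf.span_induct_alt)
  case (step c x y)
  then obtain C a where C: "x = gen_prod \<theta> C" "a \<in># C" "Suc N < a" by blast
  then obtain B where B: "C = add_mset a B" by (metis insert_DiffM)
  have gen: "gen \<theta> b \<in> ideal N" if "N < b" for b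
    by (rule sf.span_base) (rule CollectI, rule exI[of _ "{#b#}"], use that in simp)
  have "psum_adj 1 x = sf_scale (\<alpha> * \<theta>) (gen_prod \<theta> B * gen \<theta> (a - 1)) + psum_adj 1 (gen_prod \<theta> B) * gen \<theta> a"
    using C(3) by (simp add: C(1) B psum_adj_mult psum_adj_gen mult.commute)
  also have "\<dots> \<in> ideal N"
    using C(3) by (intro sf.span_add sf.span_scale ideal_mult gen) auto
  finally show ?case using step by (simp add: sf.span_add sf.span_scale)
qed (simp add: sf.span_zero)

context jack_family
begin

lemma jack_inner_p1: "jack_inner (J l) (power_sum 1 * J m) = jack_inner (J m) (psum_adj 1 (J l))"
  by (simp add: jack_inner_commute[of "J l"] jack_inner_power_sum)

lemma p1_in_ideal: "power_sum 1 * f \<in> row.ideal 0"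
proof -
  have "gen (1 / \<alpha>) 1 \<in> row.ideal 0"
    by (rule sf.span_base) (rule CollectI, rule exI[of _ "{#1#}"], simp)
  then have "sf_scale \<alpha> (f * gen (1 / \<alpha>) 1) \<in> row.ideal 0" by (intro sf.span_scale row.ideal_mult)
  then show ?thesis by (simp add: gen_1 mult.commute del: One_nat_def)
qed

text \<open>Both bounds hold because a violation puts one side of the pairing into an ideal that the
  other annihilates, directly or after passing to the adjoint.\<close>

lemma pieri_p1_head:
  assumes nz: "jack_inner (J l) (power_sum 1 * J m) \<noteq> 0"
  shows "part m 0 \<le> part l 0" "part l 0 \<le> Suc (part m 0)"
    "part l 0 = Suc (part m 0) \<Longrightarrow> drop_row l = drop_row m"
proof -
  let ?N = "part m 0" and ?g = "gen (1 / \<alpha>)"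
  have nz': "jack_inner (J m) (psum_adj 1 (J l)) \<noteq> 0" using nz unfolding jack_inner_p1 .
  show "?N \<le> part l 0"
  proof (rule ccontr)
    assume "\<not> ?N \<le> part l 0"
    then have "power_sum 1 * J m \<in> row.ideal (part l 0)"
      by (intro row.ideal_mult row.K_in_ideal) simp
    then show False using nz row.jack_inner_ideal by blast
  qed
  show "part l 0 \<le> Suc ?N"
  proof (rule ccontr)
    assume "\<not> part l 0 \<le> Suc ?N"
    then have "psum_adj 1 (J l) \<in> row.ideal ?N"
      by (intro row.psum_adj_1_ideal row.K_in_ideal) simp
    then show False using nz' row.jack_inner_ideal by blast
  qed
  show "drop_row l = drop_row m" if l: "part l 0 = Suc ?N"
  proof -
    let ?c = "row.strip l / norm2 l" and ?k = "drop_row l"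
    \<comment> \<open>Modulo the ideal \<open>J l\<close> is a multiple of this product; after the
      adjoint only \<open>?g ?N * J ?k\<close> survives, which the row rule handles.\<close>
    have "psum_adj 1 (?g (part l 0) * J ?k - sf_scale ?c (J l)) \<in> row.ideal ?N"
      using row.gen_mult_K_drop_row[of l] unfolding l by (rule row.psum_adj_1_ideal)
    then have "jack_inner (J m) (psum_adj 1 (?g (part l 0) * J ?k)) = ?c * jack_inner (J m) (psum_adj 1 (J l))"
      using row.jack_inner_ideal[of m ?N] by fastforce
    moreover have "psum_adj 1 (?g (part l 0) * J ?k) = ?g ?N * J ?k + psum_adj 1 (J ?k) * ?g (Suc ?N)"
      by (simp add: psum_adj_mult psum_adj_gen l mult.commute)
    moreover have "psum_adj 1 (J ?k) * ?g (Suc ?N) \<in> row.ideal ?N"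
      by (rule row.ideal_mult, rule sf.span_base, rule CollectI, rule exI[of _ "{#Suc ?N#}"]) simp
    then have "jack_inner (J m) (psum_adj 1 (J ?k) * ?g (Suc ?N)) = 0"
      by (rule row.jack_inner_ideal[rotated]) simp
    ultimately have "jack_inner (J m) (?g ?N * J ?k) \<noteq> 0" using nz' by simp
    then show ?thesis using row.gen_mult_K_nonorth(2)[of m ?N ?k] by simp
  qed
qed

text \<open>Either the first row takes the new box and the other rows agree, or equal first rows are
  removed from both sides. Two empty first rows are impossible since p_1 lies in the ideal for
  0.\<close>

lemma pieri_p1:
  assumes "jack_inner (J l) (power_sum 1 * J m) \<noteq> 0"
  shows "\<exists>s. s \<notin> diagram m \<and> diagram l = insert s (diagram m)"
  using assms
proof (induction "weight m" arbitrary: l m rule: less_induct)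
  case less
  let ?N = "part m 0"
  consider "part l 0 = Suc ?N" | "part l 0 = ?N" "?N = 0" | "part l 0 = ?N" "?N > 0"
    using pieri_p1_head(1,2)[OF less.prems] by linarith
  then show ?case
  proof cases
    case 1
    then have drop: "drop_row l = drop_row m" by (rule pieri_p1_head(3)[OF less.prems])
    have "diagram l = insert (0, ?N) (diagram m)"
      unfolding diagram_drop_row[of l] diagram_drop_row[of m] drop 1 by auto
    moreover have "(0, ?N) \<notin> diagram m" by (simp add: diagram_def)
    ultimately show ?thesis by blast
  next
    case 2
    then have "jack_inner (J l) (power_sum 1 * J m) = 0"
      using row.jack_inner_ideal[OF _ p1_in_ideal] by simp
    then show ?thesis using less.prems by simp
  next
    case 3
    have "jack_inner (J (drop_row l)) (power_sum 1 * J (drop_row m)) \<noteq> 0"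
      using less.prems row.jack_inner_drop_row[OF 3(1), of "power_sum 1"] by (simp add: mult.commute)
    moreover have "weight (drop_row m) < weight m" using 3 weight_drop_row[of m] by simp
    ultimately obtain i j where s: "(i, j) \<notin> diagram (drop_row m)" "diagram (drop_row l) = insert (i, j) (diagram (drop_row m))"
      using less.hyps by (metis surj_pair)
    have "diagram l = insert (Suc i, j) (diagram m)"
      unfolding diagram_drop_row[of l] diagram_drop_row[of m] s(2) 3 by auto
    moreover have "(Suc i, j) \<notin> diagram m"
      using s(1) by (simp add: diagram_def drop_row.rep_eq)
    ultimately show ?thesis by blast
  qed
qed

section \<open>Principal specialization\<close>

lemma linear_expansion:
  assumes lin: "Vector_Spaces.linear sf_scale (*) \<phi>"
    and T: "finite T" "\<And>m. m \<notin> T \<Longrightarrow> \<phi> (J m) = 0"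
  shows "\<phi> f = (\<Sum>m\<in>T. jack_inner f (J m) / norm2 m * \<phi> (J m))"
proof -
  obtain S where S: "finite S" "f = (\<Sum>l\<in>S. sf_scale (jack_inner f (J l) / norm2 l) (J l))"
    "\<And>l. jack_inner f (J l) \<noteq> 0 \<Longrightarrow> l \<in> S" using J_expansion by blast
  have "\<phi> f = (\<Sum>m\<in>S. jack_inner f (J m) / norm2 m * \<phi> (J m))"
    by (subst S(2)) (simp add: linear_sf_simps[OF lin])
  also have "\<dots> = (\<Sum>m\<in>S \<union> T. jack_inner f (J m) / norm2 m * \<phi> (J m))"
    by (rule sum.mono_neutral_left) (use S T in auto)
  also have "\<dots> = (\<Sum>m\<in>T. jack_inner f (J m) / norm2 m * \<phi> (J m))"
    by (rule sum.mono_neutral_right) (use S T in auto)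
  finally show ?thesis .
qed

text \<open>Up to a power of \<alpha>, the power of p_1 is dual to the squarefree monomial, so the
  normalization of the Jack functions enters here.\<close>

lemma jack_inner_J_p1_power: "jack_inner (J m) (power_sum 1 ^ weight m) = \<alpha> ^ weight m * fact (weight m)"
proof -
  let ?n = "weight m"
  have supp: "{i. part (single_column n) i \<noteq> 0} = {..<n}" for n
    by (auto simp: single_column.rep_eq)
  have "parts_mset (single_column ?n) = image_mset (\<lambda>i. 1) (mset_set {..<?n})"
    unfolding parts_mset_def supp by (intro image_mset_cong) (auto simp: single_column.rep_eq)
  then have "parts_mset (single_column ?n) = replicate_mset ?n 1" by (simp add: image_mset_const_eq)
  moreover have "power_sum 1 ^ n = sf_scale (\<alpha> ^ n) (gen_prod (1 / \<alpha>) (replicate_mset n 1))" for n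
    by (induction n) (simp_all add: gen_1 del: One_nat_def)
  ultimately have "power_sum 1 ^ ?n = sf_scale (\<alpha> ^ ?n) (gen_prod (1 / \<alpha>) (parts_mset (single_column ?n)))"
    by simp
  then show ?thesis by (simp add: jack_inner_gen_prod_parts J_coeff_column)
qed

end

lemma laplace_p1: "laplace (power_sum 1) = 0"
  using laplace_gen[of "1 / \<alpha>" 1] by (simp add: gen_1 del: One_nat_def)

text \<open>X p_1 plus the commutator of \<open>laplace\<close> with p_1 raises the degree in the
  series representing p_k -> X. Between Jack functions this commutator acts by the difference of
  eigenvalues.\<close>

lemma gen_raise:
  "sf_scale (\<alpha> * of_nat (Suc r)) (gen (X / \<alpha>) (Suc r)) = sf_scale X (power_sum 1 * gen (X / \<alpha>) r) +
     (laplace (power_sum 1 * gen (X / \<alpha>) r) - power_sum 1 * laplace (gen (X / \<alpha>) r))"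
proof -
  let ?g = "gen (X / \<alpha>)" and ?p = "power_sum :: nat \<Rightarrow> ratfun symfun" and ?n = "Suc r"
  have "laplace_bracket (?p 1) (?g r) = sf_scale (1 / \<alpha>) (\<Sum>(i, j)\<in>{..<?n} \<times> {..<?n}.
      ?p (Suc (Suc (i + j))) * (psum_adj (Suc i) (?p 1) * psum_adj (Suc j) (?g r)))"
    by (rule laplace_bracket_eq) (auto simp: psum_adj_power_sum psum_adj_gen)
  also have "(\<Sum>(i, j)\<in>{..<?n} \<times> {..<?n}. ?p (Suc (Suc (i + j))) * (psum_adj (Suc i) (?p 1) * psum_adj (Suc j) (?g r))) =
      (\<Sum>(i, j)\<in>{0 :: nat} \<times> {..<r}. sf_scale (\<alpha> * X) (?p (Suc (Suc j)) * ?g (r - Suc j)))"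
    by (rule sum.mono_neutral_cong_right) (auto simp: psum_adj_power_sum psum_adj_gen mult.commute split: if_splits)
  also have "\<dots> = sf_scale (\<alpha> * X) (\<Sum>j<r. ?p (Suc (Suc j)) * ?g (r - Suc j))"
    by (simp add: sum.cartesian_product[symmetric] sf.scale_sum_right)
  finally have br: "laplace_bracket (?p 1) (?g r) = sf_scale X (\<Sum>j<r. ?p (Suc (Suc j)) * ?g (r - Suc j))" by simp
  have "sf_scale (of_nat (Suc r)) (?g (Suc r)) = sf_scale (X / \<alpha>) (?p 1 * ?g r + (\<Sum>j<r. ?p (Suc (Suc j)) * ?g (r - Suc j)))"
    unfolding gen_rec[symmetric] sum.lessThan_Suc_shift by simp
  then have "sf_scale \<alpha> (sf_scale (of_nat (Suc r)) (?g (Suc r))) =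
      sf_scale \<alpha> (sf_scale (X / \<alpha>) (?p 1 * ?g r + (\<Sum>j<r. ?p (Suc (Suc j)) * ?g (r - Suc j))))" by simp
  then have "sf_scale (\<alpha> * of_nat (Suc r)) (?g (Suc r)) = sf_scale X (?p 1 * ?g r) + laplace_bracket (?p 1) (?g r)"
    by (simp add: br sf.scale_right_distrib del: of_nat_Suc One_nat_def)
  then show ?thesis by (simp add: laplace_mult laplace_p1 del: of_nat_Suc One_nat_def)
qed

definition content_prod :: "ratfun \<Rightarrow> partition \<Rightarrow> ratfun" where
  "content_prod X l = (\<Prod>(i, j)\<in>diagram l. X + \<alpha> * of_nat j - of_nat i)"

text \<open>Expand \<open>gen (X / \<alpha>) r\<close> and the r-th power of p_1 in Jack functions.
  Raising either one by a degree uses the same Pieri coefficients, except that the former gets a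
  factor X + content of the added box.\<close>

lemma (in jack_family) J_specialization:
  "jack_inner (J l) (gen (X / \<alpha>) (weight l)) = content_prod X l"
proof (induction "weight l" arbitrary: l)
  case 0
  then have w: "weight l = 0" by simp
  have "part l i = 0" for i using part_eq_0_if_weight_le[of l i] w by simp
  then have "single_column (weight l) = l"
    by (intro partition_eqI) (simp add: single_column.rep_eq w)
  moreover have "diagram l = {}" using w finite_diagram[of l] by (simp add: weight_eq_card)
  ultimately show ?case
    using J_coeff_column[of l] jack_inner_gen_prod_parts[of "J l" l]
    by (simp add: w parts_mset_weight_0 content_prod_def)
next
  case (Suc r)
  note w = Suc(2)[symmetric]
  let ?E = "gen (X / \<alpha>) r" and ?p = "power_sum 1 :: ratfun symfun" and ?e = "content_sum (1 / \<alpha>)"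
  let ?T = "{m. weight m \<le> weight l}"
  define \<phi> where "\<phi> f = jack_inner (J l) (?p * f)" for f
  \<comment> \<open>The pairing with the raising operator; on \<open>J m\<close> self-adjointness
    turns the commutator into the difference of eigenvalues, the content of the added box.\<close>
  define \<psi> where "\<psi> f = jack_inner (J l) (sf_scale X (?p * f) + (laplace (?p * f) - ?p * laplace f))" for f
  have lin: "Vector_Spaces.linear sf_scale (*) \<phi>" "Vector_Spaces.linear sf_scale (*) \<psi>"
    by (rule linearI_sf[OF vector_space_ratfun]; simp add: \<phi>_def \<psi>_def algebra_simps)+
  have \<psi>_J: "\<psi> (J m) = (X + ?e l - ?e m) * \<phi> (J m)" for m
    using jack_inner_laplace[of "J l" "?p * J m"] by (simp add: \<phi>_def \<psi>_def laplace_J algebra_simps)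
  have box: "weight m = r \<and> (X + ?e l - ?e m) * content_prod X m = content_prod X l" if nz: "\<phi> (J m) \<noteq> 0" for m
  proof -
    obtain i j where s: "(i, j) \<notin> diagram m" "diagram l = insert (i, j) (diagram m)"
      using pieri_p1[of l m] nz unfolding \<phi>_def by (metis surj_pair)
    have "?e l = (\<alpha> * of_nat j - of_nat i) + ?e m"
      unfolding content_sum_def s(2) using s(1) finite_diagram[of m] by (simp add: mult.commute)
    moreover have "content_prod X l = (X + \<alpha> * of_nat j - of_nat i) * content_prod X m"
      unfolding content_prod_def s(2) using s(1) finite_diagram[of m] by simp
    moreover have "weight l = Suc (weight m)"
      unfolding weight_eq_card s(2) using s(1) finite_diagram[of m] by simp
    moreover have "X + ((\<alpha> * of_nat j - of_nat i) + ?e m) - ?e m = X + \<alpha> * of_nat j - of_nat i" by simp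
    ultimately show ?thesis using w by simp
  qed
  have T: "finite ?T" "\<phi> (J m) = 0" "\<psi> (J m) = 0" if "m \<notin> ?T" for m
    using box[of m] that w by (auto simp: \<psi>_J finite_weight_le)
  have finT: "finite ?T" by (rule finite_weight_le)
  \<comment> \<open>The factor of the added box completes \<open>content_prod X m\<close> to
    \<open>content_prod X l\<close>, which no longer depends on \<open>m\<close> and leaves the
    sum.\<close>
  have summand: "jack_inner ?E (J m) * \<psi> (J m) * (\<alpha> ^ r * fact r) = content_prod X l * (jack_inner (?p ^ r) (J m) * \<phi> (J m))" for m
  proof (cases "\<phi> (J m) = 0")
    case False
    with box have m: "weight m = r" "(X + ?e l - ?e m) * content_prod X m = content_prod X l" by blast+
    have "jack_inner ?E (J m) = content_prod X m"
      using Suc(1)[of m] m by (simp add: jack_inner_commute)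
    moreover have "jack_inner (?p ^ r) (J m) = \<alpha> ^ r * fact r"
      using jack_inner_J_p1_power[of m] m by (simp add: jack_inner_commute)
    ultimately show ?thesis unfolding \<psi>_J m(2)[symmetric] by (simp only: mult_ac)
  qed (simp add: \<psi>_J)
  have "\<alpha> * of_nat (Suc r) * jack_inner (J l) (gen (X / \<alpha>) (weight l)) = \<psi> ?E"
    using arg_cong[OF gen_raise[of r X], of "jack_inner (J l)"] unfolding \<psi>_def w by (simp only: jack_inner_simps)
  then have "\<alpha> * of_nat (Suc r) * jack_inner (J l) (gen (X / \<alpha>) (weight l)) * (\<alpha> ^ r * fact r) =
      (\<Sum>m\<in>?T. jack_inner ?E (J m) * \<psi> (J m) * (\<alpha> ^ r * fact r) / norm2 m)"
    using linear_expansion[OF lin(2) finT, of ?E] T by (simp add: sum_distrib_right)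
  also have "\<dots> = content_prod X l * \<phi> (?p ^ r)"
    unfolding summand using linear_expansion[OF lin(1) finT, of "?p ^ r"] T by (simp add: sum_distrib_left)
  also have "\<phi> (?p ^ r) = \<alpha> * of_nat (Suc r) * (\<alpha> ^ r * fact r)"
    using jack_inner_J_p1_power[of l] by (simp add: \<phi>_def w mult_ac)
  finally show ?case by (simp del: of_nat_Suc)
qed

section \<open>The specialization as a ring homomorphism\<close>

definition specialize :: "ratfun \<Rightarrow> ratfun symfun \<Rightarrow> ratfun" where
  "specialize X = (SOME L. Vector_Spaces.linear sf_scale (*) L \<and> (\<forall>A. 0 \<notin># A \<longrightarrow> L (psum A) = X ^ size A))"

lemma specialize_spec:
  "Vector_Spaces.linear sf_scale (*) (specialize X) \<and> (\<forall>A. 0 \<notin># A \<longrightarrow> specialize X (psum A) = X ^ size A)"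
proof -
  have "\<exists>L. Vector_Spaces.linear sf_scale (*) L \<and> (\<forall>A. 0 \<notin># A \<longrightarrow> L (psum A :: ratfun symfun) = X ^ size A)"
    by (rule ex_linear_on_psum[OF vector_space_ratfun, where h = "\<lambda>A. X ^ size A"]) blast
  from someI_ex[OF this] show ?thesis unfolding specialize_def .
qed

lemmas specialize_psum = specialize_spec[THEN conjunct2, rule_format]
lemmas specialize_simps [simp] = linear_sf_simps[OF specialize_spec[THEN conjunct1]]

lemma specialize_1 [simp]: "specialize X 1 = 1"
  using specialize_psum[of "{#}"] by simp

lemma specialize_power_sum_mult: "k > 0 \<Longrightarrow> specialize X (power_sum k * f) = X * specialize X f"
proof (induction f rule: symfun_induct)
  case (psum A)
  then show ?case using specialize_psum[of "add_mset k A" X] specialize_psum[of A X] by auto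
qed (simp_all add: algebra_simps)

lemma specialize_mult [simp]: "specialize X (f * h) = specialize X f * specialize X h"
  by (induction f rule: symfun_mult_induct) (simp_all add: distrib_right specialize_power_sum_mult mult.assoc)

text \<open>The series specializes to (1 - y)^(-\<theta> X); this is the ratio of its consecutive
  coefficients.\<close>

lemma specialize_gen_rec:
  "of_nat (Suc n) * specialize X (gen \<theta> (Suc n)) = (of_nat n + \<theta> * X) * specialize X (gen \<theta> n)"
proof -
  have *: "of_nat n * specialize X (gen \<theta> n) = \<theta> * X * (\<Sum>k<n. specialize X (gen \<theta> k))" for n
  proof -
    have "of_nat n * specialize X (gen \<theta> n) = \<theta> * X * (\<Sum>k<n. specialize X (gen \<theta> (n - Suc k)))"
      using arg_cong[OF gen_rec[of \<theta> n], of "specialize X"]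
      by (simp add: specialize_power_sum_mult sum_distrib_left mult.assoc del: specialize_mult)
    then show ?thesis using sum.nat_diff_reindex[of "\<lambda>k. specialize X (gen \<theta> k)" n] by simp
  qed
  show ?thesis using *[of n] *[of "Suc n"] by (simp add: algebra_simps)
qed

text \<open>Here the specialized series is the polynomial (1 - y)^N: every index above
  \<open>N\<close> gives 0, and the index \<open>N\<close> gives a sign.\<close>

lemma specialize_gen:
  assumes "\<theta> * X = - of_nat N"
  shows "specialize X (gen \<theta> n) = (- 1) ^ n * of_nat (N choose n)"
proof (induction n)
  case (Suc n)
  have "of_nat (Suc n) * of_nat (N choose Suc n) = (of_nat N - of_nat n) * (of_nat (N choose n) :: ratfun)"
  proof (cases "n \<le> N")
    case True
    have "Suc n * (N choose Suc n) = (N - n) * (N choose n)"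
      using binomial_absorption[of n N] binomial_absorb_comp[of N n] by simp
    then have "of_nat (Suc n * (N choose Suc n)) = (of_nat ((N - n) * (N choose n)) :: ratfun)" by (rule arg_cong)
    then show ?thesis using True by (simp only: of_nat_mult of_nat_diff)
  qed (simp add: binomial_eq_0)
  note absorb = this
  have "of_nat (Suc n) * ((- 1) ^ Suc n * of_nat (N choose Suc n)) =
      (- 1) ^ Suc n * (of_nat (Suc n) * (of_nat (N choose Suc n) :: ratfun))" by (simp only: mult_ac)
  also have "\<dots> = (of_nat n + - of_nat N) * ((- 1) ^ n * of_nat (N choose n))"
    unfolding absorb by (simp add: algebra_simps)
  finally have "of_nat (Suc n) * specialize X (gen \<theta> (Suc n)) = of_nat (Suc n) * ((- 1) ^ Suc n * of_nat (N choose Suc n))"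
    unfolding specialize_gen_rec assms Suc by simp
  then show ?case by (rule mult_left_cancel[THEN iffD1, OF of_nat_neq_0])
qed simp

section \<open>Homogeneous components\<close>

definition homogeneous :: "nat \<Rightarrow> ratfun symfun set" where
  "homogeneous n = sf.span {psum A | A. 0 \<notin># A \<and> sum_mset A = n}"

lemma homogeneous_mult:
  assumes "f \<in> homogeneous a" "h \<in> homogeneous b" shows "f * h \<in> homogeneous (a + b)"
proof -
  have "psum A * h \<in> homogeneous (a + b)" if "0 \<notin># A" "sum_mset A = a" for A
    using assms(2) unfolding homogeneous_def
  proof (rule span_mult_mono)
    fix x :: "ratfun symfun" assume "x \<in> {psum A | A. 0 \<notin># A \<and> sum_mset A = b}"
    then obtain B where "x = psum B" "0 \<notin># B" "sum_mset B = b" by blast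
    then show "psum A * x \<in> sf.span {psum A | A. 0 \<notin># A \<and> sum_mset A = a + b}"
      using that by (intro sf.span_base CollectI exI[of _ "A + B"]) auto
  qed
  then have "h * f \<in> homogeneous (a + b)"
    using assms(1) unfolding homogeneous_def by (intro span_mult_mono[of f]) (auto simp: mult.commute)
  then show ?thesis by (simp add: mult.commute)
qed

lemma jack_inner_homogeneous:
  assumes "f \<in> homogeneous a" "h \<in> homogeneous b" "a \<noteq> b"
  shows "jack_inner f h = 0"
  using assms(2) unfolding homogeneous_def
proof (rule jack_inner_span_eq_0)
  fix x :: "ratfun symfun" assume "x \<in> {psum A | A. 0 \<notin># A \<and> sum_mset A = b}"
  then obtain B where B: "x = psum B" "0 \<notin># B" "sum_mset B = b" by blast
  have "jack_inner x f = 0"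
    using assms(1) unfolding homogeneous_def
    by (rule jack_inner_span_eq_0) (use B assms(3) in \<open>auto simp: jack_inner_psum\<close>)
  then show "jack_inner f x = 0" by (simp add: jack_inner_commute)
qed

lemma gen_homogeneous: "gen \<theta> n \<in> homogeneous n"
proof (induction n rule: less_induct)
  case (less n)
  show ?case
  proof (cases n)
    case 0
    then show ?thesis by (auto simp: homogeneous_def intro!: sf.span_base exI[of _ "{#}"])
  next
    case (Suc m)
    have p: "power_sum k \<in> homogeneous k" if "k > 0" for k
      unfolding homogeneous_def by (rule sf.span_base) (rule CollectI, rule exI[of _ "{#k#}"], use that in simp)
    have "power_sum (Suc k) * gen \<theta> (m - k) \<in> homogeneous n" if "k \<le> m" for k
      using homogeneous_mult[OF p[of "Suc k"] less[of "m - k"]] that by (simp add: Suc)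
    then show ?thesis unfolding Suc gen.simps(2) homogeneous_def
      by (intro sf.span_scale sf.span_sum) (auto simp: Suc)
  qed
qed

lemma gen_prod_homogeneous: "gen_prod \<theta> A \<in> homogeneous (sum_mset A)"
proof (induction A)
  case empty
  then show ?case using gen_homogeneous[of \<theta> 0] by simp
qed (simp add: homogeneous_mult gen_homogeneous)

text \<open>Moving a power sum across the pairing lowers the index of
  \<open>gen (X / \<alpha>)\<close> and contributes \<alpha> (X / \<alpha>) = X.\<close>

lemma specialize_homogeneous:
  assumes "f \<in> homogeneous n" shows "specialize X f = jack_inner f (gen (X / \<alpha>) n)"
proof -
  have psum: "jack_inner (psum A) (gen (X / \<alpha>) (sum_mset A)) = X ^ size A" if "0 \<notin># A" for A
    using that
  proof (induction A)
    case empty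
    then show ?case using jack_inner_psum[of "{#}" "{#}"] by (simp add: psum_norm_def z_mset_def)
  qed (auto simp: jack_inner_power_sum psum_adj_gen)
  show ?thesis using assms unfolding homogeneous_def
  proof (induction rule: sf.span_induct_alt)
    case (step c x y)
    then show ?case using psum specialize_psum by auto
  qed simp
qed

lemma (in jack_family) J_homogeneous: "J l \<in> homogeneous (weight l)"
proof -
  have "{gen_prod (1 / \<alpha>) (parts_mset m) | m. l \<unlhd> m} \<subseteq> homogeneous (weight l)"
  proof clarify
    fix m assume "l \<unlhd> m"
    then show "gen_prod (1 / \<alpha>) (parts_mset m) \<in> homogeneous (weight l)"
      using gen_prod_homogeneous[of "1 / \<alpha>" "parts_mset m"] part_le_weight by (simp add: sum_parts_mset)
  qed
  then show ?thesis using J_in_span_gen_prod[of l] sf.span_minimal[OF _ sf.subspace_span]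
    unfolding homogeneous_def by blast
qed

lemma (in jack_family) specialize_J: "specialize X (J l) = content_prod X l"
  by (simp add: specialize_homogeneous[OF J_homogeneous] J_specialization)

text \<open>For this \<open>X\<close> the specialization kills the ideal, so the congruence for
  \<open>gen \<theta> (part l 0) * K (drop_row l)\<close> becomes an equation of content products,
  in which \<open>P\<close> is the share of the removed strip.\<close>

lemma (in jack_strip) strip_ratio:
  assumes X: "\<theta> * X = - of_nat (part l 0)"
    and P: "content_prod X (\<sigma> l) = content_prod X (\<sigma> (drop_row l)) * P"
    and nonzero: "content_prod X (\<sigma> (drop_row l)) \<noteq> 0"
  shows "norm2 (\<sigma> l) / strip l = (- 1) ^ part l 0 * P"
proof -
  have 0: "specialize X f = 0" if "f \<in> ideal (part l 0)" for f
    using that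
  proof (induction rule: sf.span_induct_alt)
    case (step c x y)
    then obtain C a where C: "x = gen_prod \<theta> C" "a \<in># C" "part l 0 < a" by blast
    then obtain B where "C = add_mset a B" by (metis insert_DiffM)
    then show ?case using C step by (simp add: specialize_gen[OF X])
  qed simp
  let ?c = "content_prod X (\<sigma> (drop_row l))"
  have "?c * (- 1) ^ part l 0 = ?c * (strip l / norm2 (\<sigma> l) * P)"
    using 0[OF gen_mult_K_drop_row] by (simp add: specialize_gen[OF X] specialize_J P mult_ac)
  then have "(- 1) ^ part l 0 = strip l / norm2 (\<sigma> l) * P"
    using nonzero mult_left_cancel by blast
  then have "(- 1) ^ part l 0 * P * strip l = (- 1) ^ part l 0 * (- 1) ^ part l 0 * norm2 (\<sigma> l)"
    by simp
  then show ?thesis by (simp add: field_simps)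
qed

section \<open>Norms and leading coefficients\<close>

lemma prod_diagram_transpose: "(\<Prod>s\<in>diagram (transpose l). F s) = (\<Prod>s\<in>diagram l. F (prod.swap s))"
  unfolding diagram_transpose by (subst prod.reindex) auto

lemma prod_split_first_column:
  "(\<Prod>s\<in>diagram l. F s) = (\<Prod>i<part (transpose l) 0. F (i, 0)) * (\<Prod>(i, j)\<in>diagram (drop_column l). F (i, Suc j))"
proof -
  have "(\<Prod>s\<in>diagram l. F s) = (\<Prod>s\<in>diagram (transpose l). F (prod.swap s))"
    using prod_diagram_transpose[of F "transpose l"] by simp
  also have "\<dots> = (\<Prod>i<part (transpose l) 0. F (i, 0)) * (\<Prod>(i, j)\<in>diagram (transpose (drop_column l)). F (j, Suc i))"
    by (subst prod.split_first_row) (simp add: transpose_drop_column split_def)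
  finally show ?thesis by (simp add: prod_diagram_transpose split_def)
qed

text \<open>The boxes keep their coordinates: \<open>drop_column l\<close> arises by deleting the
  last box of each row. Contents depend on position and call for this splitting, while arms and legs
  are compared after the shift in \<open>prod_split_first_column\<close>.\<close>

lemma prod_diagram_row_ends:
  "(\<Prod>s\<in>diagram l. F s) = (\<Prod>s\<in>diagram (drop_column l). F s) * (\<Prod>i<part (transpose l) 0. F (i, part l i - 1))"
proof -
  let ?E = "(\<lambda>i. (i, part l i - 1)) ` {..<part (transpose l) 0}"
  have "diagram l = diagram (drop_column l) \<union> ?E"
    by (auto simp: diagram_def drop_column.rep_eq image_iff)
  then have "(\<Prod>s\<in>diagram l. F s) = (\<Prod>s\<in>diagram (drop_column l) \<union> ?E. F s)" by simp
  also have "\<dots> = (\<Prod>s\<in>diagram (drop_column l). F s) * (\<Prod>s\<in>?E. F s)"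
    by (rule prod.union_disjoint) (auto simp: finite_diagram, auto simp: diagram_def drop_column.rep_eq)
  also have "(\<Prod>s\<in>?E. F s) = (\<Prod>i<part (transpose l) 0. F (i, part l i - 1))"
    by (subst prod.reindex) (auto simp: inj_on_def)
  finally show ?thesis .
qed

lemma prod_diagram_column_ends:
  "(\<Prod>s\<in>diagram l. F s) = (\<Prod>s\<in>diagram (drop_row l). F s) * (\<Prod>j<part l 0. F (part (transpose l) j - 1, j))"
proof -
  have "(\<Prod>s\<in>diagram l. F s) = (\<Prod>s\<in>diagram (transpose l). F (prod.swap s))"
    using prod_diagram_transpose[of F "transpose l"] by simp
  also have "\<dots> = (\<Prod>s\<in>diagram (transpose (drop_row l)). F (prod.swap s)) * (\<Prod>j<part l 0. F (part (transpose l) j - 1, j))"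
    by (subst prod_diagram_row_ends) (simp add: transpose_drop_row)
  finally show ?thesis by (simp add: prod_diagram_transpose)
qed

lemma c_lower_drop_row:
  assumes "part l 0 = part m 0"
  shows "c_lower m l = (\<Prod>j<part m 0. of_int (arm m (0, j)) * \<alpha> + of_int (leg l (0, j)) + 1) * c_lower (drop_row m) (drop_row l)"
proof -
  have "of_int (arm m (Suc i, j)) * \<alpha> + of_int (leg l (Suc i, j)) + 1 =
      of_int (arm (drop_row m) (i, j)) * \<alpha> + of_int (leg (drop_row l) (i, j)) + 1" if "(i, j) \<in> diagram (drop_row m)" for i j
  proof -
    have "j < part l 0" using that part_le_first[of m "Suc i"] assms by (simp add: diagram_def drop_row.rep_eq)
    \<comment> \<open>A nonempty column makes the truncated subtraction in
      \<open>drop_column\<close> exact.\<close>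
    then have "0 < part (transpose l) j" by simp
    then show ?thesis by (simp add: arm_def leg_def drop_row.rep_eq transpose_drop_row drop_column.rep_eq of_nat_diff del: less_part_transpose)
  qed
  then show ?thesis unfolding c_lower_def prod.split_first_row[of _ m]
    by (intro arg_cong2[where f = "(*)"] refl prod.cong) auto
qed

lemma c_upper_drop_row:
  "c_upper l m = (\<Prod>j<part m 0. (of_int (arm l (0, j)) + 1) * \<alpha> + of_int (leg m (0, j))) * c_upper (drop_row l) (drop_row m)"
proof -
  have "(of_int (arm l (Suc i, j)) + 1) * \<alpha> + of_int (leg m (Suc i, j)) =
      (of_int (arm (drop_row l) (i, j)) + 1) * \<alpha> + of_int (leg (drop_row m) (i, j))" if "(i, j) \<in> diagram (drop_row m)" for i j
  proof -
    have "j < part m 0" using that part_le_first[of m "Suc i"] by (simp add: diagram_def drop_row.rep_eq)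
    then have "0 < part (transpose m) j" by simp
    then show ?thesis by (simp add: arm_def leg_def drop_row.rep_eq transpose_drop_row drop_column.rep_eq of_nat_diff del: less_part_transpose)
  qed
  then show ?thesis unfolding c_upper_def prod.split_first_row[of _ m]
    by (intro arg_cong2[where f = "(*)"] refl prod.cong) auto
qed

lemma c_lower_drop_column:
  "c_lower m l = (\<Prod>i<part (transpose m) 0. of_int (arm m (i, 0)) * \<alpha> + of_int (leg l (i, 0)) + 1) * c_lower (drop_column m) (drop_column l)"
proof -
  have "of_int (arm m (i, Suc j)) * \<alpha> + of_int (leg l (i, Suc j)) + 1 =
      of_int (arm (drop_column m) (i, j)) * \<alpha> + of_int (leg (drop_column l) (i, j)) + 1" if "(i, j) \<in> diagram (drop_column m)" for i j
    using that by (simp add: arm_def leg_def diagram_def drop_row.rep_eq transpose_drop_column drop_column.rep_eq of_nat_diff del: less_part_transpose)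
  then show ?thesis unfolding c_lower_def prod_split_first_column[of _ m]
    by (intro arg_cong2[where f = "(*)"] refl prod.cong) auto
qed

lemma c_upper_drop_column:
  assumes "part (transpose l) 0 = part (transpose m) 0"
  shows "c_upper l m = (\<Prod>i<part (transpose m) 0. (of_int (arm l (i, 0)) + 1) * \<alpha> + of_int (leg m (i, 0))) * c_upper (drop_column l) (drop_column m)"
proof -
  have "(of_int (arm l (i, Suc j)) + 1) * \<alpha> + of_int (leg m (i, Suc j)) =
      (of_int (arm (drop_column l) (i, j)) + 1) * \<alpha> + of_int (leg (drop_column m) (i, j))" if "(i, j) \<in> diagram (drop_column m)" for i j
  proof -
    have "0 < part m i" using that by (simp add: diagram_def drop_column.rep_eq)
    then have "i < part (transpose l) 0" unfolding assms by simp
    then have "0 < part l i" by simp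
    then show ?thesis by (simp add: arm_def leg_def drop_row.rep_eq transpose_drop_column drop_column.rep_eq of_nat_diff del: less_part_transpose)
  qed
  then show ?thesis unfolding c_upper_def prod_split_first_column[of _ m]
    by (intro arg_cong2[where f = "(*)"] refl prod.cong) auto
qed

lemma weight_0_unique: "weight l = 0 \<Longrightarrow> weight m = 0 \<Longrightarrow> l = m"
  by (metis parts_mset_inject parts_mset_weight_0)

text \<open>Solves the norm formula for the second scalar: \<open>p\<close> is the norm,
  \<open>q\<close> is \<open>strip\<close>, and \<open>r * s\<close> the norm of the reduced
  function.\<close>

lemma strip_ratio_aux:
  fixes p q :: "'a :: field"
  assumes "p = (p / q * r) * (A * s)" "p \<noteq> 0" "q \<noteq> 0" "r \<noteq> 0" "s \<noteq> 0"
  shows "q / (r * s) = A"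
proof -
  have "p * q = p * (A * (r * s))" using assms(1,3) by (simp add: field_simps)
  then show ?thesis using assms by simp
qed

section \<open>Hook formulas for leading coefficients and norms\<close>

context jack_family
begin

lemma J_empty:
  assumes "weight l = 0" shows "lead l = 1" "norm2 l = 1"
proof -
  have l: "parts_mset l = {#}" using assms by (rule parts_mset_weight_0)
  have "diagram l = {}" using assms finite_diagram[of l] by (simp add: weight_eq_card)
  then have 1: "jack_inner (J l) 1 = 1"
    using J_specialization[of l 0] assms by (simp add: content_prod_def)
  then show "lead l = 1" using jack_inner_gen_prod_parts[of "J l" l] by (simp add: lead_def l)
  have "{gen_prod (1 / \<alpha>) (parts_mset m) | m. l \<unlhd> m \<and> m \<noteq> l} = {}"
    using assms part_le_weight weight_0_unique by fastforce
  then have "J l - sf_scale (norm2 l / lead l) (gen_prod (1 / \<alpha>) (parts_mset l)) \<in> sf.span {}"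
    using J_gen_prod[of l] by (simp only:)
  then have "J l = sf_scale (norm2 l / lead l) 1" by (simp add: l)
  then have "jack_inner (J l) 1 = jack_inner (sf_scale (norm2 l) 1) 1" using \<open>lead l = 1\<close> by simp
  then show "norm2 l = 1"
    using 1 jack_inner_psum[of "{#}" "{#}"] by (simp add: psum_norm_def z_mset_def)
qed

text \<open>At X = -N \<alpha> the factor of the bottom box of a column is minus the upper hook
  length of its top box; the sign of \<open>strip_ratio\<close> absorbs the minus signs.\<close>

lemma row_strip_ratio:
  "norm2 l / row.strip l = (\<Prod>j<part l 0. (of_int (arm l (0, j)) + 1) * \<alpha> + of_int (leg l (0, j)))"
proof -
  let ?N = "part l 0"
  let ?X = "- (of_nat ?N * \<alpha>)"
  have pos: "0 < part (transpose l) j" if "j < ?N" for j using that by simp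
  have "?X + \<alpha> * of_nat j - of_nat i \<noteq> 0" if "(i, j) \<in> diagram (drop_row l)" for i j
  proof -
    have "j < ?N" using that part_le_first[of l "Suc i"] by (simp add: diagram_def drop_row.rep_eq)
    then have "of_nat j * \<alpha> < of_nat ?N * \<alpha>" using \<alpha>_pos by simp
    moreover have "of_nat i \<ge> (0 :: ratfun)" by simp
    ultimately have "?X + \<alpha> * of_nat j - of_nat i < 0" by (simp only: mult.commute[of \<alpha>])
    then show ?thesis by simp
  qed
  then have nz: "content_prod ?X (drop_row l) \<noteq> 0"
    by (auto simp: content_prod_def finite_diagram)
  have "content_prod ?X l = content_prod ?X (drop_row l) * (\<Prod>j<?N. ?X + \<alpha> * of_nat j - of_nat (part (transpose l) j - 1))"
    unfolding content_prod_def by (subst prod_diagram_column_ends) simp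
  then have "norm2 l / row.strip l = (- 1) ^ ?N * (\<Prod>j<?N. ?X + \<alpha> * of_nat j - of_nat (part (transpose l) j - 1))"
    by (rule row.strip_ratio[rotated]) (use nz in simp_all)
  also have "(- 1) ^ ?N = (\<Prod>j<?N. - 1 :: ratfun)" by simp
  also have "\<dots> * (\<Prod>j<?N. ?X + \<alpha> * of_nat j - of_nat (part (transpose l) j - 1)) =
      (\<Prod>j<?N. - 1 * (?X + \<alpha> * of_nat j - of_nat (part (transpose l) j - 1)))"
    by (rule prod.distrib[symmetric])
  also have "\<dots> = (\<Prod>j<?N. (of_int (arm l (0, j)) + 1) * \<alpha> + of_int (leg l (0, j)))"
  proof (rule prod.cong)
    fix j assume "j \<in> {..<?N}"
    then show "- 1 * (?X + \<alpha> * of_nat j - of_nat (part (transpose l) j - 1)) = (of_int (arm l (0, j)) + 1) * \<alpha> + of_int (leg l (0, j))"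
      using pos[of j] by (simp add: arm_def leg_def of_nat_diff algebra_simps del: less_part_transpose)
  qed simp
  finally show ?thesis .
qed

text \<open>At X = N the factor of the last box of a row is the lower hook length of its first box,
  so the sign of \<open>strip_ratio\<close> remains.\<close>

lemma column_strip_ratio:
  "norm2 l / column.strip (transpose l) =
     (- 1) ^ part (transpose l) 0 * (\<Prod>i<part (transpose l) 0. of_int (arm l (i, 0)) * \<alpha> + of_int (leg l (i, 0)) + 1)"
proof -
  let ?N = "part (transpose l) 0"
  let ?X = "of_nat ?N :: ratfun"
  have "?X + \<alpha> * of_nat j - of_nat i \<noteq> 0" if "(i, j) \<in> diagram (drop_column l)" for i j
  proof -
    have "i < ?N" using that by (simp add: diagram_def drop_column.rep_eq)
    then have "of_nat i < ?X" by simp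
    moreover have "\<alpha> * of_nat j \<ge> 0" using \<alpha>_pos by simp
    ultimately show ?thesis by linarith
  qed
  then have nz: "content_prod ?X (drop_column l) \<noteq> 0"
    by (auto simp: content_prod_def finite_diagram)
  have "content_prod ?X l = content_prod ?X (drop_column l) * (\<Prod>i<?N. ?X + \<alpha> * of_nat (part l i - 1) - of_nat i)"
    unfolding content_prod_def by (subst prod_diagram_row_ends) simp
  then have "norm2 l / column.strip (transpose l) = (- 1) ^ ?N * (\<Prod>i<?N. ?X + \<alpha> * of_nat (part l i - 1) - of_nat i)"
    using column.strip_ratio[of ?X "transpose l"] nz by (simp add: transpose_drop_row)
  also have "(\<Prod>i<?N. ?X + \<alpha> * of_nat (part l i - 1) - of_nat i) = (\<Prod>i<?N. of_int (arm l (i, 0)) * \<alpha> + of_int (leg l (i, 0)) + 1)"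
  proof (rule prod.cong)
    fix i assume "i \<in> {..<?N}"
    then have "0 < part l i" by simp
    then show "?X + \<alpha> * of_nat (part l i - 1) - of_nat i = of_int (arm l (i, 0)) * \<alpha> + of_int (leg l (i, 0)) + 1"
      by (simp add: arm_def leg_def of_nat_diff algebra_simps)
  qed simp
  finally show ?thesis .
qed

lemma norm2_div_lead: "norm2 l / lead l = c_upper l l"
proof (induction l rule: partition_induct)
  case (empty l)
  then have "weight l = 0" using parts_mset_drop_row[of l] sum_parts_mset[of l] by simp
  moreover from this have "diagram l = {}" using finite_diagram[of l] by (simp add: weight_eq_card)
  ultimately show ?case by (simp add: J_empty c_upper_def)
next
  case (row l)
  then show ?case using row.w_eq[of l] by (simp add: row_strip_ratio c_upper_drop_row[of l l])
qed

text \<open>Unrolls the column recursion; its signs cancel against those of the expansion in dual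
  products.\<close>

lemma lead_eq: "lead l = c_lower l l"
proof (induction "weight l" arbitrary: l rule: less_induct)
  case less
  show ?case
  proof (cases "weight l = 0")
    case True
    moreover from this have "diagram l = {}" using finite_diagram[of l] by (simp add: weight_eq_card)
    ultimately show ?thesis by (simp add: J_empty c_lower_def)
  next
    case False
    let ?N = "part (transpose l) 0"
    have w: "weight l = ?N + weight (drop_column l)"
      using weight_drop_row[of "transpose l"] by (simp flip: transpose_drop_column)
    have "?N \<noteq> 0"
    proof
      assume "?N = 0"
      then have "parts_mset (transpose l) = {#}" by (subst parts_mset_drop_row) simp
      then show False using False sum_parts_mset[of "transpose l"] by simp
    qed
    then have IH: "lead (drop_column l) = c_lower (drop_column l) (drop_column l)" using w by (intro less) simp
    have "(- 1) ^ weight l * lead l = norm2 l / column.strip (transpose l) * ((- 1) ^ weight (drop_column l) * lead (drop_column l))"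
      using column.w_eq[of "transpose l"] weight_transpose[of "drop_column l"] by (simp add: transpose_drop_row transpose_drop_column[symmetric])
    also have "\<dots> = (- 1) ^ weight l * c_lower l l"
      unfolding column_strip_ratio IH c_lower_drop_column[of l l] w by (simp add: power_add mult_ac)
    finally show ?thesis by simp
  qed
qed

lemma norm2_eq_hooks: "norm2 l = c_upper l l * c_lower l l"
  using norm2_div_lead[of l] lead_nonzero[of l] by (simp add: lead_eq field_simps)

lemma c_diag_nonzero [simp]: "c_upper l l \<noteq> 0" "c_lower l l \<noteq> 0"
  using norm2_nonzero[of l] by (auto simp: norm2_eq_hooks)

definition hook_product :: "partition \<Rightarrow> partition \<Rightarrow> ratfun" where
  "hook_product l m = c_lower m l * c_upper l m"

text \<open>The first scalar is the top row of \<open>c_upper l m\<close>; the second, solved from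
  the norm formula, is the top row of \<open>c_lower m l\<close>. Both identifications use that
  equal first rows have equal arms.\<close>

lemma jack_inner_row:
  assumes "part l 0 = part m 0"
  shows "hook_product (drop_row l) (drop_row m) * jack_inner (J l) (J m * f) =
    hook_product l m * jack_inner (J (drop_row l)) (J (drop_row m) * f)"
proof -
  let ?l = "drop_row l" and ?m = "drop_row m"
  let ?A = "\<Prod>j<part m 0. of_int (arm m (0, j)) * \<alpha> + of_int (leg l (0, j)) + 1"
  let ?u = "norm2 l / row.strip l"
  have "c_lower l l = ?A * c_lower ?l ?l"
    using c_lower_drop_row[of l l] assms by (simp add: arm_def)
  moreover have "c_upper l l = ?u * c_upper ?l ?l"
    unfolding row_strip_ratio by (rule c_upper_drop_row)
  ultimately have "norm2 l = (?u * c_upper ?l ?l) * (?A * c_lower ?l ?l)"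
    unfolding norm2_eq_hooks[of l] by (simp only:)
  then have strip: "row.strip l / norm2 ?l = ?A"
    unfolding norm2_eq_hooks[of ?l] by (rule strip_ratio_aux) simp_all
  have upper: "c_upper l m = norm2 m / row.strip m * c_upper ?l ?m"
    unfolding row_strip_ratio c_upper_drop_row[of l m] using assms by (simp add: arm_def)
  have lower: "c_lower m l = ?A * c_lower ?m ?l" by (rule c_lower_drop_row[OF assms])
  show ?thesis
    unfolding row.jack_inner_drop_row[OF assms] strip hook_product_def upper lower by (simp only: mult_ac)
qed

text \<open>As for rows, with \<open>c_lower\<close> and \<open>c_upper\<close> exchanged and equal
  legs in place of equal arms. Both scalars carry the sign \<open>(- 1) ^ ?N\<close>, which
  cancels.\<close>

lemma jack_inner_column:
  assumes "part (transpose l) 0 = part (transpose m) 0"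
  shows "hook_product (drop_column l) (drop_column m) * jack_inner (J l) (J m * f) =
    hook_product l m * jack_inner (J (drop_column l)) (J (drop_column m) * f)"
proof -
  let ?l = "drop_column l" and ?m = "drop_column m" and ?N = "part (transpose m) 0"
  let ?A = "\<Prod>i<?N. (of_int (arm l (i, 0)) + 1) * \<alpha> + of_int (leg m (i, 0))"
  let ?u = "norm2 l / column.strip (transpose l)"
  have "c_upper l l = ?A * c_upper ?l ?l"
    using c_upper_drop_column[of l l] assms by (simp add: leg_def)
  moreover have "c_lower l l = (- 1) ^ ?N * ?u * c_lower ?l ?l"
    unfolding column_strip_ratio c_lower_drop_column[of l l] assms by simp
  ultimately have "norm2 l = (?A * c_upper ?l ?l) * ((- 1) ^ ?N * ?u * c_lower ?l ?l)"
    unfolding norm2_eq_hooks[of l] by (simp only:)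
  then have "norm2 l = (?u * c_upper ?l ?l) * ((- 1) ^ ?N * ?A * c_lower ?l ?l)" by (simp only: mult_ac)
  then have strip: "column.strip (transpose l) / norm2 ?l = (- 1) ^ ?N * ?A"
    unfolding norm2_eq_hooks[of ?l] by (rule strip_ratio_aux) (use norm2_nonzero in simp_all)
  have lower: "c_lower m l = (- 1) ^ ?N * (norm2 m / column.strip (transpose m)) * c_lower ?m ?l"
    unfolding column_strip_ratio c_lower_drop_column[of m l] using assms by (simp add: leg_def)
  have upper: "c_upper l m = ?A * c_upper ?l ?m" by (rule c_upper_drop_column[OF assms])
  have "jack_inner (J l) (J m * f) = norm2 m / column.strip (transpose m) * (column.strip (transpose l) / norm2 ?l) * jack_inner (J ?l) (J ?m * f)"
    using column.jack_inner_drop_row[OF assms] by (simp add: transpose_drop_row)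
  then show ?thesis
    unfolding strip hook_product_def upper lower by (simp only: mult_ac)
qed

section \<open>Skew Jack functions\<close>

lemma J_nondegenerate:
  assumes "\<And>n. jack_inner f (J n) = jack_inner g (J n)" shows "f = g"
proof -
  have "f - g \<in> sf.span {J l | l. False}" by (rule J_in_span) (simp add: assms)
  then show ?thesis by simp
qed

text \<open>Shows that the description in \<open>skew_jack\<close> has a unique solution. The
  prescribed pairings vanish for weights above that of \<open>l\<close> by homogeneity, so a finite
  sum realizes them.\<close>

lemma jack_inner_skew_jack: "jack_inner (skew_jack J l m) (J n) = jack_inner (J l) (J m * J n)"
proof -
  let ?c = "\<lambda>n. jack_inner (J l) (J m * J n)"
  let ?S = "{n. weight n \<le> weight l}"
  let ?f = "\<Sum>n\<in>?S. sf_scale (?c n / norm2 n) (J n)"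
  have "jack_inner ?f (J n) = ?c n" for n
  proof -
    have "jack_inner ?f (J n) = (\<Sum>k\<in>?S. if k = n then ?c n else 0)"
      unfolding jack_inner_simps
      by (rule sum.cong) (use norm2_nonzero[of n] in \<open>auto simp: J_orth norm2_def\<close>)
    also have "\<dots> = (if n \<in> ?S then ?c n else 0)" by (simp add: finite_weight_le)
    also have "\<dots> = ?c n"
      using jack_inner_homogeneous[OF J_homogeneous[of l] homogeneous_mult[OF J_homogeneous[of m] J_homogeneous[of n]]]
      by auto
    finally show ?thesis .
  qed
  then have "\<exists>!f. \<forall>n. jack_inner f (J n) = ?c n"
    by (intro ex1I[of _ ?f]) (auto intro: J_nondegenerate)
  from theI'[OF this] show ?thesis unfolding skew_jack_def by blast
qed

end

text \<open>Containment makes all arms and legs at boxes of \<open>m\<close> nonnegative, so every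
  factor is positive in the ordered field.\<close>

lemma hook_product_nonzero:
  assumes "contained m l" shows "c_lower m l * c_upper l m \<noteq> 0"
proof -
  have nonneg: "arm m s \<ge> 0" "leg l s \<ge> 0" "arm l s \<ge> 0" "leg m s \<ge> 0" if "s \<in> diagram m" for s
  proof -
    obtain i j where s: "s = (i, j)" by (cases s)
    have "j < part m i" "j < part l i" using that assms by (auto simp: contained_def diagram_def s)
    then have "j < part m i" "j < part l i" "i < part (transpose m) j" "i < part (transpose l) j" by simp_all
    then show "arm m s \<ge> 0" "leg l s \<ge> 0" "arm l s \<ge> 0" "leg m s \<ge> 0"
      by (simp_all add: s arm_def leg_def del: less_part_transpose)
  qed
  have "of_int (arm m s) * \<alpha> + of_int (leg l s) + 1 > 0" "(of_int (arm l s) + 1) * \<alpha> + of_int (leg m s) > 0"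
    if "s \<in> diagram m" for s
  proof -
    have "of_int (arm m s) * \<alpha> \<ge> 0" "of_int (leg l s) \<ge> (0 :: ratfun)" "of_int (leg m s) \<ge> (0 :: ratfun)"
      using nonneg[OF that] \<alpha>_pos by simp_all
    moreover have "(of_int (arm l s) + 1) * \<alpha> > 0"
      using nonneg[OF that] \<alpha>_pos by (intro mult_pos_pos add_nonneg_pos) simp_all
    ultimately show "of_int (arm m s) * \<alpha> + of_int (leg l s) + 1 > 0" "(of_int (arm l s) + 1) * \<alpha> + of_int (leg m s) > 0"
      by (simp_all add: add_nonneg_pos add_pos_nonneg)
  qed
  then show ?thesis unfolding c_lower_def c_upper_def by (force simp: finite_diagram)
qed

lemma contained_iff: "contained m l \<longleftrightarrow> (\<forall>i. part m i \<le> part l i)"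
proof
  assume "contained m l"
  then have "j < part m i \<Longrightarrow> j < part l i" for i j by (auto simp: contained_def diagram_def)
  then show "\<forall>i. part m i \<le> part l i" by (metis not_le_imp_less less_irrefl)
qed (auto simp: contained_def diagram_def intro: less_le_trans)

text \<open>Carries containment through a chain of removals and additions, so that the hook product
  of each intermediate pair is nonzero.\<close>

lemma contained_remove_empty:
  assumes "remove_empty x y"
  shows "contained (snd x) (fst x) \<longleftrightarrow> contained (snd y) (fst y)"
  using assms
proof cases
  case (row l m)
  have "(\<forall>i. part m i \<le> part l i) \<longleftrightarrow> part m 0 \<le> part l 0 \<and> (\<forall>i. part m (Suc i) \<le> part l (Suc i))"
    by (metis not0_implies_Suc)
  then show ?thesis using row by (simp add: contained_iff drop_row.rep_eq)
next
  case (column l m)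
  have "part l i = 0 \<longleftrightarrow> part m i = 0" for i
    using column(3) less_part_transpose[of i l 0] less_part_transpose[of i m 0] by auto
  then have "part m i \<le> part l i \<longleftrightarrow> part m i - 1 \<le> part l i - 1" for i
    by (metis Suc_le_mono Suc_pred' bot_nat_0.not_eq_extremum diff_is_0_eq' diff_le_mono le_numeral_extra(3))
  then show ?thesis using column by (simp add: contained_iff drop_column.rep_eq)
qed

theorem theorem6:
  fixes J :: "partition \<Rightarrow> ratfun symfun"
    and l m l' m' :: partition
  assumes "is_jack_family J"
    and "contained m l"
    and "contained m' l'"
    and "coincide_up_to_translation (l, m) (l', m')"
  shows "sf_scale (c_lower m l * c_upper l m) (skew_jack J l' m') =
         sf_scale (c_lower m' l' * c_upper l' m') (skew_jack J l m)"
proof -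
  interpret jack_family J by unfold_locales fact
  define H where "H x = hook_product (fst x) (snd x)" for x
  define I where "I x n = jack_inner (J (fst x)) (J (snd x) * J n)" for x n
  have H: "H x \<noteq> 0" if "contained (snd x) (fst x)" for x
    using hook_product_nonzero[OF that] by (simp add: H_def hook_product_def)
  \<comment> \<open>Cross-multiplied form, symmetric in \<open>x\<close> and \<open>y\<close>: it
    covers additions as well as removals.\<close>
  have remove: "H y * I x n = H x * I y n" if "remove_empty x y" for x y n
    using that by cases (simp_all add: H_def I_def jack_inner_row jack_inner_column)
  have "equivclp remove_empty (l, m) (l', m')"
    using assms(4) by (simp add: coincide_up_to_translation_def)
  then have "contained (snd (l', m')) (fst (l', m')) \<and> (\<forall>n. H (l, m) * I (l', m') n = H (l', m') * I (l, m) n)"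
  proof (induction rule: equivclp_induct)
    case base
    show ?case using assms(2) by simp
  next
    case (step y z)
    have yz: "H z * I y n = H y * I z n" for n using step(2) remove[of y z n] remove[of z y n] by auto
    have "contained (snd z) (fst z)" using step(2,3) contained_remove_empty by blast
    moreover have "H (l, m) * I z n = H z * I (l, m) n" for n
    proof -
      \<comment> \<open>The relation is transitive only after cancelling \<open>H y\<close>, which
        is nonzero because the intermediate pair is contained.\<close>
      have "H y * (H (l, m) * I z n) = H (l, m) * (H z * I y n)" by (simp only: yz mult.left_commute)
      also have "\<dots> = H z * (H (l, m) * I y n)" by (simp only: mult.left_commute)
      also have "\<dots> = H y * (H z * I (l, m) n)" using step(3) by (simp only: mult.left_commute)
      finally have "H y * (H (l, m) * I z n) = H y * (H z * I (l, m) n)" .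
      then show ?thesis using H[of y] step(3) by simp
    qed
    ultimately show ?case by blast
  qed
  then show ?thesis
    by (intro J_nondegenerate) (simp add: jack_inner_skew_jack H_def I_def hook_product_def)
qed

end
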